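(* Let $g$ belong to the Schwartz space $S(\mathbb{R})$, let $\eta\in{}^{*}\mathbb{N}\setminus\mathbb{N}$, and let $g_\eta:\overline{\mathbb{R}}_\eta\to{}^{*}\mathbb{C}$ be $g_\eta(x)={}^{*}g([\eta x]/\eta)$. Then $g_\eta$ is $S$-integrable on $(\overline{\mathbb{R}}_\eta,\mathfrak{C}_\eta,\lambda_\eta)$, ${}^{\circ}g_\eta(x)=st^{*}(g_\infty)(x)$ for every $x\in\overline{\mathbb{R}}_\eta$, and $${}^{\circ}\Big(\int_{\overline{\mathbb{R}}_\eta}g_\eta\,d\lambda_\eta\Big)=\int_{\overline{\mathbb{R}}_\eta}st^{*}(g_\infty)\,dL(\lambda_\eta)=\int_{\mathbb{R}}g\,d\mu.$$
   Context: ${}^{*}\mathbb{R}$ is a countably saturated nonstandard extension of $\mathbb{R}$; ${}^{*}g$ is the transfer of $g$, $[\cdot]$ is the integer part, ${}^{\circ}$ denotes standard part (componentwise for complex values), $\mu$ is Lebesgue measure. $S(\mathbb{R})$ consists of smooth $g:\mathbb{R}\to\mathbb{C}$ with $\sup_x|x|^k|g^{(n)}(x)|<\infty$ for all $k,n\ge0$. $\overline{\mathbb{R}}_\eta=\{\tau\in{}^{*}\mathbb{R}:-\eta\le\tau<\eta\}$; $\mathfrak{C}_\eta$ is the internal algebra of internal unions of intervals $[k/\eta,(k+1)/\eta)$, $-\eta^2\le k<\eta^2$; $\lambda_\eta$ gives each such interval mass $1/\eta$, so $\int h\,d\lambda_\eta=\frac1\eta\sum_{k=-\eta^2}^{\eta^2-1}h(k/\eta)$;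 $L(\lambda_\eta)$ is the associated Loeb measure on the Loeb $\sigma$-algebra $L(\mathfrak{C}_\eta)$. An internal $\mathfrak{C}_\eta$-measurable $F:\overline{\mathbb{R}}_\eta\to{}^{*}\mathbb{R}$ is $S$-integrable if $\int|F|\,d\lambda_\eta$ is finite, $\int_A|F|\,d\lambda_\eta\approx0$ for every $A\in\mathfrak{C}_\eta$ with $\lambda_\eta(A)\approx0$, and $\int_A|F|\,d\lambda_\eta\approx0$ for every $A\in\mathfrak{C}_\eta$ on which $|F|$ is infinitesimal; a complex-valued function is $S$-integrable if its real and imaginary parts are. The map $st:\overline{\mathbb{R}}_\eta\to\mathbb{R}\cup\{\pm\infty\}$ sends finite $x$ to ${}^{\circ}x$ and positive/negative infinite $x$ to $+\infty/-\infty$; $g_\infty$ extends $g$ by $g_\infty(\pm\infty)=0$, and $st^{*}(g_\infty)=g_\infty\circ st$. *)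

theory Defs
  imports "HOL-Analysis.Analysis"
begin

section \<open>Nonstandard extensions\<close>

text \<open>
  The standard universe is many-sorted: points of \<open>\<complex>\<close> (which has \<open>\<real>\<close> as a subset),
  sets of points and functions on points.  A nonstandard extension is a complete
  elementary extension of this universe: every finitary relation on it (of any kind, also
  relating points with sets and functions) has a nonstandard interpretation, and the transfer
  principle holds for all first-order formulas over these relations.  A superstructure extension
  of \<open>\<real>\<close> restricts to such an extension, with the same internal sets and internal functions.
\<close>

datatype obj = Num complex | Set "complex set" | Fun "complex \<Rightarrow> complex"

fun num_of :: "obj \<Rightarrow> complex" where
  "num_of (Num z) = z" | "num_of _ = 0"

fun set_of :: "obj \<Rightarrow> complex set" where
  "set_of (Set A) = A" | "set_of _ = {}"

fun fun_of :: "obj \<Rightarrow> complex \<Rightarrow> complex" where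
  "fun_of (Fun f) = f" | "fun_of _ = (\<lambda>_. 0)"

datatype fm =
    Atom "obj list \<Rightarrow> bool" "nat list"
  | Eq nat nat
  | Neg fm
  | Conj fm fm
  | Exi nat fm

primrec sat :: "((obj list \<Rightarrow> bool) \<Rightarrow> 's list \<Rightarrow> bool) \<Rightarrow> (nat \<Rightarrow> 's) \<Rightarrow> fm \<Rightarrow> bool" where
  "sat I e (Atom R vs) \<longleftrightarrow> I R (map e vs)"
| "sat I e (Eq i j) \<longleftrightarrow> e i = e j"
| "sat I e (Neg p) \<longleftrightarrow> \<not> sat I e p"
| "sat I e (Conj p q) \<longleftrightarrow> sat I e p \<and> sat I e q"
| "sat I e (Exi i p) \<longleftrightarrow> (\<exists>x. sat I (e(i := x)) p)"

text \<open>\<open>rel N R\<close> is \<open>\<^sup>*R\<close> and \<open>emb N c\<close> is \<open>\<^sup>*c\<close>.\<close>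

record 's extension =
  rel :: "(obj list \<Rightarrow> bool) \<Rightarrow> 's list \<Rightarrow> bool"
  emb :: "obj \<Rightarrow> 's"

definition nonstandard_extension :: "'s extension \<Rightarrow> bool" where
  "nonstandard_extension N \<longleftrightarrow>
     (\<forall>p e. sat (\<lambda>R. R) e p \<longleftrightarrow> sat (rel N) (\<lambda>i. emb N (e i)) p)"

text \<open>The sets \<open>{x. rel N R (x # p)}\<close> are the internal sets defined with internal parameters \<open>p\<close>.\<close>

definition countably_saturated :: "'s extension \<Rightarrow> bool" where
  "countably_saturated N \<longleftrightarrow>
     (\<forall>(R :: nat \<Rightarrow> obj list \<Rightarrow> bool) (p :: nat \<Rightarrow> 's list).
        (\<forall>n. \<exists>x. \<forall>i\<le>n. rel N (R i) (x # p i)) \<longrightarrow> (\<exists>x. \<forall>i. rel N (R i) (x # p i)))"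

text \<open>The transfer of an operation is the operation whose graph is the transfer of its graph.\<close>

definition star_op :: "'s extension \<Rightarrow> (obj list \<Rightarrow> obj) \<Rightarrow> 's list \<Rightarrow> 's" where
  "star_op N F xs = (THE y. rel N (\<lambda>zs. hd zs = F (tl zs)) (y # xs))"

definition star1 :: "'s extension \<Rightarrow> (complex \<Rightarrow> complex) \<Rightarrow> 's \<Rightarrow> 's" where
  "star1 N f x = star_op N (\<lambda>zs. Num (f (num_of (zs ! 0)))) [x]"

definition star2 :: "'s extension \<Rightarrow> (complex \<Rightarrow> complex \<Rightarrow> complex) \<Rightarrow> 's \<Rightarrow> 's \<Rightarrow> 's" where
  "star2 N f x y = star_op N (\<lambda>zs. Num (f (num_of (zs ! 0)) (num_of (zs ! 1)))) [x, y]"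

definition std :: "'s extension \<Rightarrow> complex \<Rightarrow> 's" where
  "std N z = emb N (Num z)"

text \<open>The internal set coded by an element \<open>a\<close> of \<open>\<^sup>*P(\<complex>)\<close>.\<close>

definition is_set :: "'s extension \<Rightarrow> 's \<Rightarrow> bool" where
  "is_set N a \<longleftrightarrow> rel N (\<lambda>zs. \<exists>A. zs = [Set A]) [a]"

definition ext :: "'s extension \<Rightarrow> 's \<Rightarrow> 's set" where
  "ext N a = {x. rel N (\<lambda>zs. \<exists>z A. zs = [Num z, Set A] \<and> z \<in> A) [x, a]}"

definition internal_set :: "'s extension \<Rightarrow> 's set \<Rightarrow> bool" where
  "internal_set N A \<longleftrightarrow> (\<exists>a. is_set N a \<and> ext N a = A)"

definition star_set :: "'s extension \<Rightarrow> complex set \<Rightarrow> 's set" where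
  "star_set N A = ext N (emb N (Set A))"

text \<open>\<open>f\<close> is an internal function whose restriction to \<open>X\<close> is \<open>F\<close>.\<close>

definition codes_fun_on :: "'s extension \<Rightarrow> 's set \<Rightarrow> ('s \<Rightarrow> 's) \<Rightarrow> 's \<Rightarrow> bool" where
  "codes_fun_on N X F f \<longleftrightarrow>
     rel N (\<lambda>zs. \<exists>h. zs = [Fun h]) [f] \<and>
     (\<forall>x\<in>X. F x = star_op N (\<lambda>zs. Num (fun_of (zs ! 0) (num_of (zs ! 1)))) [f, x])"

definition internal_fun_on :: "'s extension \<Rightarrow> 's set \<Rightarrow> ('s \<Rightarrow> 's) \<Rightarrow> bool" where
  "internal_fun_on N X F \<longleftrightarrow> (\<exists>f. codes_fun_on N X F f)"

definition ns_le :: "'s extension \<Rightarrow> 's \<Rightarrow> 's \<Rightarrow> bool" where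
  "ns_le N x y \<longleftrightarrow>
     rel N (\<lambda>zs. \<exists>a b :: real. zs = [Num (of_real a), Num (of_real b)] \<and> a \<le> b) [x, y]"

definition ns_less :: "'s extension \<Rightarrow> 's \<Rightarrow> 's \<Rightarrow> bool" where
  "ns_less N x y \<longleftrightarrow>
     rel N (\<lambda>zs. \<exists>a b :: real. zs = [Num (of_real a), Num (of_real b)] \<and> a < b) [x, y]"

abbreviation star_norm :: "'s extension \<Rightarrow> 's \<Rightarrow> 's" where
  "star_norm N \<equiv> star1 N (\<lambda>z. of_real (norm z))"

abbreviation star_Re :: "'s extension \<Rightarrow> 's \<Rightarrow> 's" where
  "star_Re N \<equiv> star1 N (\<lambda>z. of_real (Re z))"

abbreviation star_Im :: "'s extension \<Rightarrow> 's \<Rightarrow> 's" where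
  "star_Im N \<equiv> star1 N (\<lambda>z. of_real (Im z))"

definition ns_finite :: "'s extension \<Rightarrow> 's \<Rightarrow> bool" where
  "ns_finite N x \<longleftrightarrow>
     x \<in> star_set N UNIV \<and> (\<exists>r :: real. ns_le N (star_norm N x) (std N (of_real r)))"

definition infinitesimal :: "'s extension \<Rightarrow> 's \<Rightarrow> bool" where
  "infinitesimal N x \<longleftrightarrow>
     x \<in> star_set N UNIV \<and> (\<forall>r :: real. r > 0 \<longrightarrow> ns_less N (star_norm N x) (std N (of_real r)))"

text \<open>Standard parts are meaningful for finite arguments only.\<close>

definition real_st :: "'s extension \<Rightarrow> 's \<Rightarrow> real" where
  "real_st N x = (THE r. infinitesimal N (star2 N (-) x (std N (of_real r))))"

definition complex_st :: "'s extension \<Rightarrow> 's \<Rightarrow> complex" where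
  "complex_st N x = Complex (real_st N (star_Re N x)) (real_st N (star_Im N x))"

definition st_bar :: "'s extension \<Rightarrow> 's \<Rightarrow> ereal" where
  "st_bar N x = (if ns_finite N x then ereal (real_st N x)
                 else if ns_less N (std N 0) x then \<infinity> else - \<infinity>)"


section \<open>The measure space on the bounded hyperreal line\<close>

definition R_bar :: "'s extension \<Rightarrow> 's \<Rightarrow> 's set" where
  "R_bar N \<eta> = {\<tau> \<in> star_set N \<real>. ns_le N (star1 N uminus \<eta>) \<tau> \<and> ns_less N \<tau> \<eta>}"

definition C_alg :: "'s extension \<Rightarrow> 's \<Rightarrow> 's set set" where
  "C_alg N \<eta> = {A. \<exists>K. internal_set N K \<and>
     K \<subseteq> {k \<in> star_set N \<int>. ns_le N (star1 N (\<lambda>z. - z\<^sup>2) \<eta>) k \<and> ns_less N k (star1 N (\<lambda>z. z\<^sup>2) \<eta>)} \<and>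
     A = (\<Union>k\<in>K. {x \<in> star_set N \<real>. ns_le N (star2 N (/) k \<eta>) x \<and>
                                        ns_less N x (star2 N (\<lambda>k n. (k + 1) / n) k \<eta>)})}"

text \<open>
  The standard sum whose transfer defines internal integration over an \<open>A\<close> in the algebra:
  for \<open>n\<close> a natural number, the mean \<open>(1/n) \<Sum> h(k/n)\<close> over the integers
  \<open>-n\<^sup>2 \<le> k < n\<^sup>2\<close> with \<open>k/n \<in> A\<close>.
\<close>

definition grid_sum :: "(complex \<Rightarrow> complex) \<Rightarrow> complex set \<Rightarrow> complex \<Rightarrow> complex" where
  "grid_sum h A n =
     1 / n * (\<Sum>k \<in> {k \<in> {- (\<lfloor>Re n\<rfloor>\<^sup>2) ..< \<lfloor>Re n\<rfloor>\<^sup>2}. of_int k / n \<in> A}. h (of_int k / n))"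

text \<open>
  The integral of an internal \<open>F\<close> over \<open>A\<close>.  The value does not depend on the choice of the
  code \<open>f\<close>, since only the values of \<open>F\<close> at grid points of \<open>A\<close> enter.
\<close>

definition int_lambda :: "'s extension \<Rightarrow> 's \<Rightarrow> 's set \<Rightarrow> ('s \<Rightarrow> 's) \<Rightarrow> 's" where
  "int_lambda N \<eta> A F = (THE v. \<exists>f a.
     codes_fun_on N (R_bar N \<eta>) F f \<and> is_set N a \<and> ext N a = A \<and>
     v = star_op N (\<lambda>zs. Num (grid_sum (fun_of (zs ! 0)) (set_of (zs ! 1)) (num_of (zs ! 2)))) [f, a, \<eta>])"

definition lambda :: "'s extension \<Rightarrow> 's \<Rightarrow> 's set \<Rightarrow> 's" where
  "lambda N \<eta> A = int_lambda N \<eta> A (\<lambda>_. std N 1)"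

text \<open>Measurability in the internal sense: preimages of \<open>*\<close>-Borel sets lie in the algebra.\<close>

definition C_measurable :: "'s extension \<Rightarrow> 's \<Rightarrow> ('s \<Rightarrow> 's) \<Rightarrow> bool" where
  "C_measurable N \<eta> F \<longleftrightarrow>
     (\<forall>b. rel N (\<lambda>zs. \<exists>B \<in> sets borel. zs = [Set B]) [b] \<longrightarrow>
          {x \<in> R_bar N \<eta>. F x \<in> ext N b} \<in> C_alg N \<eta>)"

definition S_integrable_real :: "'s extension \<Rightarrow> 's \<Rightarrow> ('s \<Rightarrow> 's) \<Rightarrow> bool" where
  "S_integrable_real N \<eta> F \<longleftrightarrow>
     (\<forall>x \<in> R_bar N \<eta>. F x \<in> star_set N \<real>) \<and>
     internal_fun_on N (R_bar N \<eta>) F \<and> C_measurable N \<eta> F \<and>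
     ns_finite N (int_lambda N \<eta> (R_bar N \<eta>) (\<lambda>x. star_norm N (F x))) \<and>
     (\<forall>A \<in> C_alg N \<eta>. infinitesimal N (lambda N \<eta> A) \<longrightarrow>
        infinitesimal N (int_lambda N \<eta> A (\<lambda>x. star_norm N (F x)))) \<and>
     (\<forall>A \<in> C_alg N \<eta>. (\<forall>x\<in>A. infinitesimal N (star_norm N (F x))) \<longrightarrow>
        infinitesimal N (int_lambda N \<eta> A (\<lambda>x. star_norm N (F x))))"

definition S_integrable :: "'s extension \<Rightarrow> 's \<Rightarrow> ('s \<Rightarrow> 's) \<Rightarrow> bool" where
  "S_integrable N \<eta> F \<longleftrightarrow>
     (\<forall>x \<in> R_bar N \<eta>. F x \<in> star_set N UNIV) \<and>
     S_integrable_real N \<eta> (\<lambda>x. star_Re N (F x)) \<and>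
     S_integrable_real N \<eta> (\<lambda>x. star_Im N (F x))"

text \<open>
  The Loeb measure: the Caratheodory extension of \<open>A \<mapsto> \<degree>\<lambda>\<^sub>\<eta>(A) \<in> [0,\<infinity>]\<close> to the generated
  sigma algebra, completed.
\<close>

definition st_lambda :: "'s extension \<Rightarrow> 's \<Rightarrow> 's set \<Rightarrow> ennreal" where
  "st_lambda N \<eta> A =
     (if ns_finite N (lambda N \<eta> A) then ennreal (real_st N (lambda N \<eta> A)) else \<infinity>)"

definition Loeb :: "'s extension \<Rightarrow> 's \<Rightarrow> 's measure" where
  "Loeb N \<eta> =
     completion (measure_of (R_bar N \<eta>) (C_alg N \<eta>) (outer_measure (C_alg N \<eta>) (st_lambda N \<eta>)))"



section \<open>Schwartz functions\<close>

definition nth_deriv :: "nat \<Rightarrow> (real \<Rightarrow> complex) \<Rightarrow> real \<Rightarrow> complex" where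
  "nth_deriv n = (\<lambda>f x. vector_derivative f (at x)) ^^ n"

definition Schwartz :: "(real \<Rightarrow> complex) set" where
  "Schwartz = {g. (\<forall>n x. nth_deriv n g differentiable (at x)) \<and>
                  (\<forall>k n. bdd_above (range (\<lambda>x. \<bar>x\<bar> ^ k * norm (nth_deriv n g x))))}"

definition g_infty :: "(real \<Rightarrow> complex) \<Rightarrow> ereal \<Rightarrow> complex" where
  "g_infty g y = (if \<bar>y\<bar> = \<infinity> then 0 else g (real_of_ereal y))"

definition st_pullback :: "'s extension \<Rightarrow> (ereal \<Rightarrow> complex) \<Rightarrow> 's \<Rightarrow> complex" where
  "st_pullback N h x = h (st_bar N x)"

definition g_eta :: "'s extension \<Rightarrow> 's \<Rightarrow> (real \<Rightarrow> complex) \<Rightarrow> 's \<Rightarrow> 's" where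
  "g_eta N \<eta> g x =
     star1 N (\<lambda>z. g (Re z))
       (star2 N (/) (star1 N (\<lambda>z. of_int \<lfloor>Re z\<rfloor>) (star2 N (*) \<eta> x)) \<eta>)"

end

theory Submission
  imports Defs "HOL-Probability.Sinc_Integral"
begin

text \<open>
  The relations that hold at a fixed tuple of nonstandard objects form an ultrafilter, so every
  statement below about finitely many internal objects reduces to a standard statement about all
  large \<open>n\<close>.  With \<open>n\<close> in place of \<open>\<eta>\<close>, the internal integral of \<open>g\<^sub>\<eta>\<close> is a Riemann sum over the grid
  \<open>k/n\<close>, which is the integral of a step function and converges to \<open>\<integral>g\<close> by dominated convergence
  against \<open>1/(1 + x\<^sup>2)\<close>.  S-integrability follows from uniform bounds on such sums: where
  \<open>|g| \<le> \<delta>\<close>, the decay \<open>|g| \<le> C/(1 + x\<^sup>2)\<^sup>2\<close> gives \<open>|g| \<le> \<surd>(\<delta> C)/(1 + x\<^sup>2)\<close>.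
  For the Loeb integral, the push-forward of the Loeb measure on the finite points under the
  standard part map gives every open interval its length, hence is Lebesgue measure.
\<close>

section \<open>Transfer\<close>

text \<open>Every standard relation is an atom of the formula language, so transfer is only needed
  at a fixed tuple of internal objects. The objects in play go into a list \<open>L\<close>, each is
  rewritten as a coordinate germ of \<open>L\<close>, and the claim becomes one relation at
  \<open>L\<close>. A claim about all internal points of a set is reached by contradiction:
  \<open>rel_ex\<close> turns its failure into an internal counterexample. Since inequalities are
  checked for each standard n but used at n = \<open>\<eta>\<close>, their constants must not depend
  on n or on the set summed over. The exponent in the decay C / (1 + x^2)^2 is twice what
  integrability asks, which leaves a factor to spend on smallness. Riemann sums are treated for
  functions continuous almost everywhere, so that one convergence result serves both g and
  indicators of intervals. The standard part map is not internal: preimages of open intervals are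
  exhausted from inside by internal intervals with standard margins. Saturation enters through
  countable additivity of the Loeb premeasure.\<close>

primrec alls :: "nat \<Rightarrow> fm \<Rightarrow> fm" where
  "alls 0 p = p"
| "alls (Suc m) p = Neg (Exi m (Neg (alls m p)))"

text \<open>The outermost quantifier of \<open>alls (Suc m) p\<close> binds variable
  \<open>m\<close>; its value \<open>x\<close> is merged into the assignment \<open>f\<close> of the
  variables below \<open>Suc m\<close>.\<close>

lemma sat_alls: "sat I e (alls m p) \<longleftrightarrow> (\<forall>f. sat I (\<lambda>i. if i < m then f i else e i) p)"
proof (induction m arbitrary: e)
  case (Suc m)
  have eq: "(\<lambda>i. if i < m then f i else (e(m := x)) i) =
      (\<lambda>i. if i < Suc m then (f(m := x)) i else e i)" for f x
    by (auto simp: fun_eq_iff less_Suc_eq)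
  have "sat I e (alls (Suc m) p) \<longleftrightarrow> (\<forall>x. sat I (e(m := x)) (alls m p))"
    by simp
  also have "\<dots> \<longleftrightarrow> (\<forall>x f. sat I (\<lambda>i. if i < Suc m then (f(m := x)) i else e i) p)"
    unfolding Suc.IH eq ..
  also have "\<dots> \<longleftrightarrow> (\<forall>f. sat I (\<lambda>i. if i < Suc m then f i else e i) p)"
  proof (intro iffI allI)
    fix f
    assume "\<forall>x f. sat I (\<lambda>i. if i < Suc m then (f(m := x)) i else e i) p"
    from spec[OF spec[OF this, of "f m"], of f]
    show "sat I (\<lambda>i. if i < Suc m then f i else e i) p"
      unfolding fun_upd_triv .
  next
    fix x f
    assume "\<forall>f. sat I (\<lambda>i. if i < Suc m then f i else e i) p"
    from spec[OF this, of "f(m := x)"]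
    show "sat I (\<lambda>i. if i < Suc m then (f(m := x)) i else e i) p" .
  qed
  finally show ?case .
qed simp

lemma map_nth_upt_eq_drop:
  "length zs = m + n \<Longrightarrow> map (\<lambda>i. zs ! i) [m..<m + n] = drop m zs"
  by (rule nth_equalityI) simp_all

section \<open>Relations that hold at a fixed internal tuple\<close>

locale ns_ext =
  fixes N :: "'s extension"
  assumes transfer: "nonstandard_extension N"
begin

text \<open>Variables past the end of the tuple get a standard value, so that only finitely many
  values are possibly nonstandard. Those are the ones that \<open>alls\<close> quantifies
  away.\<close>

definition env :: "'s list \<Rightarrow> nat \<Rightarrow> 's" where
  "env xs i = (if i < length xs then xs ! i else emb N (Num 0))"

lemma map_env [simp]: "map (env xs) [0..<length xs] = xs"
  by (rule nth_equalityI) (simp_all add: env_def)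

text \<open>\<open>nonstandard_extension\<close> speaks only of environments made of embedded
  standard objects. Arbitrary internal parameters are reached by transferring the universal closure
  and then instantiating it at \<open>xs\<close>.\<close>

lemma sat_transfer:
  assumes "\<And>e. sat (\<lambda>R. R) e p"
  shows "sat (rel N) (env xs) p"
proof -
  have "sat (\<lambda>R. R) (\<lambda>_. Num 0) (alls (length xs) p)"
    using assms by (simp add: sat_alls)
  then have "sat (rel N) (\<lambda>_. emb N (Num 0)) (alls (length xs) p)"
    using transfer by (simp add: nonstandard_extension_def)
  then have "sat (rel N) (\<lambda>i. if i < length xs then (\<lambda>i. xs ! i) i else emb N (Num 0)) p"
    unfolding sat_alls by blast
  then show ?thesis
    by (simp add: env_def[abs_def])
qed

lemma sat_transfer_iff:
  assumes "\<And>e. sat (\<lambda>R. R) e p \<longleftrightarrow> sat (\<lambda>R. R) e q"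
  shows "sat (rel N) (env xs) p \<longleftrightarrow> sat (rel N) (env xs) q"
  using sat_transfer[of "Conj (Neg (Conj p (Neg q))) (Neg (Conj q (Neg p)))" xs] assms by auto

text \<open>On the left the conjunction sits inside a single atom, on the right it belongs to the
  formula language. The two formulas agree in all standard environments, which is all that
  \<open>sat_transfer_iff\<close> asks.\<close>

lemma rel_conj: "rel N (\<lambda>zs. R zs \<and> S zs) xs \<longleftrightarrow> rel N R xs \<and> rel N S xs"
proof -
  let ?v = "[0..<length xs]"
  have "sat (rel N) (env xs) (Atom (\<lambda>zs. R zs \<and> S zs) ?v) \<longleftrightarrow>
      sat (rel N) (env xs) (Conj (Atom R ?v) (Atom S ?v))"
    by (rule sat_transfer_iff) simp
  then show ?thesis by simp
qed

lemma rel_not: "rel N (\<lambda>zs. \<not> R zs) xs \<longleftrightarrow> \<not> rel N R xs"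
proof -
  let ?v = "[0..<length xs]"
  have "sat (rel N) (env xs) (Atom (\<lambda>zs. \<not> R zs) ?v) \<longleftrightarrow>
      sat (rel N) (env xs) (Neg (Atom R ?v))"
    by (rule sat_transfer_iff) simp
  then show ?thesis by simp
qed

text \<open>The bound variable is number \<open>length xs\<close>, the first one that the tuple
  leaves free. Read from left to right, this produces internal witnesses, in particular internal
  counterexamples to universal claims.\<close>

lemma rel_ex: "rel N (\<lambda>zs. \<exists>z. R (z # zs)) xs \<longleftrightarrow> (\<exists>x. rel N R (x # xs))"
proof -
  let ?v = "[0..<length xs]"
  have m: "map (e(length xs := x)) ?v = map e ?v" for e :: "nat \<Rightarrow> 'b" and x
    by auto
  have "sat (rel N) (env xs) (Atom (\<lambda>zs. \<exists>z. R (z # zs)) ?v) \<longleftrightarrow>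
      sat (rel N) (env xs) (Exi (length xs) (Atom R (length xs # ?v)))"
    by (rule sat_transfer_iff) (simp add: m del: map_eq_conv)
  then show ?thesis by (simp add: m del: map_eq_conv)
qed

lemma rel_valid:
  assumes "\<And>zs. length zs = length xs \<Longrightarrow> R zs"
  shows "rel N R xs"
proof -
  have "sat (rel N) (env xs) (Atom R [0..<length xs])"
    by (rule sat_transfer) (use assms in simp)
  then show ?thesis by simp
qed

lemma rel_mono:
  assumes "rel N R xs" and "\<And>zs. length zs = length xs \<Longrightarrow> R zs \<Longrightarrow> S zs"
  shows "rel N S xs"
proof -
  have "rel N (\<lambda>zs. \<not> (R zs \<and> \<not> S zs)) xs"
    by (rule rel_valid) (use assms in blast)
  then show ?thesis
    using assms(1) rel_not[of "\<lambda>zs. R zs \<and> \<not> S zs" xs] rel_conj[of R "\<lambda>zs. \<not> S zs" xs] rel_not[of S xs]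
    by blast
qed

lemma rel_cong:
  assumes "\<And>zs. length zs = length xs \<Longrightarrow> R zs \<longleftrightarrow> S zs"
  shows "rel N R xs \<longleftrightarrow> rel N S xs"
  using assms by (meson rel_mono)

lemma rel_mp2:
  assumes "rel N P xs" "rel N Q xs" and "\<And>zs. length zs = length xs \<Longrightarrow> P zs \<Longrightarrow> Q zs \<Longrightarrow> S zs"
  shows "rel N S xs"
  by (rule rel_mono[of "\<lambda>zs. P zs \<and> Q zs"]) (use assms in \<open>auto simp: rel_conj\<close>)

lemma rel_mp3:
  assumes "rel N P xs" "rel N Q xs" "rel N R xs"
    and "\<And>zs. length zs = length xs \<Longrightarrow> P zs \<Longrightarrow> Q zs \<Longrightarrow> R zs \<Longrightarrow> S zs"
  shows "rel N S xs"
  by (rule rel_mono[of "\<lambda>zs. P zs \<and> Q zs \<and> R zs"]) (use assms in \<open>auto simp: rel_conj\<close>)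

lemma rel_False: "\<not> rel N (\<lambda>_. False) xs"
  using rel_valid[of xs "\<lambda>_. True"] rel_not[of "\<lambda>_. True" xs] by simp

lemma rel_const: "rel N (\<lambda>_. P) xs \<longleftrightarrow> P"
  using rel_False rel_valid by (cases P) auto

text \<open>Covers permuting, duplicating and dropping coordinates at once. Indices are confined to
  the tuple because \<open>!\<close> is unspecified beyond it.\<close>

lemma rel_reindex:
  assumes "\<And>i. i \<in> set is \<Longrightarrow> i < length xs"
  shows "rel N (\<lambda>zs. R (map (\<lambda>i. zs ! i) is)) xs \<longleftrightarrow> rel N R (map (\<lambda>i. xs ! i) is)"
proof -
  let ?v = "[0..<length xs]"
  have m: "map (\<lambda>i. map e ?v ! i) is = map e is" for e :: "nat \<Rightarrow> 'b"
    using assms by auto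
  have "sat (rel N) (env xs) (Atom (\<lambda>zs. R (map (\<lambda>i. zs ! i) is)) ?v) \<longleftrightarrow>
      sat (rel N) (env xs) (Atom R is)"
    by (rule sat_transfer_iff) (simp only: sat.simps m)
  moreover have "map (env xs) is = map (\<lambda>i. xs ! i) is"
    using assms by (auto simp: env_def)
  ultimately show ?thesis by simp
qed

lemma rel_append_left:
  "rel N (\<lambda>zs. R (take (length xs) zs)) (xs @ ys) \<longleftrightarrow> rel N R xs"
proof -
  have 1: "map (\<lambda>i. (xs @ ys) ! i) [0..<length xs] = xs"
    by (auto intro: nth_equalityI simp: nth_append)
  have "rel N (\<lambda>zs. R (take (length xs) zs)) (xs @ ys) \<longleftrightarrow>
      rel N (\<lambda>zs. R (map (\<lambda>i. zs ! i) [0..<length xs])) (xs @ ys)"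
    by (rule rel_cong) (auto intro!: arg_cong[of _ _ R] nth_equalityI)
  also have "\<dots> \<longleftrightarrow> rel N R xs"
    by (subst rel_reindex) (auto simp: 1 simp del: map_eq_conv)
  finally show ?thesis .
qed

lemma rel_append_right:
  "rel N (\<lambda>zs. R (drop (length xs) zs)) (xs @ ys) \<longleftrightarrow> rel N R ys"
proof -
  let ?is = "[length xs..<length xs + length ys]"
  have 1: "map (\<lambda>i. (xs @ ys) ! i) ?is = ys"
    by (auto intro: nth_equalityI simp: nth_append)
  have "rel N (\<lambda>zs. R (drop (length xs) zs)) (xs @ ys) \<longleftrightarrow>
      rel N (\<lambda>zs. R (map (\<lambda>i. zs ! i) ?is)) (xs @ ys)"
  proof (rule rel_cong)
    fix zs :: "obj list" assume "length zs = length (xs @ ys)"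
    then have "drop (length xs) zs = map (\<lambda>i. zs ! i) ?is"
      by (intro map_nth_upt_eq_drop[symmetric]) simp
    then show "R (drop (length xs) zs) \<longleftrightarrow> R (map (\<lambda>i. zs ! i) ?is)" by simp
  qed
  also have "\<dots> \<longleftrightarrow> rel N R ys"
    by (subst rel_reindex) (auto simp: 1 simp del: map_eq_conv)
  finally show ?thesis .
qed

text \<open>\<open>Eq\<close> is read as true equality in the extension, hence the transferred
  equality relation is the identity. Uniqueness of transferred values rests on this.\<close>

lemma rel_eq: "rel N (\<lambda>zs. zs ! 0 = zs ! 1) [x, y] \<longleftrightarrow> x = y"
proof -
  have "sat (rel N) (env [x, y]) (Atom (\<lambda>zs. zs ! 0 = zs ! 1) [0, 1]) \<longleftrightarrow>
      sat (rel N) (env [x, y]) (Eq 0 1)"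
    by (rule sat_transfer_iff) simp
  then show ?thesis by (simp add: env_def)
qed

section \<open>Standard constants and transferred operations as germs\<close>

lemma rel_emb: "rel N R (map (emb N) cs) \<longleftrightarrow> R cs"
proof -
  have "sat (\<lambda>R. R) ((!) cs) (Atom R [0..<length cs]) \<longleftrightarrow>
      sat (rel N) (\<lambda>i. emb N (cs ! i)) (Atom R [0..<length cs])"
    by (rule transfer[unfolded nonstandard_extension_def, THEN spec, THEN spec])
  moreover have "map (\<lambda>i. emb N (cs ! i)) [0..<length cs] = map (emb N) cs"
    by (rule nth_equalityI) simp_all
  ultimately show ?thesis by (simp add: map_nth del: map_eq_conv)
qed

text \<open>Justifies the \<open>THE\<close> in \<open>star_op\<close>. A value exists because every
  standard tuple has one; for uniqueness both candidates are put in front of the same parameters,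
  where each equals \<open>F\<close> of the remaining coordinates.\<close>

lemma ex1_star_op: "\<exists>!y. rel N (\<lambda>zs. hd zs = F (tl zs)) (y # xs)"
proof (rule ex_ex1I)
  show "\<exists>y. rel N (\<lambda>zs. hd zs = F (tl zs)) (y # xs)"
    using rel_ex[of "\<lambda>zs. hd zs = F (tl zs)" xs] by (simp add: rel_const)
next
  fix y z
  assume y: "rel N (\<lambda>zs. hd zs = F (tl zs)) (y # xs)"
    and z: "rel N (\<lambda>zs. hd zs = F (tl zs)) (z # xs)"
  let ?l = "[y, z] @ xs"
  have "rel N (\<lambda>zs. zs ! 1 = F (drop 2 zs)) ?l"
  proof -
    have "rel N (\<lambda>zs. hd (drop 1 zs) = F (tl (drop 1 zs))) ?l"
      using z rel_append_right[of "\<lambda>zs. hd zs = F (tl zs)" "[y]" "z # xs"] by simp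
    then show ?thesis
    proof (rule rel_mono)
      fix zs :: "obj list"
      assume "length zs = length ?l" "hd (drop 1 zs) = F (tl (drop 1 zs))"
      then show "zs ! 1 = F (drop 2 zs)"
        by (cases zs; cases "tl zs") auto
    qed
  qed
  moreover have "rel N (\<lambda>zs. zs ! 0 = F (drop 2 zs)) ?l"
  proof -
    let ?is = "0 # [2..<2 + length xs]"
    have m: "map (\<lambda>i. ?l ! i) ?is = y # xs"
      using map_nth_upt_eq_drop[of ?l 2 "length xs"] by (simp del: upt_Suc map_eq_conv)
    have "rel N (\<lambda>zs. hd (map (\<lambda>i. zs ! i) ?is) = F (tl (map (\<lambda>i. zs ! i) ?is))) ?l"
      by (subst rel_reindex[where R="\<lambda>zs. hd zs = F (tl zs)"])
        (use y m in \<open>auto simp del: map_eq_conv\<close>)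
    then show ?thesis
    proof (rule rel_mono)
      fix zs :: "obj list"
      assume l: "length zs = length ?l"
        and h: "hd (map (\<lambda>i. zs ! i) ?is) = F (tl (map (\<lambda>i. zs ! i) ?is))"
      have "map (\<lambda>i. zs ! i) [2..<2 + length xs] = drop 2 zs"
        using l by (intro map_nth_upt_eq_drop) simp
      then show "zs ! 0 = F (drop 2 zs)" using h by (simp del: upt_Suc)
    qed
  qed
  ultimately have "rel N (\<lambda>zs. zs ! 0 = zs ! 1) ?l"
    by (rule rel_mp2) simp
  then have "rel N (\<lambda>zs. zs ! 0 = zs ! 1) [y, z]"
    using rel_append_left[of "\<lambda>zs. zs ! 0 = zs ! 1" "[y,z]" xs] by simp
  then show "y = z" by (rule rel_eq[THEN iffD1])
qed

lemma rel_star_op: "rel N (\<lambda>zs. hd zs = F (tl zs)) (star_op N F xs # xs)"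
  unfolding star_op_def by (rule theI'[OF ex1_star_op])

lemma star_opI: "rel N (\<lambda>zs. hd zs = F (tl zs)) (y # xs) \<Longrightarrow> star_op N F xs = y"
  using rel_star_op ex1_star_op by blast

text \<open>As in an ultrapower, \<open>star_op N F xs\<close> plays the role of the germ of \<open>F\<close> at \<open>xs\<close>.\<close>

lemma rel_map_star_op:
  "rel N R (map (\<lambda>F. star_op N F xs) Fs) \<longleftrightarrow> rel N (\<lambda>zs. R (map (\<lambda>F. F zs) Fs)) xs"
proof -
  let ?ys = "map (\<lambda>F. star_op N F xs) Fs"
  let ?m = "length Fs"
  have i: "rel N (\<lambda>zs. zs ! i = (Fs ! i) (drop ?m zs)) (?ys @ xs)" if "i < ?m" for i
  proof -
    let ?is = "i # [?m..<?m + length xs]"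
    have m: "map (\<lambda>j. (?ys @ xs) ! j) ?is = star_op N (Fs ! i) xs # xs"
      using that map_nth_upt_eq_drop[of "?ys @ xs" ?m "length xs"]
      by (simp add: nth_append del: upt_Suc map_eq_conv)
    have "rel N (\<lambda>zs. hd (map (\<lambda>i. zs ! i) ?is) = (Fs ! i) (tl (map (\<lambda>i. zs ! i) ?is))) (?ys @ xs)"
      using that m rel_star_op[of "Fs ! i" xs]
      by (subst rel_reindex[where R="\<lambda>zs. hd zs = (Fs ! i) (tl zs)"]) (auto simp del: map_eq_conv)
    then show ?thesis
    proof (rule rel_mono)
      fix zs :: "obj list"
      assume l: "length zs = length (?ys @ xs)"
        and h: "hd (map (\<lambda>i. zs ! i) ?is) = (Fs ! i) (tl (map (\<lambda>i. zs ! i) ?is))"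
      have "map (\<lambda>i. zs ! i) [?m..<?m + length xs] = drop ?m zs"
        using l by (intro map_nth_upt_eq_drop) simp
      then show "zs ! i = (Fs ! i) (drop ?m zs)" using h by simp
    qed
  qed
  have all: "rel N (\<lambda>zs. \<forall>i<j. zs ! i = (Fs ! i) (drop ?m zs)) (?ys @ xs)" if "j \<le> ?m" for j
    using that
  proof (induction j)
    case (Suc j)
    then have "rel N (\<lambda>zs. \<forall>i<j. zs ! i = (Fs ! i) (drop ?m zs)) (?ys @ xs)"
      "rel N (\<lambda>zs. zs ! j = (Fs ! j) (drop ?m zs)) (?ys @ xs)"
      using i[of j] by simp_all
    then show ?case
      by (rule rel_mp2) (simp add: less_Suc_eq)
  qed (simp add: rel_const)
  have *: "rel N (\<lambda>zs. take ?m zs = map (\<lambda>F. F (drop ?m zs)) Fs) (?ys @ xs)"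
    by (rule rel_mono[OF all[OF order_refl]]) (auto intro!: nth_equalityI)
  have "rel N R ?ys \<longleftrightarrow> rel N (\<lambda>zs. R (take ?m zs)) (?ys @ xs)"
    using rel_append_left[of R ?ys xs] by simp
  also have "\<dots> \<longleftrightarrow> rel N (\<lambda>zs. R (map (\<lambda>F. F (drop ?m zs)) Fs)) (?ys @ xs)"
  proof
    assume "rel N (\<lambda>zs. R (take ?m zs)) (?ys @ xs)"
    with * show "rel N (\<lambda>zs. R (map (\<lambda>F. F (drop ?m zs)) Fs)) (?ys @ xs)"
      by (rule rel_mp2) simp
  next
    assume "rel N (\<lambda>zs. R (map (\<lambda>F. F (drop ?m zs)) Fs)) (?ys @ xs)"
    with * show "rel N (\<lambda>zs. R (take ?m zs)) (?ys @ xs)"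
      by (rule rel_mp2) simp
  qed
  also have "\<dots> \<longleftrightarrow> rel N (\<lambda>zs. R (map (\<lambda>F. F zs) Fs)) xs"
    using rel_append_right[of "\<lambda>zs. R (map (\<lambda>F. F zs) Fs)" ?ys xs] by simp
  finally show ?thesis .
qed

lemma rel_star_op1: "rel N R [star_op N F xs] \<longleftrightarrow> rel N (\<lambda>zs. R [F zs]) xs"
  using rel_map_star_op[of R xs "[F]"] by simp

lemma rel_star_op2:
  "rel N R [star_op N F xs, star_op N G xs] \<longleftrightarrow> rel N (\<lambda>zs. R [F zs, G zs]) xs"
  using rel_map_star_op[of R xs "[F, G]"] by simp

lemma star_op_eq_iff: "star_op N F xs = star_op N G xs \<longleftrightarrow> rel N (\<lambda>zs. F zs = G zs) xs"
  unfolding rel_eq[symmetric] rel_star_op2 by simp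

text \<open>With the composite added as an extra coordinate, the defining relation of the outer
  operation becomes an instance of \<open>rel_map_star_op\<close>, where it holds
  identically.\<close>

lemma star_op_comp:
  "star_op N G (map (\<lambda>F. star_op N F xs) Fs) = star_op N (\<lambda>zs. G (map (\<lambda>F. F zs) Fs)) xs"
proof (rule star_opI)
  let ?K = "\<lambda>zs. G (map (\<lambda>F. F zs) Fs)"
  have "rel N (\<lambda>zs. hd zs = G (tl zs)) (map (\<lambda>F. star_op N F xs) (?K # Fs))"
    by (subst rel_map_star_op) (simp add: rel_const)
  then show "rel N (\<lambda>zs. hd zs = G (tl zs)) (star_op N ?K xs # map (\<lambda>F. star_op N F xs) Fs)"
    by simp
qed

lemma star_op_comp1: "star_op N G [star_op N F xs] = star_op N (\<lambda>zs. G [F zs]) xs"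
  using star_op_comp[of G xs "[F]"] by simp

lemma star_op_comp2:
  "star_op N G [star_op N F xs, star_op N F' xs] = star_op N (\<lambda>zs. G [F zs, F' zs]) xs"
  using star_op_comp[of G xs "[F, F']"] by simp

lemma star_op_comp3:
  "star_op N G [star_op N F xs, star_op N F' xs, star_op N F'' xs] =
     star_op N (\<lambda>zs. G [F zs, F' zs, F'' zs]) xs"
  using star_op_comp[of G xs "[F, F', F'']"] by simp

text \<open>Makes every internal object a germ, namely a projection of any tuple that contains it.
  This is how arbitrary points, codes and \<open>\<eta>\<close> enter the calculus.\<close>

lemma star_op_nth:
  assumes "i < length xs"
  shows "star_op N (\<lambda>zs. zs ! i) xs = xs ! i"
proof (rule star_opI)
  let ?is = "i # [0..<length xs]"
  have m: "map (\<lambda>i. xs ! i) ?is = xs ! i # xs" by (simp add: map_nth)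
  have "rel N (\<lambda>zs. hd (map (\<lambda>i. zs ! i) ?is) = tl (map (\<lambda>i. zs ! i) ?is) ! i) xs"
    using assms by (intro rel_valid) simp
  then show "rel N (\<lambda>zs. hd zs = tl zs ! i) (xs ! i # xs)"
    using assms m by (subst (asm) rel_reindex[where R="\<lambda>zs. hd zs = tl zs ! i"]) auto
qed

lemma star_op_const: "star_op N (\<lambda>_. c) xs = emb N c"
proof (rule star_opI)
  have "rel N (\<lambda>zs. hd zs = c) ([emb N c] @ xs)"
  proof -
    have "rel N (\<lambda>zs. hd (take (length [emb N c]) zs) = c) ([emb N c] @ xs)"
      using rel_emb[of "\<lambda>zs. hd zs = c" "[c]"]
      by (subst rel_append_left[where R="\<lambda>zs. hd zs = c"]) simp
    then show ?thesis by (rule rel_mono) (auto simp: hd_take)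
  qed
  then show "rel N (\<lambda>zs. hd zs = c) (emb N c # xs)" by simp
qed

end

section \<open>Germs of numbers, sets and functions\<close>

text \<open>For a positive natural number \<open>n\<close> and real \<open>z\<close> this is the
  left endpoint of the grid interval [k/n, (k+1)/n) containing \<open>z\<close>. It serves both as
  the rounding in \<open>g_eta\<close> and as the test for membership in the algebra. The type is
  complex because points of the standard universe are.\<close>

definition cell :: "complex \<Rightarrow> complex \<Rightarrow> complex" where
  "cell n z = of_int \<lfloor>Re (n * z)\<rfloor> / n"

context ns_ext
begin

lemma std_star_op: "std N c = star_op N (\<lambda>_. Num c) xs"
  by (simp add: std_def star_op_const)

lemma star1_star_op [simp]:
  "star1 N f (star_op N F xs) = star_op N (\<lambda>zs. Num (f (num_of (F zs)))) xs"
  by (simp add: star1_def star_op_comp1)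

lemma star2_star_op [simp]:
  "star2 N f (star_op N F xs) (star_op N G xs) =
     star_op N (\<lambda>zs. Num (f (num_of (F zs)) (num_of (G zs)))) xs"
  by (simp add: star2_def star_op_comp2)

lemma ns_le_star_op:
  "ns_le N (star_op N F xs) (star_op N G xs) \<longleftrightarrow>
     rel N (\<lambda>zs. \<exists>a b :: real. F zs = Num (of_real a) \<and> G zs = Num (of_real b) \<and> a \<le> b) xs"
  by (simp add: ns_le_def rel_star_op2)

lemma ns_less_star_op:
  "ns_less N (star_op N F xs) (star_op N G xs) \<longleftrightarrow>
     rel N (\<lambda>zs. \<exists>a b :: real. F zs = Num (of_real a) \<and> G zs = Num (of_real b) \<and> a < b) xs"
  by (simp add: ns_less_def rel_star_op2)

lemma ext_star_op:
  "star_op N F xs \<in> ext N (star_op N G xs) \<longleftrightarrow>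
     rel N (\<lambda>zs. \<exists>z A. F zs = Num z \<and> G zs = Set A \<and> z \<in> A) xs"
  by (simp add: ext_def rel_star_op2)

lemma star_set_star_op:
  "star_op N F xs \<in> star_set N A \<longleftrightarrow> rel N (\<lambda>zs. \<exists>z\<in>A. F zs = Num z) xs"
proof -
  have "star_op N F xs \<in> star_set N A \<longleftrightarrow> star_op N F xs \<in> ext N (star_op N (\<lambda>_. Set A) xs)"
    by (simp add: star_set_def star_op_const)
  also have "\<dots> \<longleftrightarrow> rel N (\<lambda>zs. \<exists>z\<in>A. F zs = Num z) xs"
    unfolding ext_star_op by (rule rel_cong) auto
  finally show ?thesis .
qed

lemma is_set_star_op: "is_set N (star_op N F xs) \<longleftrightarrow> rel N (\<lambda>zs. \<exists>A. F zs = Set A) xs"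
  by (simp add: is_set_def rel_star_op1)

lemma is_set_Set [simp]: "is_set N (star_op N (\<lambda>zs. Set (A zs)) xs)"
  by (simp add: is_set_star_op rel_const)

text \<open>If two set codes differ, then so do the standard sets at germ level, and
  \<open>rel_ex\<close> yields an internal point in their symmetric difference. This makes the
  choice of a code of the domain in \<open>int_lambda\<close> harmless.\<close>

lemma is_set_ext_eqD:
  assumes a: "is_set N a" and b: "is_set N b" and eq: "ext N a = ext N b"
  shows "a = b"
proof (rule ccontr)
  assume "a \<noteq> b"
  have "rel N (\<lambda>zs. \<exists>z. \<exists>w. z = Num w \<and> (w \<in> set_of (zs ! 0) \<longleftrightarrow> w \<notin> set_of (zs ! 1))) [a, b]"
  proof -
    define L where "L = [a, b]"
    have e: "a = star_op N (\<lambda>zs. zs ! 0) L" "b = star_op N (\<lambda>zs. zs ! 1) L"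
      using star_op_nth[of _ L] by (simp_all add: L_def)
    have "rel N (\<lambda>zs. zs ! 0 \<noteq> zs ! 1) L"
      using \<open>a \<noteq> b\<close> unfolding e star_op_eq_iff rel_not .
    moreover have "rel N (\<lambda>zs. \<exists>A. zs ! 0 = Set A) L" "rel N (\<lambda>zs. \<exists>A. zs ! 1 = Set A) L"
      using a b unfolding e is_set_star_op .
    ultimately show ?thesis
      unfolding L_def[symmetric] by (rule rel_mp3) auto
  qed
  then have "\<exists>x. rel N (\<lambda>zs. \<exists>w. zs ! 0 = Num w \<and>
      (w \<in> set_of (zs ! 1) \<longleftrightarrow> w \<notin> set_of (zs ! 2))) [x, a, b]"
    using rel_ex[of "\<lambda>zs. \<exists>w. zs ! 0 = Num w \<and> (w \<in> set_of (zs ! 1) \<longleftrightarrow> w \<notin> set_of (zs ! 2))" "[a, b]"]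
    by (simp add: numeral_2_eq_2)
  then obtain x where x: "rel N (\<lambda>zs. \<exists>w. zs ! 0 = Num w \<and>
      (w \<in> set_of (zs ! 1) \<longleftrightarrow> w \<notin> set_of (zs ! 2))) [x, a, b]" ..
  define L where "L = [x, a, b]"
  have e: "x = star_op N (\<lambda>zs. zs ! 0) L" "a = star_op N (\<lambda>zs. zs ! 1) L"
      "b = star_op N (\<lambda>zs. zs ! 2) L"
    using star_op_nth[of _ L] by (simp_all add: L_def numeral_2_eq_2)
  have A: "rel N (\<lambda>zs. \<exists>A. zs ! 1 = Set A) L" and B: "rel N (\<lambda>zs. \<exists>A. zs ! 2 = Set A) L"
    using a b unfolding e is_set_star_op .
  let ?P = "\<lambda>zs. \<exists>z A. zs ! 0 = Num z \<and> zs ! 1 = Set A \<and> z \<in> A"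
  let ?Q = "\<lambda>zs. \<exists>z A. zs ! 0 = Num z \<and> zs ! 2 = Set A \<and> z \<in> A"
  have "rel N ?P L \<longleftrightarrow> rel N ?Q L"
    using eq unfolding e ext_star_op[symmetric] by simp
  moreover have "rel N (\<lambda>zs. ?P zs \<longleftrightarrow> \<not> ?Q zs) L"
    by (rule rel_mp3[OF x[folded L_def] A B]) auto
  moreover have "rel N (\<lambda>zs. ?P zs \<longleftrightarrow> \<not> ?Q zs) L \<longleftrightarrow> (rel N ?P L \<longleftrightarrow> \<not> rel N ?Q L)"
  proof -
    have "rel N (\<lambda>zs. ?P zs \<longleftrightarrow> \<not> ?Q zs) L \<longleftrightarrow>
        rel N (\<lambda>zs. \<not> (?P zs \<and> ?Q zs) \<and> \<not> (\<not> ?P zs \<and> \<not> ?Q zs)) L"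
      by (rule rel_cong) blast
    then show ?thesis by (simp only: rel_conj rel_not) blast
  qed
  ultimately show False by blast
qed

text \<open>Brings a code into the shape \<open>Set (A zs)\<close> in which the formulas for
  integrals and measures are stated; the default value of \<open>set_of\<close> is never met because
  the object is a set code.\<close>

lemma is_set_germ:
  assumes "is_set N (xs ! i)" "i < length xs"
  shows "xs ! i = star_op N (\<lambda>zs. Set (set_of (zs ! i))) xs"
proof -
  have e: "star_op N (\<lambda>zs. zs ! i) xs = xs ! i" by (rule star_op_nth[OF assms(2)])
  have "rel N (\<lambda>zs. \<exists>A. zs ! i = Set A) xs"
    using assms(1) unfolding e[symmetric] is_set_star_op .
  then have "star_op N (\<lambda>zs. zs ! i) xs = star_op N (\<lambda>zs. Set (set_of (zs ! i))) xs"
    unfolding star_op_eq_iff by (rule rel_mono) auto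
  then show ?thesis unfolding e .
qed

section \<open>Finite, infinitesimal and near-standard germs\<close>

lemma ns_finite_germ:
  "ns_finite N (star_op N (\<lambda>zs. Num (F zs)) xs) \<longleftrightarrow> (\<exists>r. rel N (\<lambda>zs. norm (F zs) \<le> r) xs)"
  unfolding ns_finite_def std_star_op[of _ xs] star1_star_op ns_le_star_op star_set_star_op
  by (simp add: rel_const)

lemma infinitesimal_germ:
  "infinitesimal N (star_op N (\<lambda>zs. Num (F zs)) xs) \<longleftrightarrow>
     (\<forall>r>0. rel N (\<lambda>zs. norm (F zs) < r) xs)"
  unfolding infinitesimal_def std_star_op[of _ xs] star1_star_op ns_less_star_op star_set_star_op
  by (simp add: rel_const)

lemma real_st_germ:
  assumes "\<And>r. r > 0 \<Longrightarrow> rel N (\<lambda>zs. norm (F zs - of_real c) < r) xs"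
  shows "real_st N (star_op N (\<lambda>zs. Num (F zs)) xs) = c"
  unfolding real_st_def std_star_op[of _ xs] star2_star_op infinitesimal_germ num_of.simps
proof (rule the_equality)
  show "\<forall>r>0. rel N (\<lambda>zs. norm (F zs - of_real c) < r) xs" using assms by blast
next
  fix d assume d: "\<forall>r>0. rel N (\<lambda>zs. norm (F zs - of_real d) < r) xs"
  show "d = c"
  proof (rule ccontr)
    assume "d \<noteq> c"
    then have pos: "\<bar>d - c\<bar> / 2 > 0" by simp
    have "rel N (\<lambda>_. False) xs"
    proof (rule rel_mp2[OF assms[OF pos] d[rule_format, OF pos]])
      fix zs :: "obj list"
      assume 1: "norm (F zs - of_real c) < \<bar>d - c\<bar> / 2" and 2: "norm (F zs - of_real d) < \<bar>d - c\<bar> / 2"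
      have "\<bar>d - c\<bar> = norm ((F zs - of_real c) - (F zs - of_real d))"
        using norm_of_real[of "d - c", where 'a=complex] by simp
      also have "\<dots> \<le> norm (F zs - of_real c) + norm (F zs - of_real d)"
        by (rule norm_triangle_ineq4)
      finally show False using 1 2 by simp
    qed
    then show False by (simp add: rel_const)
  qed
qed

lemma complex_st_germ:
  assumes "\<And>r. r > 0 \<Longrightarrow> rel N (\<lambda>zs. norm (F zs - c) < r) xs"
  shows "complex_st N (star_op N (\<lambda>zs. Num (F zs)) xs) = c"
proof -
  have "real_st N (star_op N (\<lambda>zs. Num (of_real (Re (F zs)))) xs) = Re c"
  proof (rule real_st_germ)
    fix r :: real assume "r > 0"
    from assms[OF this] show "rel N (\<lambda>zs. norm (complex_of_real (Re (F zs)) - of_real (Re c)) < r) xs"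
    proof (rule rel_mono)
      fix zs assume "norm (F zs - c) < r"
      then show "norm (complex_of_real (Re (F zs)) - of_real (Re c)) < r"
        using abs_Re_le_cmod[of "F zs - c"]
        by (simp only: of_real_diff[symmetric] norm_of_real minus_complex.sel)
    qed
  qed
  moreover have "real_st N (star_op N (\<lambda>zs. Num (of_real (Im (F zs)))) xs) = Im c"
  proof (rule real_st_germ)
    fix r :: real assume "r > 0"
    from assms[OF this] show "rel N (\<lambda>zs. norm (complex_of_real (Im (F zs)) - of_real (Im c)) < r) xs"
    proof (rule rel_mono)
      fix zs assume "norm (F zs - c) < r"
      then show "norm (complex_of_real (Im (F zs)) - of_real (Im c)) < r"
        using abs_Im_le_cmod[of "F zs - c"]
        by (simp only: of_real_diff[symmetric] norm_of_real minus_complex.sel)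
    qed
  qed
  ultimately show ?thesis by (simp add: complex_st_def)
qed

text \<open>Existence of the standard part is completeness of the reals: it is the supremum of the
  standard lower bounds, a set that the bound \<open>b\<close> keeps nonempty and bounded
  above.\<close>

lemma ex_real_st_germ:
  fixes F :: "obj list \<Rightarrow> complex"
  assumes fin: "rel N (\<lambda>zs. norm (F zs) \<le> b) xs" and real: "rel N (\<lambda>zs. F zs \<in> \<real>) xs"
  obtains c :: real where "\<And>r. r > 0 \<Longrightarrow> rel N (\<lambda>zs. norm (F zs - of_real c) < r) xs"
proof -
  define S where "S = {q. rel N (\<lambda>zs. q \<le> Re (F zs)) xs}"
  have "- b \<in> S"
    unfolding S_def mem_Collect_eq
  proof (rule rel_mono[OF fin])
    show "- b \<le> Re (F zs)" if "norm (F zs) \<le> b" for zs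
      using that abs_Re_le_cmod[of "F zs"] by linarith
  qed
  moreover have ub: "q \<le> b" if "q \<in> S" for q
  proof (rule ccontr)
    assume "\<not> q \<le> b"
    have "rel N (\<lambda>_. False) xs"
    proof (rule rel_mp2[OF fin])
      show "rel N (\<lambda>zs. q \<le> Re (F zs)) xs" using that by (simp add: S_def)
      show False if "norm (F zs) \<le> b" "q \<le> Re (F zs)" for zs
        using that \<open>\<not> q \<le> b\<close> complex_Re_le_cmod[of "F zs"] by linarith
    qed
    then show False by (simp add: rel_const)
  qed
  ultimately have bdd: "bdd_above S" and ne: "S \<noteq> {}"
    by (auto intro: bdd_aboveI[of _ b])
  show thesis
  proof (rule that[of "Sup S"])
    fix r :: real assume "r > 0"
    obtain q where q: "q \<in> S" "Sup S - r < q"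
      using less_cSup_iff[OF ne bdd, of "Sup S - r"] \<open>r > 0\<close> by auto
    have "Sup S + r / 2 \<notin> S"
      using cSup_upper[OF _ bdd, of "Sup S + r / 2"] \<open>r > 0\<close> by auto
    then have 1: "rel N (\<lambda>zs. \<not> Sup S + r / 2 \<le> Re (F zs)) xs"
      by (simp only: S_def mem_Collect_eq rel_not) simp
    have 2: "rel N (\<lambda>zs. q \<le> Re (F zs)) xs" using q by (simp add: S_def)
    show "rel N (\<lambda>zs. norm (F zs - of_real (Sup S)) < r) xs"
    proof (rule rel_mp3[OF 1 2 real])
      fix zs assume h: "\<not> Sup S + r / 2 \<le> Re (F zs)" "q \<le> Re (F zs)" "F zs \<in> \<real>"
      then obtain t where t: "F zs = of_real t" by (elim Reals_cases)
      have "norm (F zs - of_real (Sup S)) = \<bar>t - Sup S\<bar>"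
        unfolding t by (simp only: of_real_diff[symmetric] norm_of_real)
      then show "norm (F zs - of_real (Sup S)) < r"
        using h q \<open>r > 0\<close> by (simp add: t)
    qed
  qed
qed

text \<open>Currying: the germ at \<open>y\<close> of the partial application \<open>H n\<close> is
  an internal function, and applying it to \<open>x\<close> is the binary operation at
  \<open>y\<close> and \<open>x\<close>.\<close>

lemma codes_fun_on_star2:
  "codes_fun_on N X (star2 N H y) (star_op N (\<lambda>zs. Fun (H (num_of (zs ! 0)))) [y])"
  unfolding codes_fun_on_def
proof (intro conjI ballI)
  show "rel N (\<lambda>zs. \<exists>h. zs = [Fun h]) [star_op N (\<lambda>zs. Fun (H (num_of (zs ! 0)))) [y]]"
    by (simp add: rel_star_op1 rel_const)
next
  fix x
  define L where "L = [y, x]"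
  have e: "y = star_op N (\<lambda>zs. zs ! 0) L" "x = star_op N (\<lambda>zs. zs ! 1) L"
    using star_op_nth[of _ L] by (simp_all add: L_def)
  show "star2 N H y x = star_op N (\<lambda>zs. Num (fun_of (zs ! 0) (num_of (zs ! 1))))
      [star_op N (\<lambda>zs. Fun (H (num_of (zs ! 0)))) [y], x]"
    unfolding e by (simp add: star_op_comp1 star_op_comp2)
qed

lemma star1_star2: "star1 N f (star2 N H y x) = star2 N (\<lambda>n z. f (H n z)) y x"
proof -
  define L where "L = [y, x]"
  have e: "y = star_op N (\<lambda>zs. zs ! 0) L" "x = star_op N (\<lambda>zs. zs ! 1) L"
    using star_op_nth[of _ L] by (simp_all add: L_def)
  show ?thesis unfolding e by simp
qed

text \<open>Collapses the nested transferred operations into one binary operation with first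
  argument \<open>y\<close>, the shape in which internal integrals can be evaluated.\<close>

lemma g_eta_eq: "g_eta N y g = star2 N (\<lambda>n z. g (Re (cell n z))) y"
proof
  fix x
  define L where "L = [y, x]"
  have e: "y = star_op N (\<lambda>zs. zs ! 0) L" "x = star_op N (\<lambda>zs. zs ! 1) L"
    using star_op_nth[of _ L] by (simp_all add: L_def)
  show "g_eta N y g x = star2 N (\<lambda>n z. g (Re (cell n z))) y x"
    unfolding e g_eta_def by (simp add: cell_def)
qed

end

section \<open>The internal measure space\<close>

definition line :: "complex \<Rightarrow> complex set" where
  "line n = complex_of_real ` {- Re n..<Re n}"

text \<open>The standard counterpart of the algebra without its index sets: the fixed-point equation
  forces \<open>A\<close> into \<open>line n\<close> and makes membership depend on the cell
  only.\<close>

definition cell_set :: "complex \<Rightarrow> complex set \<Rightarrow> bool" where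
  "cell_set n A \<longleftrightarrow> A = {z \<in> line n. cell n z \<in> A}"

lemma of_real_in_line: "complex_of_real t \<in> line n \<longleftrightarrow> - Re n \<le> t \<and> t < Re n"
  by (auto simp: line_def)

lemma lineE:
  assumes "z \<in> line n"
  obtains t where "z = of_real t" "- Re n \<le> t" "t < Re n"
  using assms by (auto simp: line_def)

lemma cell_of_nat: "cell (of_nat n) (of_real t) = of_real (of_int \<lfloor>real n * t\<rfloor> / real n)"
  by (simp add: cell_def)

text \<open>Multiplication by n moves both endpoints to integers, and comparing a real with an
  integer in these directions is the same as comparing its floor.\<close>

lemma floor_grid_bounds:
  fixes t :: real
  assumes "n \<ge> 1"
  shows "- (real n) \<le> t \<and> t < real n \<longleftrightarrow> - ((int n)\<^sup>2) \<le> \<lfloor>real n * t\<rfloor> \<and> \<lfloor>real n * t\<rfloor> < (int n)\<^sup>2"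
proof -
  have "- (real n) \<le> t \<longleftrightarrow> real n * (- real n) \<le> real n * t"
    using assms by (subst mult_le_cancel_left_pos) auto
  also have "\<dots> \<longleftrightarrow> - ((int n)\<^sup>2) \<le> \<lfloor>real n * t\<rfloor>"
    by (simp add: le_floor_iff power2_eq_square)
  finally have 1: "- (real n) \<le> t \<longleftrightarrow> - ((int n)\<^sup>2) \<le> \<lfloor>real n * t\<rfloor>" .
  have "t < real n \<longleftrightarrow> real n * t < real n * real n"
    using assms by (subst mult_less_cancel_left_pos) auto
  also have "\<dots> \<longleftrightarrow> \<lfloor>real n * t\<rfloor> < (int n)\<^sup>2"
    by (simp add: floor_less_iff power2_eq_square)
  finally show ?thesis using 1 by simp
qed

lemma grid_point_in_line:
  assumes "n \<ge> 1" "k \<in> {- ((int n)\<^sup>2)..<(int n)\<^sup>2}"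
  shows "complex_of_int k / of_nat n \<in> line (of_nat n)"
proof -
  have "- (real n) \<le> of_int k / real n \<and> of_int k / real n < real n"
    using assms by (subst floor_grid_bounds) auto
  then have "complex_of_real (of_int k / real n) \<in> line (of_nat n)"
    by (simp only: of_real_in_line complex_Re_of_nat)
  then show ?thesis by simp
qed

lemma cell_grid_point:
  assumes "n \<ge> 1"
  shows "cell (of_nat n) (of_int k / of_nat n) = of_int k / of_nat n"
proof -
  have "cell (of_nat n) (of_real (of_int k / real n)) = of_int k / of_nat n"
    unfolding cell_of_nat using assms by simp
  then show ?thesis by simp
qed

lemma cell_cell:
  assumes "n \<ge> 1"
  shows "cell (of_nat n) (cell (of_nat n) z) = cell (of_nat n) z"
  using cell_grid_point[OF assms, of "\<lfloor>Re (of_nat n * z)\<rfloor>"] by (simp add: cell_def)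

lemma floor_eq_iff_cell:
  fixes t :: real
  assumes "n \<ge> 1"
  shows "of_int k / real n \<le> t \<and> t < (of_int k + 1) / real n \<longleftrightarrow> \<lfloor>real n * t\<rfloor> = k"
  using assms by (simp add: floor_eq_iff field_simps)

lemma grid_sum_of_nat:
  "grid_sum h A (of_nat n) =
     1 / of_nat n * (\<Sum>k \<in> {k \<in> {- ((int n)\<^sup>2)..<(int n)\<^sup>2}. of_int k / of_nat n \<in> A}. h (of_int k / of_nat n))"
  by (simp add: grid_sum_def)

text \<open>A grid sum reads its function only at grid points of \<open>A\<close> inside the line.
  This is what makes the internal integral independent of how the code behaves elsewhere.\<close>

lemma grid_sum_cong:
  assumes "\<And>z. z \<in> line (of_nat n) \<Longrightarrow> z \<in> A \<Longrightarrow> f z = h z"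
  shows "grid_sum f A (of_nat n) = grid_sum h A (of_nat n)"
proof (cases "n = 0")
  case False
  then show ?thesis
    unfolding grid_sum_of_nat
    by (intro arg_cong2[where f="(*)"] refl sum.cong assms grid_point_in_line) auto
qed (simp add: grid_sum_def)

locale ns_infinite = ns_ext N for N :: "'s extension" +
  fixes \<eta> :: 's
  assumes eta_nat: "\<eta> \<in> star_set N \<nat>" and eta_nonstandard: "\<eta> \<notin> std N ` \<nat>"
begin

text \<open>Since \<open>\<eta>\<close> differs from the standard number m, being at least m
  improves to being at least m + 1.\<close>

lemma eta_large:
  assumes "i < length xs" "xs ! i = \<eta>"
  shows "rel N (\<lambda>zs. \<exists>n\<ge>m. zs ! i = Num (of_nat n)) xs"
proof -
  have e: "\<eta> = star_op N (\<lambda>zs. zs ! i) xs"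
    using star_op_nth[of i xs] assms by simp
  show ?thesis
  proof (induction m)
    case 0
    from eta_nat show ?case
      unfolding e star_set_star_op by (rule rel_mono) (auto elim!: Nats_cases)
  next
    case (Suc m)
    have "std N (of_nat m) \<noteq> \<eta>"
      using eta_nonstandard by (metis of_nat_in_Nats image_eqI)
    then have "rel N (\<lambda>zs. Num (of_nat m) \<noteq> zs ! i) xs"
      unfolding e std_star_op[of _ xs] star_op_eq_iff rel_not .
    with Suc.IH show ?case
      by (rule rel_mp2) (metis le_antisym not_less_eq_eq)
  qed
qed

lemma eta_eventually:
  assumes "eventually P sequentially" "i < length xs" "xs ! i = \<eta>"
  shows "rel N (\<lambda>zs. \<exists>n\<ge>1. zs ! i = Num (of_nat n) \<and> P n) xs"
proof -
  obtain m where m: "\<And>n. n \<ge> m \<Longrightarrow> P n"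
    using assms(1) by (auto simp: eventually_sequentially)
  show ?thesis
    by (rule rel_mono[OF eta_large[OF assms(2,3), of "max m 1"]]) (use m in auto)
qed

lemma eta_nat':
  assumes "i < length xs" "xs ! i = \<eta>"
  shows "rel N (\<lambda>zs. \<exists>n\<ge>1. zs ! i = Num (of_nat n)) xs"
  using eta_large[OF assms, of 1] .

section \<open>The bounded hyperreal line and internal integrals as grid sums\<close>

lemma R_bar_star_op:
  assumes "i < length xs" "xs ! i = \<eta>"
  shows "star_op N F xs \<in> R_bar N \<eta> \<longleftrightarrow> rel N (\<lambda>zs. \<exists>z \<in> line (num_of (zs ! i)). F zs = Num z) xs"
proof -
  have e: "\<eta> = star_op N (\<lambda>zs. zs ! i) xs"
    using star_op_nth[of i xs] assms by simp
  have "star_op N F xs \<in> R_bar N \<eta> \<longleftrightarrow>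
    rel N (\<lambda>zs. (\<exists>z\<in>\<real>. F zs = Num z) \<and>
      (\<exists>a b. Num (- num_of (zs ! i)) = Num (complex_of_real a) \<and> F zs = Num (complex_of_real b) \<and> a \<le> b) \<and>
      (\<exists>a b. F zs = Num (complex_of_real a) \<and> zs ! i = Num (complex_of_real b) \<and> a < b)) xs"
    (is "_ \<longleftrightarrow> rel N ?P xs")
    unfolding e R_bar_def mem_Collect_eq star1_star_op star_set_star_op ns_le_star_op ns_less_star_op rel_conj
    by simp
  also have "\<dots> \<longleftrightarrow> rel N (\<lambda>zs. \<exists>z \<in> line (num_of (zs ! i)). F zs = Num z) xs" (is "_ \<longleftrightarrow> rel N ?Q xs")
  proof -
    have iff: "?P zs \<longleftrightarrow> ?Q zs" if nat: "\<exists>n\<ge>1. zs ! i = Num (of_nat n)" for zs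
    proof
      assume "?P zs"
      then obtain a b c d where *: "Num (- num_of (zs ! i)) = Num (complex_of_real a)"
        "F zs = Num (complex_of_real b)" "a \<le> b"
        "F zs = Num (complex_of_real c)" "zs ! i = Num (complex_of_real d)" "c < d" by blast
      then have "c = b" "- d = a"
        by (auto simp flip: of_real_minus)
      then have "complex_of_real b \<in> line (num_of (zs ! i))"
        using * by (simp add: of_real_in_line)
      then show "?Q zs" using * by blast
    next
      assume "?Q zs"
      then obtain t where t: "F zs = Num (of_real t)" "- Re (num_of (zs ! i)) \<le> t" "t < Re (num_of (zs ! i))"
        by (elim bexE lineE) auto
      obtain n where n: "zs ! i = Num (of_nat n)" using nat by blast
      have "Num (- num_of (zs ! i)) = Num (complex_of_real (- real n))"
        "zs ! i = Num (complex_of_real (real n))" "- real n \<le> t" "t < real n"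
        using n t by auto
      with t(1) show "?P zs" by (metis Reals_of_real)
    qed
    show ?thesis
    proof
      assume "rel N ?P xs"
      with eta_nat'[OF assms] show "rel N ?Q xs" by (rule rel_mp2) (use iff in blast)
    next
      assume "rel N ?Q xs"
      with eta_nat'[OF assms] show "rel N ?P xs" by (rule rel_mp2) (use iff in blast)
    qed
  qed
  finally show ?thesis .
qed

text \<open>Gives the whole space a canonical code, so that integrals over it are covered by the
  formula for coded sets.\<close>

lemma R_bar_eq_ext:
  assumes "i < length xs" "xs ! i = \<eta>"
  shows "R_bar N \<eta> = ext N (star_op N (\<lambda>zs. Set (line (num_of (zs ! i)))) xs)"
proof (rule set_eqI)
  fix x
  define L where "L = xs @ [x]"
  have e: "x = star_op N (\<lambda>zs. zs ! length xs) L"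
    using star_op_nth[of "length xs" L] by (simp add: L_def)
  have Li: "i < length L" "L ! i = \<eta>"
    using assms by (auto simp: L_def nth_append)
  \<comment> \<open>The code is a germ at \<open>xs\<close>, the point \<open>x\<close> lives on the
    longer tuple \<open>L\<close>. Writing \<open>xs\<close> as projections of \<open>L\<close> lets
    the composition rule move the code to \<open>L\<close>.\<close>
  have xs: "xs = map (\<lambda>F. star_op N F L) (map (\<lambda>j zs. zs ! j) [0..<length xs])"
    by (rule nth_equalityI) (auto simp: star_op_nth L_def nth_append)
  have *: "star_op N (\<lambda>zs. Set (line (num_of (zs ! i)))) xs =
      star_op N (\<lambda>zs. Set (line (num_of (zs ! i)))) L"
    by (subst xs, subst star_op_comp) (use assms in simp)
  show "x \<in> R_bar N \<eta> \<longleftrightarrow> x \<in> ext N (star_op N (\<lambda>zs. Set (line (num_of (zs ! i)))) xs)"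
    unfolding * unfolding e R_bar_star_op[OF Li] ext_star_op by (rule rel_cong) auto
qed

text \<open>Two choices hide in the \<open>THE\<close>: the code of the set is unique by
  extensionality, and any two codes of the function agree at every internal point of the line, hence
  at all grid points that enter the sum.\<close>

lemma int_lambda_star2:
  assumes a: "is_set N a"
  shows "int_lambda N \<eta> (ext N a) (star2 N H \<eta>) =
    star_op N (\<lambda>zs. Num (grid_sum (H (num_of (zs ! 0))) (set_of (zs ! 1)) (num_of (zs ! 0)))) [\<eta>, a]"
    (is "_ = ?v")
proof -
  let ?GS = "\<lambda>zs. Num (grid_sum (fun_of (zs ! 0)) (set_of (zs ! 1)) (num_of (zs ! 2)))"
  let ?f = "star_op N (\<lambda>zs. Fun (H (num_of (zs ! 0)))) [\<eta>]"
  have v: "?v = star_op N ?GS [?f, a, \<eta>]"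
  proof -
    define L where "L = [\<eta>, a]"
    have e: "\<eta> = star_op N (\<lambda>zs. zs ! 0) L" "a = star_op N (\<lambda>zs. zs ! 1) L"
      using star_op_nth[of _ L] by (simp_all add: L_def)
    show ?thesis
      unfolding L_def[symmetric] unfolding e by (simp add: star_op_comp1 star_op_comp3)
  qed
  have unique: "star_op N ?GS [f, a, \<eta>] = ?v" if f: "codes_fun_on N (R_bar N \<eta>) (star2 N H \<eta>) f" for f
  proof -
    let ?P = "\<lambda>zs. \<exists>z\<in>line (num_of (zs ! 1)). zs ! 0 = Num z \<and> fun_of (zs ! 2) z \<noteq> H (num_of (zs ! 1)) z"
    \<comment> \<open>A point where the code \<open>f\<close> and the intended function differ would
      lie in \<open>R_bar N \<eta>\<close>, where \<open>f\<close> computes that function by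
      assumption.\<close>
    have no: "\<not> rel N ?P [x, \<eta>, f, a]" for x
    proof
      assume P: "rel N ?P [x, \<eta>, f, a]"
      define L where "L = [x, \<eta>, f, a]"
      have e: "x = star_op N (\<lambda>zs. zs ! 0) L" "\<eta> = star_op N (\<lambda>zs. zs ! 1) L"
          "f = star_op N (\<lambda>zs. zs ! 2) L"
        using star_op_nth[of _ L] by (simp_all add: L_def numeral_2_eq_2)
      have Li: "1 < length L" "L ! 1 = \<eta>" by (simp_all add: L_def)
      have "x \<in> R_bar N \<eta>"
        unfolding e(1) R_bar_star_op[OF Li] by (rule rel_mono[OF P[folded L_def]]) auto
      then have "star2 N H \<eta> x = star_op N (\<lambda>zs. Num (fun_of (zs ! 0) (num_of (zs ! 1)))) [f, x]"
        using f by (simp add: codes_fun_on_def)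
      then have "rel N (\<lambda>zs. H (num_of (zs ! 1)) (num_of (zs ! 0)) = fun_of (zs ! 2) (num_of (zs ! 0))) L"
        unfolding e by (simp add: star_op_comp2 star_op_eq_iff)
      with P[folded L_def] have "rel N (\<lambda>_. False) L"
        by (rule rel_mp2) auto
      then show False by (simp add: rel_const)
    qed
    define L where "L = [\<eta>, f, a]"
    have e: "\<eta> = star_op N (\<lambda>zs. zs ! 0) L" "f = star_op N (\<lambda>zs. zs ! 1) L"
        "a = star_op N (\<lambda>zs. zs ! 2) L"
      using star_op_nth[of _ L] by (simp_all add: L_def numeral_2_eq_2)
    have "\<not> rel N (\<lambda>zs. \<exists>z. ?P (z # zs)) L"
      using no rel_ex[of ?P L] by (auto simp: L_def)
    then have no': "rel N (\<lambda>zs. \<not> (\<exists>z. ?P (z # zs))) L"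
      by (simp only: rel_not) simp
    have nat: "rel N (\<lambda>zs. \<exists>n\<ge>1. zs ! 0 = Num (of_nat n)) L"
      by (rule eta_nat') (simp_all add: L_def)
    have "rel N (\<lambda>zs. grid_sum (fun_of (zs ! 1)) (set_of (zs ! 2)) (num_of (zs ! 0)) =
        grid_sum (H (num_of (zs ! 0))) (set_of (zs ! 2)) (num_of (zs ! 0))) L"
    proof (rule rel_mp2[OF no' nat])
      fix zs :: "obj list"
      assume 1: "\<not> (\<exists>z. ?P (z # zs))" and "\<exists>n\<ge>1. zs ! 0 = Num (of_nat n)"
      then obtain n where n: "zs ! 0 = Num (of_nat n)" by blast
      have "fun_of (zs ! 1) z = H (of_nat n) z" if "z \<in> line (of_nat n)" for z
        using 1 that n by (auto simp: numeral_2_eq_2)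
      then show "grid_sum (fun_of (zs ! 1)) (set_of (zs ! 2)) (num_of (zs ! 0)) =
        grid_sum (H (num_of (zs ! 0))) (set_of (zs ! 2)) (num_of (zs ! 0))"
        using n by (auto intro!: grid_sum_cong)
    qed
    then have "star_op N ?GS [f, a, \<eta>] = star_op N ?GS [?f, a, \<eta>]"
      unfolding e by (simp add: star_op_comp1 star_op_comp3 star_op_eq_iff)
    then show ?thesis by (simp only: v)
  qed
  show ?thesis
    unfolding int_lambda_def
  proof (rule the_equality)
    show "\<exists>f b. codes_fun_on N (R_bar N \<eta>) (star2 N H \<eta>) f \<and> is_set N b \<and> ext N b = ext N a \<and>
        ?v = star_op N ?GS [f, b, \<eta>]"
      by (intro exI[of _ ?f] exI[of _ a] conjI codes_fun_on_star2 a v refl)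
  next
    fix w
    assume "\<exists>f b. codes_fun_on N (R_bar N \<eta>) (star2 N H \<eta>) f \<and> is_set N b \<and> ext N b = ext N a \<and>
        w = star_op N ?GS [f, b, \<eta>]"
    then obtain f b where f: "codes_fun_on N (R_bar N \<eta>) (star2 N H \<eta>) f"
      and b: "is_set N b" "ext N b = ext N a" and w: "w = star_op N ?GS [f, b, \<eta>]"
      by (elim exE conjE)
    show "w = ?v"
      unfolding w is_set_ext_eqD[OF b(1) a b(2)] by (rule unique[OF f])
  qed
qed

lemma int_lambda_germ:
  "int_lambda N \<eta> (ext N (star_op N (\<lambda>zs. Set (A zs)) (\<eta> # ys))) (star2 N H \<eta>) =
    star_op N (\<lambda>zs. Num (grid_sum (H (num_of (zs ! 0))) (A zs) (num_of (zs ! 0)))) (\<eta> # ys)"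
proof -
  define L where "L = \<eta> # ys"
  have e: "\<eta> = star_op N (\<lambda>zs. zs ! 0) L"
    using star_op_nth[of 0 L] by (simp_all add: L_def)
  show ?thesis
    unfolding L_def[symmetric]
    by (subst int_lambda_star2, simp, unfold e, simp add: star_op_comp2)
qed

lemma lambda_germ:
  "lambda N \<eta> (ext N (star_op N (\<lambda>zs. Set (A zs)) (\<eta> # ys))) =
    star_op N (\<lambda>zs. Num (grid_sum (\<lambda>_. 1) (A zs) (num_of (zs ! 0)))) (\<eta> # ys)"
proof -
  have "(\<lambda>_. std N 1) = star2 N (\<lambda>_ _. 1) \<eta>"
  proof
    fix x
    define L where "L = [\<eta>, x]"
    have e: "\<eta> = star_op N (\<lambda>zs. zs ! 0) L" "x = star_op N (\<lambda>zs. zs ! 1) L"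
      using star_op_nth[of _ L] by (simp_all add: L_def)
    show "std N 1 = star2 N (\<lambda>_ _. 1) \<eta> x"
      unfolding e std_star_op[of _ L] by simp
  qed
  then show ?thesis
    by (simp add: lambda_def int_lambda_germ)
qed

lemma int_lambda_R_bar:
  "int_lambda N \<eta> (R_bar N \<eta>) (star2 N H \<eta>) =
    star_op N (\<lambda>zs. Num (grid_sum (H (num_of (zs ! 0))) (line (num_of (zs ! 0))) (num_of (zs ! 0)))) [\<eta>]"
  by (subst R_bar_eq_ext[of 0 "[\<eta>]"]) (simp_all only: int_lambda_germ list.size nth_Cons_0)

end

section \<open>Riemann sums over the grid\<close>

definition grid :: "nat \<Rightarrow> int set" where
  "grid n = {- ((int n)\<^sup>2)..<(int n)\<^sup>2}"

text \<open>Values lie in any real vector space so that one notion serves the complex function g and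
  its real majorants.\<close>

definition riemann_sum :: "nat \<Rightarrow> (real \<Rightarrow> 'a::real_vector) \<Rightarrow> 'a" where
  "riemann_sum n \<phi> = (\<Sum>k\<in>grid n. (1 / real n) *\<^sub>R \<phi> (of_int k / real n))"

definition step_fun :: "nat \<Rightarrow> (real \<Rightarrow> 'a::real_vector) \<Rightarrow> real \<Rightarrow> 'a" where
  "step_fun n \<phi> x = indicator {- real n..<real n} x *\<^sub>R \<phi> (of_int \<lfloor>real n * x\<rfloor> / real n)"

lemma finite_grid [simp]: "finite (grid n)"
  by (simp add: grid_def)

text \<open>The cells with index in \<open>grid n\<close> tile [-n, n), so at each \<open>x\<close>
  at most the summand with index \<lfloor>n x\<rfloor> survives.\<close>

lemma has_bochner_integral_step_fun:
  fixes \<phi> :: "real \<Rightarrow> 'a::{banach, second_countable_topology}"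
  assumes n: "n \<ge> 1"
  shows "has_bochner_integral lborel (step_fun n \<phi>) (riemann_sum n \<phi>)"
proof -
  let ?J = "\<lambda>k. {of_int k / real n..<(of_int k + 1) / real n}"
  have "has_bochner_integral lborel (\<lambda>x. indicator (?J k) x *\<^sub>R \<phi> (of_int k / real n))
      ((1 / real n) *\<^sub>R \<phi> (of_int k / real n))" for k
  proof (rule has_bochner_integral_scaleR_left)
    have em: "emeasure lborel (?J k) = ennreal (1 / real n)"
      using n by (subst emeasure_lborel_Ico) (auto simp: field_simps)
    then have "has_bochner_integral lborel (indicator (?J k)) (measure lborel (?J k))"
      by (intro has_bochner_integral_real_indicator) auto
    moreover have "measure lborel (?J k) = 1 / real n"
      by (simp add: measure_def em)
    ultimately show "has_bochner_integral lborel (indicator (?J k)) (1 / real n)" by simp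
  qed
  then have "has_bochner_integral lborel
      (\<lambda>x. \<Sum>k\<in>grid n. indicator (?J k) x *\<^sub>R \<phi> (of_int k / real n)) (riemann_sum n \<phi>)"
    unfolding riemann_sum_def by (intro has_bochner_integral_sum)
  moreover have "(\<Sum>k\<in>grid n. indicator (?J k) x *\<^sub>R \<phi> (of_int k / real n)) = step_fun n \<phi> x" for x
  proof -
    have "(\<Sum>k\<in>grid n. indicator (?J k) x *\<^sub>R \<phi> (of_int k / real n)) =
        (\<Sum>k\<in>grid n. if k = \<lfloor>real n * x\<rfloor> then \<phi> (of_int k / real n) else 0)"
      by (intro sum.cong refl) (use floor_eq_iff_cell[OF n, of _ x] in \<open>auto simp: indicator_def\<close>)
    also have "\<dots> = (if \<lfloor>real n * x\<rfloor> \<in> grid n then \<phi> (of_int \<lfloor>real n * x\<rfloor> / real n) else 0)"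
      by (simp add: sum.delta)
    also have "\<dots> = step_fun n \<phi> x"
      using floor_grid_bounds[OF n, of x] by (auto simp: step_fun_def grid_def indicator_def)
    finally show ?thesis .
  qed
  ultimately show ?thesis by simp
qed

lemma floor_mult_div_bounds:
  fixes x :: real
  assumes "n \<ge> 1"
  shows "of_int \<lfloor>real n * x\<rfloor> / real n \<le> x" and "x < of_int \<lfloor>real n * x\<rfloor> / real n + 1 / real n"
  using assms floor_eq_iff_cell[OF assms, of "\<lfloor>real n * x\<rfloor>" x] by (auto simp: add_divide_distrib)

text \<open>Let y be the rounded point. Rounding moves x by at most 1, so x^2 \<le> 2 (x - y)^2 + 2
  y^2 \<le> 2 + 2 y^2, and 1 + x^2 \<le> 3 (1 + y^2). The constant does not depend on n.\<close>

lemma inverse_quadratic_floor_le: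
  fixes x :: real
  assumes "n \<ge> 1"
  shows "1 / (1 + (of_int \<lfloor>real n * x\<rfloor> / real n)\<^sup>2) \<le> 3 / (1 + x\<^sup>2)"
proof -
  define y where "y = of_int \<lfloor>real n * x\<rfloor> / real n"
  have "1 / real n \<le> 1" using assms by simp
  then have d: "\<bar>x - y\<bar> \<le> 1"
    using floor_mult_div_bounds[OF assms, of x] by (simp add: y_def)
  have "(x - y)\<^sup>2 \<le> 1"
    using d by (simp add: abs_square_le_1)
  moreover have "0 \<le> (x - 2 * y)\<^sup>2" "0 \<le> y\<^sup>2" by simp_all
  moreover have "2 * (x - y)\<^sup>2 + 2 * y\<^sup>2 - x\<^sup>2 = (x - 2 * y)\<^sup>2"
    by (simp add: power2_eq_square algebra_simps)
  moreover have "a \<le> 1 \<Longrightarrow> 0 \<le> d \<Longrightarrow> 0 \<le> b \<Longrightarrow> 2 * a + 2 * b - c = d \<Longrightarrow> 1 + c \<le> 3 * (1 + b)"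
    for a b c d :: real by simp
  ultimately have "1 + x\<^sup>2 \<le> 3 * (1 + y\<^sup>2)"
    by blast
  then show ?thesis
    unfolding y_def[symmetric] by (simp add: divide_simps add_pos_nonneg)
qed

lemma integrable_inverse_quadratic: "integrable lborel (\<lambda>x::real. C / (1 + x\<^sup>2))"
proof -
  have "integrable lborel (\<lambda>x::real. inverse (1 + x\<^sup>2))"
    using integrable_inverse_1_plus_square by (simp add: set_integrable_def)
  then have "integrable lborel (\<lambda>x::real. C * inverse (1 + x\<^sup>2))"
    by (rule integrable_mult_right)
  then show ?thesis by (simp add: divide_inverse)
qed

text \<open>At a point of continuity the rounded arguments converge to \<open>x\<close> and the
  truncation to [-n, n) eventually has no effect. Rounding costs a factor 3 in the bound, uniformly
  in n, so one integrable majorant serves all step functions.\<close>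

lemma riemann_sum_LIMSEQ:
  fixes \<phi> :: "real \<Rightarrow> 'a::{banach, second_countable_topology}"
  assumes meas: "\<phi> \<in> borel_measurable borel"
    and cont: "AE x in lborel. isCont \<phi> x"
    and bound: "\<And>x. norm (\<phi> x) \<le> C / (1 + x\<^sup>2)"
  shows "(\<lambda>n. riemann_sum n \<phi>) \<longlonglongrightarrow> integral\<^sup>L lborel \<phi>"
proof -
  have C: "0 \<le> C" using bound[of 0] norm_ge_zero[of "\<phi> 0"] by (simp del: norm_ge_zero)
  \<comment> \<open>The sequence is shifted by one because the grid has no meaning for n =
    0.\<close>
  have "(\<lambda>n. integral\<^sup>L lborel (step_fun (Suc n) \<phi>)) \<longlonglongrightarrow> integral\<^sup>L lborel \<phi>"
  proof (rule integral_dominated_convergence)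
    show "\<phi> \<in> borel_measurable lborel" using meas by simp
    show "step_fun (Suc n) \<phi> \<in> borel_measurable lborel" for n
      using has_bochner_integral_step_fun[of "Suc n" \<phi>]
      by (intro borel_measurable_has_bochner_integral) auto
    show "integrable lborel (\<lambda>x. 3 * C / (1 + x\<^sup>2))"
      by (rule integrable_inverse_quadratic)
    show "AE x in lborel. norm (step_fun (Suc n) \<phi> x) \<le> 3 * C / (1 + x\<^sup>2)" for n
    proof (rule AE_I2)
      fix x :: real
      let ?y = "of_int \<lfloor>real (Suc n) * x\<rfloor> / real (Suc n)"
      have "norm (step_fun (Suc n) \<phi> x) \<le> norm (\<phi> ?y)"
        by (auto simp: step_fun_def indicator_def)
      also have "\<dots> \<le> C * (1 / (1 + ?y\<^sup>2))" using bound[of ?y] by simp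
      also have "\<dots> \<le> C * (3 / (1 + x\<^sup>2))"
        using C by (intro mult_left_mono inverse_quadratic_floor_le) auto
      finally show "norm (step_fun (Suc n) \<phi> x) \<le> 3 * C / (1 + x\<^sup>2)" by (simp add: mult.commute)
    qed
    show "AE x in lborel. (\<lambda>n. step_fun (Suc n) \<phi> x) \<longlonglongrightarrow> \<phi> x"
      using cont
    proof eventually_elim
      case (elim x)
      let ?y = "\<lambda>n. of_int \<lfloor>real (Suc n) * x\<rfloor> / real (Suc n)"
      have "?y \<longlonglongrightarrow> x"
      proof (rule real_tendsto_sandwich)
        show "\<forall>\<^sub>F n in sequentially. x - 1 / real (Suc n) \<le> ?y n"
          using floor_mult_div_bounds(2)[of "Suc _" x] by (intro always_eventually allI) (simp add: less_imp_le diff_le_eq)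
        show "\<forall>\<^sub>F n in sequentially. ?y n \<le> x"
          using floor_mult_div_bounds(1)[of "Suc _" x] by (intro always_eventually allI) simp
        show "(\<lambda>n. x - 1 / real (Suc n)) \<longlonglongrightarrow> x"
          using tendsto_diff[OF tendsto_const[of x] LIMSEQ_inverse_real_of_nat] by (simp add: divide_inverse)
      qed simp
      then have lim: "(\<lambda>n. \<phi> (?y n)) \<longlonglongrightarrow> \<phi> x"
        by (rule isCont_tendsto_compose[OF elim])
      \<comment> \<open>From this index on \<open>x\<close> lies inside the truncation
        interval.\<close>
      obtain m where m: "\<bar>x\<bar> < real m" using reals_Archimedean2 by blast
      have "\<forall>\<^sub>F n in sequentially. \<phi> (?y n) = step_fun (Suc n) \<phi> x"
        using eventually_ge_at_top[of m]
      proof eventually_elim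
        case (elim n)
        then have "real m \<le> real (Suc n)" by simp
        with m have "x \<in> {- real (Suc n)..<real (Suc n)}" by auto
        then show ?case by (simp only: step_fun_def indicator_simps scaleR_one)
      qed
      with lim show ?case by (rule Lim_transform_eventually)
    qed
  qed
  moreover have "integral\<^sup>L lborel (step_fun (Suc n) \<phi>) = riemann_sum (Suc n) \<phi>" for n
    by (rule has_bochner_integral_integral_eq) (rule has_bochner_integral_step_fun, simp)
  ultimately have "(\<lambda>n. riemann_sum (Suc n) \<phi>) \<longlonglongrightarrow> integral\<^sup>L lborel \<phi>" by simp
  then show ?thesis by (rule LIMSEQ_imp_Suc)
qed

text \<open>A bound independent of n remains a standard bound at n = \<open>\<eta>\<close>. The
  integral of 3 / (1 + x^2) works because it dominates every step function.\<close>

lemma riemann_sum_inverse_quadratic_bounded: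
  obtains M where "0 \<le> M" "\<And>n. n \<ge> 1 \<Longrightarrow> riemann_sum n (\<lambda>x. 1 / (1 + x\<^sup>2)) \<le> M"
proof
  let ?M = "integral\<^sup>L lborel (\<lambda>x::real. 3 / (1 + x\<^sup>2))"
  show "0 \<le> ?M" by (intro Bochner_Integration.integral_nonneg) auto
  fix n :: nat assume n: "n \<ge> 1"
  let ?\<phi> = "\<lambda>x::real. 1 / (1 + x\<^sup>2)"
  note step = has_bochner_integral_step_fun[OF n, of ?\<phi>]
  have "riemann_sum n ?\<phi> = integral\<^sup>L lborel (step_fun n ?\<phi>)"
    using has_bochner_integral_integral_eq[OF step] by simp
  also have "\<dots> \<le> ?M"
  proof (rule integral_mono)
    show "integrable lborel (step_fun n ?\<phi>)"
      using step by (rule integrable.intros)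
    show "integrable lborel (\<lambda>x::real. 3 / (1 + x\<^sup>2))"
      by (rule integrable_inverse_quadratic)
    show "step_fun n ?\<phi> x \<le> 3 / (1 + x\<^sup>2)" for x
      using inverse_quadratic_floor_le[OF n, of x]
      by (auto simp: step_fun_def indicator_def)
  qed
  finally show "riemann_sum n ?\<phi> \<le> ?M" .
qed

text \<open>Rounding fixes grid points, so it disappears from the sum; the set \<open>A\<close>
  turns into a cut-off factor, so that sums over different sets run over the same grid and can be
  compared termwise.\<close>

lemma grid_sum_cell:
  assumes n: "n \<ge> 1"
  shows "grid_sum (\<lambda>z. \<phi> (Re (cell (of_nat n) z))) A (of_nat n) =
    riemann_sum n (\<lambda>x. if complex_of_real x \<in> A then \<phi> x else 0)"
proof -
  have "grid_sum (\<lambda>z. \<phi> (Re (cell (of_nat n) z))) A (of_nat n) =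
      1 / of_nat n * (\<Sum>k \<in> {k \<in> grid n. of_int k / of_nat n \<in> A}. \<phi> (of_int k / real n))"
  proof -
    have "\<phi> (Re (cell (of_nat n) (of_int k / of_nat n))) = \<phi> (of_int k / real n)" for k
      unfolding cell_grid_point[OF n]
      using Re_complex_of_real[of "of_int k / real n"] by (simp del: Re_complex_of_real)
    then show ?thesis by (simp add: grid_sum_of_nat grid_def)
  qed
  also have "\<dots> = 1 / of_nat n *
      (\<Sum>k \<in> grid n. if of_int k / of_nat n \<in> A then \<phi> (of_int k / real n) else 0)"
    by (subst sum.inter_filter) simp_all
  also have "\<dots> = riemann_sum n (\<lambda>x. if complex_of_real x \<in> A then \<phi> x else 0)"
    unfolding riemann_sum_def sum_distrib_left
    by (intro sum.cong refl) (auto simp: scaleR_conv_of_real)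
  finally show ?thesis .
qed

lemma riemann_sum_of_real:
  "riemann_sum n (\<lambda>x. complex_of_real (\<phi> x)) = of_real (riemann_sum n \<phi>)"
  by (simp add: riemann_sum_def scaleR_conv_of_real)

lemma riemann_sum_mono:
  fixes \<phi> \<psi> :: "real \<Rightarrow> real"
  assumes "\<And>k. k \<in> grid n \<Longrightarrow> \<phi> (of_int k / real n) \<le> \<psi> (of_int k / real n)"
  shows "riemann_sum n \<phi> \<le> riemann_sum n \<psi>"
  unfolding riemann_sum_def using assms by (intro sum_mono scaleR_left_mono) auto

lemma riemann_sum_nonneg:
  fixes \<phi> :: "real \<Rightarrow> real"
  assumes "\<And>x. 0 \<le> \<phi> x"
  shows "0 \<le> riemann_sum n \<phi>"
  unfolding riemann_sum_def using assms by (intro sum_nonneg) auto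

lemma riemann_sum_cmult:
  fixes \<phi> :: "real \<Rightarrow> real"
  shows "riemann_sum n (\<lambda>x. c * \<phi> x) = c * riemann_sum n \<phi>"
  by (simp add: riemann_sum_def sum_distrib_left algebra_simps)

lemma grid_sum_cell_real:
  assumes "n \<ge> 1"
  shows "grid_sum (\<lambda>z. complex_of_real (\<phi> (Re (cell (of_nat n) z)))) A (of_nat n) =
    of_real (riemann_sum n (\<lambda>x. if complex_of_real x \<in> A then \<phi> x else 0))"
  unfolding grid_sum_cell[OF assms, of "\<lambda>x. complex_of_real (\<phi> x)"] riemann_sum_of_real[symmetric]
  by (rule arg_cong[where f="riemann_sum n"]) auto

lemma riemann_sum_line:
  assumes "n \<ge> 1"
  shows "riemann_sum n (\<lambda>x. if complex_of_real x \<in> line (of_nat n) then \<phi> x else 0) = riemann_sum n \<phi>"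
proof -
  have "complex_of_real (of_int k / real n) \<in> line (of_nat n)" if "k \<in> grid n" for k
    using grid_point_in_line[OF assms, of k] that by (simp add: grid_def)
  then show ?thesis by (simp add: riemann_sum_def)
qed

section \<open>Schwartz functions\<close>

lemma Schwartz_isCont:
  assumes "g \<in> Schwartz"
  shows "isCont g x"
proof -
  have "nth_deriv 0 g differentiable (at x)"
    using assms by (simp add: Schwartz_def)
  then show ?thesis
    by (simp add: nth_deriv_def differentiable_imp_continuous_within)
qed

text \<open>Fourth-order decay, rather than the second order that integrability asks, prepares for
  \<open>decay_sqrt_bound\<close>.\<close>

lemma Schwartz_bound:
  assumes "g \<in> Schwartz"
  obtains C where "0 < C" "\<And>x. norm (g x) \<le> C / (1 + x\<^sup>2)\<^sup>2"
proof -
  have "bdd_above (range (\<lambda>x. \<bar>x\<bar> ^ k * norm (nth_deriv 0 g x)))" for k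
    using assms by (simp add: Schwartz_def)
  then have "\<exists>B. \<forall>x. \<bar>x\<bar> ^ k * norm (g x) \<le> B" for k
    unfolding bdd_above_def nth_deriv_def by auto
  then obtain B where B: "\<And>k x. \<bar>x\<bar> ^ k * norm (g x) \<le> B k" by metis
  \<comment> \<open>The coefficients come from (1 + x^2)^2 = 1 + 2 x^2 + x^4, each monomial being
    bounded by its seminorm; the final 1 makes the constant positive.\<close>
  let ?C = "\<bar>B 0\<bar> + 2 * \<bar>B 2\<bar> + \<bar>B 4\<bar> + 1"
  show thesis
  proof (rule that[of ?C])
    fix x
    have "norm (g x) * (1 + x\<^sup>2)\<^sup>2 = \<bar>x\<bar> ^ 0 * norm (g x) + 2 * (\<bar>x\<bar> ^ 2 * norm (g x)) + \<bar>x\<bar> ^ 4 * norm (g x)"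
      by (simp add: power2_eq_square algebra_simps power4_eq_xxxx)
    also have "\<dots> \<le> ?C"
      using B[of x 0] B[of x 2] B[of x 4] by linarith
    finally show "norm (g x) \<le> ?C / (1 + x\<^sup>2)\<^sup>2"
      by (subst pos_le_divide_eq) (simp_all only: zero_less_power add_pos_nonneg zero_less_one zero_le_power2)
  qed simp
qed

lemma inverse_quadratic_square_le:
  fixes x :: real
  assumes "0 \<le> C"
  shows "C / (1 + x\<^sup>2)\<^sup>2 \<le> C / (1 + x\<^sup>2)" and "C / (1 + x\<^sup>2) \<le> C"
proof -
  have 1: "1 \<le> 1 + x\<^sup>2" by simp
  then have "1 + x\<^sup>2 \<le> (1 + x\<^sup>2)\<^sup>2"
    unfolding power2_eq_square[of "1 + x\<^sup>2"] by (metis mult_left_mono mult.right_neutral order_trans zero_le_one)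
  then show "C / (1 + x\<^sup>2)\<^sup>2 \<le> C / (1 + x\<^sup>2)"
    using assms 1 by (intro divide_left_mono mult_pos_pos zero_less_power add_pos_nonneg) auto
  show "C / (1 + x\<^sup>2) \<le> C"
    using assms 1 by (simp add: divide_le_eq mult_le_cancel_left1 add_pos_nonneg)
qed

lemma Schwartz_measurable: "g \<in> Schwartz \<Longrightarrow> g \<in> borel_measurable borel"
  using Schwartz_isCont by (intro borel_measurable_continuous_onI continuous_at_imp_continuous_on) auto

lemma Schwartz_integrable:
  assumes "g \<in> Schwartz"
  shows "integrable lborel g"
proof -
  obtain C where C: "0 < C" "\<And>x. norm (g x) \<le> C / (1 + x\<^sup>2)\<^sup>2"
    using Schwartz_bound[OF assms] by blast
  show ?thesis
  proof (rule Bochner_Integration.integrable_bound[OF integrable_inverse_quadratic[of C]])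
    show "g \<in> borel_measurable lborel"
      using Schwartz_measurable[OF assms] by simp
    have "norm (g x) \<le> norm (C / (1 + x\<^sup>2))" for x
      using C(2)[of x] inverse_quadratic_square_le(1)[of C x] C(1) abs_ge_self[of "C / (1 + x\<^sup>2)"]
      unfolding real_norm_def by linarith
    then show "AE x in lborel. norm (g x) \<le> norm (C / (1 + x\<^sup>2))" by simp
  qed
qed

section \<open>The internal algebra of cells\<close>

lemma cell_in_line:
  assumes "n \<ge> 1" "z \<in> line (of_nat n)"
  shows "cell (of_nat n) z \<in> line (of_nat n)"
proof -
  obtain t where t: "z = of_real t" "- real n \<le> t" "t < real n"
    using assms(2) by (auto elim!: lineE)
  then have "\<lfloor>real n * t\<rfloor> \<in> {- ((int n)\<^sup>2)..<(int n)\<^sup>2}"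
    using floor_grid_bounds[OF assms(1), of t] by auto
  from grid_point_in_line[OF assms(1) this] show ?thesis
    by (simp add: cell_def t)
qed

text \<open>Holds because rounding is idempotent and stays on the line. Preimages of internal sets
  under functions of the cell enter the algebra this way.\<close>

lemma cell_set_Collect:
  assumes "n \<ge> 1"
  shows "cell_set (of_nat n) {z \<in> line (of_nat n). P (cell (of_nat n) z)}"
  unfolding cell_set_def using cell_cell[OF assms] cell_in_line[OF assms] by auto

lemma cell_set_line: "n \<ge> 1 \<Longrightarrow> cell_set (of_nat n) (line (of_nat n))"
  using cell_set_Collect[of n "\<lambda>_. True"] by simp

context ns_infinite
begin

text \<open>For an integer k, lying in [k/\<eta>, (k+1)/\<eta>) means that k is the integer part of
  \<eta> x. Both order relations thereby become one equation, which is easier to transfer.\<close>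

lemma in_cell_star_op:
  assumes Li: "i < length L" "L ! i = \<eta>"
    and G: "rel N (\<lambda>zs. \<exists>j::int. G zs = Num (of_int j)) L"
  shows "star_op N F L \<in> {x \<in> star_set N \<real>. ns_le N (star2 N (/) (star_op N G L) \<eta>) x \<and>
        ns_less N x (star2 N (\<lambda>k n. (k + 1) / n) (star_op N G L) \<eta>)} \<longleftrightarrow>
    rel N (\<lambda>zs. \<exists>t. F zs = Num (complex_of_real t) \<and> G zs = Num (of_int \<lfloor>Re (num_of (zs ! i)) * t\<rfloor>)) L"
proof -
  have e: "\<eta> = star_op N (\<lambda>zs. zs ! i) L"
    using star_op_nth[of i L] Li by simp
  let ?P = "\<lambda>zs. (\<exists>z\<in>\<real>. F zs = Num z) \<and>
      (\<exists>a b. Num (num_of (G zs) / num_of (zs ! i)) = Num (complex_of_real a) \<and> F zs = Num (complex_of_real b) \<and> a \<le> b) \<and>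
      (\<exists>a b. F zs = Num (complex_of_real a) \<and> Num ((num_of (G zs) + 1) / num_of (zs ! i)) = Num (complex_of_real b) \<and> a < b)"
  let ?Q = "\<lambda>zs. \<exists>t. F zs = Num (complex_of_real t) \<and> G zs = Num (of_int \<lfloor>Re (num_of (zs ! i)) * t\<rfloor>)"
  have 1: "star_op N F L \<in> {x \<in> star_set N \<real>. ns_le N (star2 N (/) (star_op N G L) \<eta>) x \<and>
        ns_less N x (star2 N (\<lambda>k n. (k + 1) / n) (star_op N G L) \<eta>)} \<longleftrightarrow> rel N ?P L"
    unfolding e mem_Collect_eq star2_star_op star_set_star_op ns_le_star_op ns_less_star_op rel_conj ..
  have iff: "?P zs \<longleftrightarrow> ?Q zs"
    if nat: "\<exists>n\<ge>1. zs ! i = Num (of_nat n)" and int: "\<exists>j::int. G zs = Num (of_int j)" for zs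
  proof -
    obtain n j where n: "n \<ge> 1" "zs ! i = Num (of_nat n)" and j: "G zs = Num (of_int j)"
      using nat int by blast
    have eqs: "complex_of_int j / of_nat n = of_real (of_int j / real n)"
      "(complex_of_int j + 1) / of_nat n = of_real ((of_int j + 1) / real n)" by simp_all
    have "?P zs \<longleftrightarrow> (\<exists>t. F zs = Num (complex_of_real t) \<and> of_int j / real n \<le> t \<and> t < (of_int j + 1) / real n)"
      unfolding n(2) j num_of.simps eqs obj.inject of_real_eq_iff by auto
    also have "\<dots> \<longleftrightarrow> ?Q zs"
      using floor_eq_iff_cell[OF n(1)] by (auto simp: n(2) j)
    finally show ?thesis .
  qed
  have "rel N ?P L \<longleftrightarrow> rel N ?Q L"
  proof
    assume "rel N ?P L"
    with eta_nat'[OF Li] G show "rel N ?Q L" by (rule rel_mp3) (rule iff[THEN iffD1])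
  next
    assume "rel N ?Q L"
    with eta_nat'[OF Li] G show "rel N ?P L" by (rule rel_mp3) (rule iff[THEN iffD2])
  qed
  with 1 show ?thesis by (rule trans)
qed

text \<open>Each comparison on the complex sort supplies its own real representatives; injectivity
  of \<open>of_real\<close> identifies them before the bounds can be read as integer bounds.\<close>

lemma index_set_star_op:
  assumes Li: "i < length L" "L ! i = \<eta>"
  shows "star_op N G L \<in> {k \<in> star_set N \<int>. ns_le N (star1 N (\<lambda>z. - z\<^sup>2) \<eta>) k \<and> ns_less N k (star1 N (\<lambda>z. z\<^sup>2) \<eta>)} \<longleftrightarrow>
    rel N (\<lambda>zs. \<exists>n\<ge>1. zs ! i = Num (of_nat n) \<and> (\<exists>j\<in>grid n. G zs = Num (of_int j))) L"
proof -
  have e: "\<eta> = star_op N (\<lambda>zs. zs ! i) L"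
    using star_op_nth[of i L] Li by simp
  let ?P = "\<lambda>zs. (\<exists>z\<in>\<int>. G zs = Num z) \<and>
      (\<exists>a b. Num (- (num_of (zs ! i))\<^sup>2) = Num (complex_of_real a) \<and> G zs = Num (complex_of_real b) \<and> a \<le> b) \<and>
      (\<exists>a b. G zs = Num (complex_of_real a) \<and> Num ((num_of (zs ! i))\<^sup>2) = Num (complex_of_real b) \<and> a < b)"
  let ?Q = "\<lambda>zs. \<exists>n\<ge>1. zs ! i = Num (of_nat n) \<and> (\<exists>j\<in>grid n. G zs = Num (of_int j))"
  have 1: "star_op N G L \<in> {k \<in> star_set N \<int>. ns_le N (star1 N (\<lambda>z. - z\<^sup>2) \<eta>) k \<and> ns_less N k (star1 N (\<lambda>z. z\<^sup>2) \<eta>)} \<longleftrightarrow> rel N ?P L"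
    unfolding e mem_Collect_eq star1_star_op star_set_star_op ns_le_star_op ns_less_star_op rel_conj ..
  have iff: "?P zs \<longleftrightarrow> ?Q zs" if nat: "\<exists>n\<ge>1. zs ! i = Num (of_nat n)" for zs
  proof -
    obtain n where n: "n \<ge> 1" "zs ! i = Num (of_nat n)"
      using nat by blast
    have eqs: "- ((complex_of_nat n)\<^sup>2) = of_real (- ((real n)\<^sup>2))" "(complex_of_nat n)\<^sup>2 = of_real ((real n)\<^sup>2)"
      by simp_all
    have le: "- (real n)\<^sup>2 \<le> of_int j \<longleftrightarrow> - ((int n)\<^sup>2) \<le> j" "of_int j < (real n)\<^sup>2 \<longleftrightarrow> j < (int n)\<^sup>2" for j
      by (metis of_int_le_iff of_int_minus of_int_of_nat_eq of_int_power,
          metis of_int_less_iff of_int_of_nat_eq of_int_power)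
    have int: "complex_of_int j = of_real b \<longleftrightarrow> b = of_int j" for j b
      by (metis of_real_eq_iff of_real_of_int_eq)
    have "?P zs \<longleftrightarrow> (\<exists>j. G zs = Num (of_int j) \<and> - (real n)\<^sup>2 \<le> of_int j \<and> of_int j < (real n)\<^sup>2)"
    proof
      assume "?P zs"
      then obtain z a b c d where *: "z \<in> \<int>" "G zs = Num z"
        "Num (- ((complex_of_nat n)\<^sup>2)) = Num (of_real a)" "G zs = Num (of_real b)" "a \<le> b"
        "G zs = Num (of_real c)" "Num ((complex_of_nat n)\<^sup>2) = Num (of_real d)" "c < d"
        unfolding n(2) num_of.simps by (elim conjE exE bexE)
      obtain j where j: "z = of_int j" using *(1) by (elim Ints_cases)
      have "complex_of_int j = of_real b" "complex_of_int j = of_real c"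
        using *(2,4,6) j by simp_all
      then have "a = - (real n)\<^sup>2" "d = (real n)\<^sup>2" "b = of_int j" "c = of_int j"
        using *(3,7) unfolding eqs obj.inject of_real_eq_iff int by simp_all
      with *(2,5,8) j show "\<exists>j. G zs = Num (of_int j) \<and> - (real n)\<^sup>2 \<le> of_int j \<and> of_int j < (real n)\<^sup>2"
        by auto
    next
      assume "\<exists>j. G zs = Num (of_int j) \<and> - (real n)\<^sup>2 \<le> of_int j \<and> of_int j < (real n)\<^sup>2"
      then obtain j where j: "G zs = Num (of_int j)" "- (real n)\<^sup>2 \<le> of_int j" "of_int j < (real n)\<^sup>2"
        by blast
      have "\<exists>z\<in>\<int>. G zs = Num z" using j(1) by (intro bexI[of _ "of_int j"]) simp_all
      moreover have "\<exists>a b. Num (- (num_of (zs ! i))\<^sup>2) = Num (complex_of_real a) \<and>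
          G zs = Num (complex_of_real b) \<and> a \<le> b"
        using j n by (intro exI[of _ "- (real n)\<^sup>2"] exI[of _ "of_int j"]) simp
      moreover have "\<exists>a b. G zs = Num (complex_of_real a) \<and>
          Num ((num_of (zs ! i))\<^sup>2) = Num (complex_of_real b) \<and> a < b"
        using j n by (intro exI[of _ "of_int j"] exI[of _ "(real n)\<^sup>2"]) simp
      ultimately show "?P zs" by (intro conjI)
    qed
    also have "\<dots> \<longleftrightarrow> ?Q zs"
      unfolding le using n by (auto simp: grid_def)
    finally show ?thesis .
  qed
  have "rel N ?P L \<longleftrightarrow> rel N ?Q L"
  proof
    assume "rel N ?P L"
    with eta_nat'[OF Li] show "rel N ?Q L" by (rule rel_mp2) (rule iff[THEN iffD1])
  next
    assume "rel N ?Q L"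
    with eta_nat'[OF Li] show "rel N ?P L" by (rule rel_mp2) (rule iff[THEN iffD2])
  qed
  with 1 show ?thesis by (rule trans)
qed

text \<open>Codes of members of the algebra: \<open>ext_in_C_alg\<close> and \<open>C_algE\<close>
  show that their extensions are exactly \<open>C_alg N \<eta>\<close>. From then on the algebra is
  handled through codes.\<close>

abbreviation cell_code :: "'s \<Rightarrow> bool" where
  "cell_code a \<equiv> is_set N a \<and> rel N (\<lambda>zs. cell_set (num_of (zs ! 0)) (set_of (zs ! 1))) [\<eta>, a]"

lemma cell_code_germ:
  assumes "rel N (\<lambda>zs. cell_set (num_of (zs ! 0)) (A zs)) (\<eta> # ys)"
  shows "cell_code (star_op N (\<lambda>zs. Set (A zs)) (\<eta> # ys))"
proof -
  define L where "L = \<eta> # ys"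
  have e: "\<eta> = star_op N (\<lambda>zs. zs ! 0) L"
    using star_op_nth[of 0 L] by (simp_all add: L_def)
  show ?thesis
    using assms unfolding L_def[symmetric] unfolding e by (simp add: rel_star_op2)
qed

text \<open>The index set consists of the grid integers whose left endpoint lies in the coded set;
  it is internal, being a germ in \<open>\<eta>\<close> and \<open>a\<close>.\<close>

lemma ext_in_C_alg:
  assumes "cell_code a"
  shows "ext N a \<in> C_alg N \<eta>"
proof -
  let ?K = "\<lambda>zs. {z. \<exists>n\<ge>1. zs ! 0 = Num (of_nat n) \<and> (\<exists>j\<in>grid n. z = of_int j \<and> of_int j / of_nat n \<in> set_of (zs ! 1))}"
  let ?k = "star_op N (\<lambda>zs. Set (?K zs)) [\<eta>, a]"
  let ?I = "\<lambda>k. {x \<in> star_set N \<real>. ns_le N (star2 N (/) k \<eta>) x \<and> ns_less N x (star2 N (\<lambda>k n. (k + 1) / n) k \<eta>)}"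
  have sub: "ext N ?k \<subseteq> {k \<in> star_set N \<int>. ns_le N (star1 N (\<lambda>z. - z\<^sup>2) \<eta>) k \<and> ns_less N k (star1 N (\<lambda>z. z\<^sup>2) \<eta>)}"
  proof
    fix y assume y: "y \<in> ext N ?k"
    define L where "L = [\<eta>, a, y]"
    have e: "\<eta> = star_op N (\<lambda>zs. zs ! 0) L" "a = star_op N (\<lambda>zs. zs ! 1) L" "y = star_op N (\<lambda>zs. zs ! 2) L"
      using star_op_nth[of _ L] by (simp_all add: L_def numeral_2_eq_2)
    have Li: "0 < length L" "L ! 0 = \<eta>" by (simp_all add: L_def)
    have "rel N (\<lambda>zs. \<exists>z A. zs ! 2 = Num z \<and> Set (?K zs) = Set A \<and> z \<in> A) L"
      using y unfolding e star_op_comp2 ext_star_op by simp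
    then show "y \<in> {k \<in> star_set N \<int>. ns_le N (star1 N (\<lambda>z. - z\<^sup>2) \<eta>) k \<and> ns_less N k (star1 N (\<lambda>z. z\<^sup>2) \<eta>)}"
      unfolding e(3) index_set_star_op[OF Li] by (rule rel_mono) auto
  qed
  moreover have "ext N a = (\<Union>k\<in>ext N ?k. ?I k)"
  proof (intro equalityI subsetI)
    fix x assume x: "x \<in> ext N a"
    define L where "L = [\<eta>, a, x]"
    have e: "\<eta> = star_op N (\<lambda>zs. zs ! 0) L" "a = star_op N (\<lambda>zs. zs ! 1) L" "x = star_op N (\<lambda>zs. zs ! 2) L"
      using star_op_nth[of _ L] by (simp_all add: L_def numeral_2_eq_2)
    have Li: "0 < length L" "L ! 0 = \<eta>" by (simp_all add: L_def)
    \<comment> \<open>The integer part of \<eta> x, the index of the cell that contains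
      \<open>x\<close>.\<close>
    let ?G = "\<lambda>zs. Num (of_int \<lfloor>Re (num_of (zs ! 0) * num_of (zs ! 2))\<rfloor>)"
    let ?y = "star_op N ?G L"
    have X: "rel N (\<lambda>zs. \<exists>z A. zs ! 2 = Num z \<and> zs ! 1 = Set A \<and> z \<in> A) L"
      using x unfolding e ext_star_op .
    have C: "rel N (\<lambda>zs. cell_set (num_of (zs ! 0)) (set_of (zs ! 1))) L"
      using assms unfolding e by (simp add: rel_star_op2)
    have "x \<in> ?I ?y"
      unfolding e(3)
    proof (subst in_cell_star_op[OF Li])
      show "rel N (\<lambda>zs. \<exists>j. ?G zs = Num (of_int j)) L" by (rule rel_valid) blast
      show "rel N (\<lambda>zs. \<exists>t. zs ! 2 = Num (complex_of_real t) \<and> ?G zs = Num (of_int \<lfloor>Re (num_of (zs ! 0)) * t\<rfloor>)) L"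
      proof (rule rel_mp3[OF X C eta_nat'[OF Li]])
        fix zs :: "obj list"
        assume 1: "\<exists>z A. zs ! 2 = Num z \<and> zs ! 1 = Set A \<and> z \<in> A"
          and 2: "cell_set (num_of (zs ! 0)) (set_of (zs ! 1))"
        from 1 obtain z where z: "zs ! 2 = Num z" "z \<in> set_of (zs ! 1)" by auto
        then have "z \<in> line (num_of (zs ! 0))" using 2 unfolding cell_set_def by blast
        then obtain t where "z = of_real t" by (rule lineE)
        then show "\<exists>t. zs ! 2 = Num (complex_of_real t) \<and> ?G zs = Num (of_int \<lfloor>Re (num_of (zs ! 0)) * t\<rfloor>)"
          using z by auto
      qed
    qed
    moreover have "?y \<in> ext N ?k"
    proof -
      have "rel N (\<lambda>zs. \<exists>z A. ?G zs = Num z \<and> Set (?K zs) = Set A \<and> z \<in> A) L"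
      proof (rule rel_mp3[OF X C eta_nat'[OF Li]])
        fix zs :: "obj list"
        assume 1: "\<exists>z A. zs ! 2 = Num z \<and> zs ! 1 = Set A \<and> z \<in> A"
          and 2: "cell_set (num_of (zs ! 0)) (set_of (zs ! 1))" and "\<exists>n\<ge>1. zs ! 0 = Num (of_nat n)"
        then obtain n where n: "n \<ge> 1" "zs ! 0 = Num (of_nat n)" by blast
        from 1 obtain z where z: "zs ! 2 = Num z" "z \<in> set_of (zs ! 1)" by auto
        then have "z \<in> line (of_nat n)" and cell: "cell (of_nat n) z \<in> set_of (zs ! 1)"
          using 2 n unfolding cell_set_def by auto
        then obtain t where t: "z = of_real t" "- real n \<le> t" "t < real n" by (auto elim!: lineE)
        then have "\<lfloor>real n * t\<rfloor> \<in> grid n"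
          using floor_grid_bounds[OF n(1), of t] by (auto simp: grid_def)
        moreover have "of_int \<lfloor>real n * t\<rfloor> / of_nat n \<in> set_of (zs ! 1)"
          using cell t by (simp add: cell_def)
        ultimately have "of_int \<lfloor>real n * t\<rfloor> \<in> ?K zs" using n by auto
        moreover have "?G zs = Num (of_int \<lfloor>real n * t\<rfloor>)" using n z t by simp
        ultimately show "\<exists>z A. ?G zs = Num z \<and> Set (?K zs) = Set A \<and> z \<in> A"
          by (intro exI[of _ "of_int \<lfloor>real n * t\<rfloor>"] exI[of _ "?K zs"] conjI refl)
      qed
      then show ?thesis unfolding e star_op_comp2 ext_star_op by simp
    qed
    ultimately show "x \<in> (\<Union>k\<in>ext N ?k. ?I k)" by blast
  next
    fix x assume "x \<in> (\<Union>k\<in>ext N ?k. ?I k)"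
    then obtain y where y: "y \<in> ext N ?k" and x: "x \<in> ?I y" by blast
    define L where "L = [\<eta>, a, x, y]"
    have e: "\<eta> = star_op N (\<lambda>zs. zs ! 0) L" "a = star_op N (\<lambda>zs. zs ! 1) L"
      "x = star_op N (\<lambda>zs. zs ! 2) L" "y = star_op N (\<lambda>zs. zs ! 3) L"
      using star_op_nth[of _ L] by (simp_all add: L_def numeral_2_eq_2 numeral_3_eq_3)
    have Li: "0 < length L" "L ! 0 = \<eta>" by (simp_all add: L_def)
    have Y: "rel N (\<lambda>zs. \<exists>z A. zs ! 3 = Num z \<and> Set (?K zs) = Set A \<and> z \<in> A) L"
      using y unfolding e star_op_comp2 ext_star_op by simp
    have X: "rel N (\<lambda>zs. \<exists>t. zs ! 2 = Num (complex_of_real t) \<and> zs ! 3 = Num (of_int \<lfloor>Re (num_of (zs ! 0)) * t\<rfloor>)) L"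
    proof -
      have "rel N (\<lambda>zs. \<exists>j::int. zs ! 3 = Num (of_int j)) L"
        by (rule rel_mono[OF Y]) auto
      from in_cell_star_op[OF Li this] show ?thesis
        using x unfolding e(3,4) by simp
    qed
    have C: "rel N (\<lambda>zs. cell_set (num_of (zs ! 0)) (set_of (zs ! 1)) \<and> (\<exists>A. zs ! 1 = Set A)) L"
      using assms unfolding e by (simp add: rel_star_op2 rel_conj is_set_star_op)
    have "rel N (\<lambda>zs. \<exists>z A. zs ! 2 = Num z \<and> zs ! 1 = Set A \<and> z \<in> A) L"
    proof (rule rel_mp3[OF X Y C])
      fix zs :: "obj list"
      assume 1: "\<exists>t. zs ! 2 = Num (complex_of_real t) \<and> zs ! 3 = Num (of_int \<lfloor>Re (num_of (zs ! 0)) * t\<rfloor>)"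
        and 2: "\<exists>z A. zs ! 3 = Num z \<and> Set (?K zs) = Set A \<and> z \<in> A"
        and 3: "cell_set (num_of (zs ! 0)) (set_of (zs ! 1)) \<and> (\<exists>A. zs ! 1 = Set A)"
      obtain t where t: "zs ! 2 = Num (complex_of_real t)" "zs ! 3 = Num (of_int \<lfloor>Re (num_of (zs ! 0)) * t\<rfloor>)"
        using 1 by blast
      obtain z where z: "zs ! 3 = Num z" "z \<in> ?K zs" using 2 by auto
      then obtain n j where n: "n \<ge> 1" "zs ! 0 = Num (of_nat n)" and j: "j \<in> grid n" "z = of_int j"
        "of_int j / of_nat n \<in> set_of (zs ! 1)" by blast
      have "j = \<lfloor>real n * t\<rfloor>" using t z n j by simp
      then have "complex_of_real t \<in> line (of_nat n)"
        using floor_grid_bounds[OF n(1), of t] j(1) by (auto simp: grid_def of_real_in_line)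
      moreover have "cell (of_nat n) (of_real t) \<in> set_of (zs ! 1)"
        using j \<open>j = _\<close> by (simp add: cell_def)
      ultimately have "of_real t \<in> set_of (zs ! 1)"
        using 3 n unfolding cell_set_def by auto
      then show "\<exists>z A. zs ! 2 = Num z \<and> zs ! 1 = Set A \<and> z \<in> A"
        using t 3 by auto
    qed
    then show "x \<in> ext N a" unfolding e ext_star_op .
  qed
  moreover have "internal_set N (ext N ?k)"
    unfolding internal_set_def by (intro exI[of _ ?k] conjI is_set_Set refl)
  ultimately show ?thesis
    unfolding C_alg_def mem_Collect_eq by (intro exI[of _ "ext N ?k"] conjI)
qed

text \<open>From an internal index set the code collects the points of the line whose cell has its
  index in it; multiplying the left endpoint by n recovers that index.\<close>

lemma C_algE:
  assumes "A \<in> C_alg N \<eta>"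
  obtains a where "cell_code a" "A = ext N a"
proof -
  let ?I = "\<lambda>k. {x \<in> star_set N \<real>. ns_le N (star2 N (/) k \<eta>) x \<and> ns_less N x (star2 N (\<lambda>k n. (k + 1) / n) k \<eta>)}"
  obtain K where K: "internal_set N K"
    and subK: "K \<subseteq> {k \<in> star_set N \<int>. ns_le N (star1 N (\<lambda>z. - z\<^sup>2) \<eta>) k \<and> ns_less N k (star1 N (\<lambda>z. z\<^sup>2) \<eta>)}"
    and AK: "A = (\<Union>k\<in>K. ?I k)"
    using assms unfolding C_alg_def mem_Collect_eq by (elim exE conjE)
  obtain k where k: "is_set N k" and extk: "ext N k = K"
    using K unfolding internal_set_def by (elim exE conjE)
  note sub = subK[folded extk] and A = AK[folded extk]
  let ?A = "\<lambda>zs. {z \<in> line (num_of (zs ! 0)). num_of (zs ! 0) * cell (num_of (zs ! 0)) z \<in> set_of (zs ! 1)}"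
  let ?a = "star_op N (\<lambda>zs. Set (?A zs)) [\<eta>, k]"
  have nz: "of_nat n * cell (of_nat n) z = of_int \<lfloor>Re (of_nat n * z)\<rfloor>" if "n \<ge> 1" for n z
    using that by (simp add: cell_def)
  have "cell_code ?a"
  proof (rule cell_code_germ)
    show "rel N (\<lambda>zs. cell_set (num_of (zs ! 0)) (?A zs)) [\<eta>, k]"
    proof (rule rel_mono[OF eta_nat'[of 0]])
      fix zs :: "obj list" assume "\<exists>n\<ge>1. zs ! 0 = Num (of_nat n)"
      then obtain n where n: "n \<ge> 1" "zs ! 0 = Num (of_nat n)" by blast
      show "cell_set (num_of (zs ! 0)) (?A zs)"
        unfolding n num_of.simps by (rule cell_set_Collect[OF n(1)])
    qed simp_all
  qed
  moreover have "A = ext N ?a"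
    unfolding A
  proof (intro equalityI subsetI)
    fix x assume "x \<in> (\<Union>k\<in>ext N k. ?I k)"
    then obtain y where y: "y \<in> ext N k" and x: "x \<in> ?I y" by blast
    define L where "L = [\<eta>, k, x, y]"
    have e: "\<eta> = star_op N (\<lambda>zs. zs ! 0) L" "k = star_op N (\<lambda>zs. zs ! 1) L"
      "x = star_op N (\<lambda>zs. zs ! 2) L" "y = star_op N (\<lambda>zs. zs ! 3) L"
      using star_op_nth[of _ L] by (simp_all add: L_def numeral_2_eq_2 numeral_3_eq_3)
    have Li: "0 < length L" "L ! 0 = \<eta>" by (simp_all add: L_def)
    have Y: "rel N (\<lambda>zs. \<exists>z A. zs ! 3 = Num z \<and> zs ! 1 = Set A \<and> z \<in> A) L"
      using y unfolding e ext_star_op .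
    have "y \<in> {k \<in> star_set N \<int>. ns_le N (star1 N (\<lambda>z. - z\<^sup>2) \<eta>) k \<and> ns_less N k (star1 N (\<lambda>z. z\<^sup>2) \<eta>)}"
      using y sub by blast
    then have J: "rel N (\<lambda>zs. \<exists>n\<ge>1. zs ! 0 = Num (of_nat n) \<and> (\<exists>j\<in>grid n. zs ! 3 = Num (of_int j))) L"
      unfolding e(4) index_set_star_op[OF Li] .
    have X: "rel N (\<lambda>zs. \<exists>t. zs ! 2 = Num (complex_of_real t) \<and> zs ! 3 = Num (of_int \<lfloor>Re (num_of (zs ! 0)) * t\<rfloor>)) L"
    proof -
      have "rel N (\<lambda>zs. \<exists>j::int. zs ! 3 = Num (of_int j)) L"
        by (rule rel_mono[OF J]) auto
      from in_cell_star_op[OF Li this] show ?thesis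
        using x unfolding e(3,4) by simp
    qed
    have "rel N (\<lambda>zs. \<exists>z A. zs ! 2 = Num z \<and> Set (?A zs) = Set A \<and> z \<in> A) L"
    proof (rule rel_mp3[OF X Y J])
      fix zs :: "obj list"
      assume 1: "\<exists>t. zs ! 2 = Num (complex_of_real t) \<and> zs ! 3 = Num (of_int \<lfloor>Re (num_of (zs ! 0)) * t\<rfloor>)"
        and 2: "\<exists>z A. zs ! 3 = Num z \<and> zs ! 1 = Set A \<and> z \<in> A"
        and 3: "\<exists>n\<ge>1. zs ! 0 = Num (of_nat n) \<and> (\<exists>j\<in>grid n. zs ! 3 = Num (of_int j))"
      obtain t where t: "zs ! 2 = Num (complex_of_real t)" "zs ! 3 = Num (of_int \<lfloor>Re (num_of (zs ! 0)) * t\<rfloor>)"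
        using 1 by blast
      obtain n j where n: "n \<ge> 1" "zs ! 0 = Num (of_nat n)" and j: "j \<in> grid n" "zs ! 3 = Num (of_int j)"
        using 3 by blast
      have jt: "j = \<lfloor>real n * t\<rfloor>" using t n j by simp
      then have "complex_of_real t \<in> line (of_nat n)"
        using floor_grid_bounds[OF n(1), of t] j(1) by (auto simp: grid_def of_real_in_line)
      moreover have "of_nat n * cell (of_nat n) (of_real t) \<in> set_of (zs ! 1)"
        using 2 j jt n(1) by (auto simp: nz)
      ultimately show "\<exists>z A. zs ! 2 = Num z \<and> Set (?A zs) = Set A \<and> z \<in> A"
        using t n by auto
    qed
    then show "x \<in> ext N ?a"
      unfolding e star_op_comp2 ext_star_op by simp
  next
    fix x assume x: "x \<in> ext N ?a"
    define L where "L = [\<eta>, k, x]"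
    have e: "\<eta> = star_op N (\<lambda>zs. zs ! 0) L" "k = star_op N (\<lambda>zs. zs ! 1) L" "x = star_op N (\<lambda>zs. zs ! 2) L"
      using star_op_nth[of _ L] by (simp_all add: L_def numeral_2_eq_2)
    have Li: "0 < length L" "L ! 0 = \<eta>" by (simp_all add: L_def)
    have X: "rel N (\<lambda>zs. \<exists>z A. zs ! 2 = Num z \<and> Set (?A zs) = Set A \<and> z \<in> A) L"
      using x unfolding e star_op_comp2 ext_star_op by simp
    have K: "rel N (\<lambda>zs. \<exists>A. zs ! 1 = Set A) L"
      using k unfolding e is_set_star_op .
    let ?G = "\<lambda>zs. Num (of_int \<lfloor>Re (num_of (zs ! 0) * num_of (zs ! 2))\<rfloor>)"
    let ?y = "star_op N ?G L"
    have "x \<in> ?I ?y"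
      unfolding e(3)
    proof (subst in_cell_star_op[OF Li])
      show "rel N (\<lambda>zs. \<exists>j. ?G zs = Num (of_int j)) L" by (rule rel_valid) blast
      show "rel N (\<lambda>zs. \<exists>t. zs ! 2 = Num (complex_of_real t) \<and> ?G zs = Num (of_int \<lfloor>Re (num_of (zs ! 0)) * t\<rfloor>)) L"
      proof (rule rel_mono[OF X])
        fix zs :: "obj list"
        assume "\<exists>z A. zs ! 2 = Num z \<and> Set (?A zs) = Set A \<and> z \<in> A"
        then obtain z where z: "zs ! 2 = Num z" "z \<in> line (num_of (zs ! 0))" by auto
        then obtain t where "z = of_real t" by (auto elim: lineE)
        then show "\<exists>t. zs ! 2 = Num (complex_of_real t) \<and> ?G zs = Num (of_int \<lfloor>Re (num_of (zs ! 0)) * t\<rfloor>)"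
          using z by auto
      qed
    qed
    moreover have "?y \<in> ext N k"
    proof -
      have "rel N (\<lambda>zs. \<exists>z A. ?G zs = Num z \<and> zs ! 1 = Set A \<and> z \<in> A) L"
        by (rule rel_mp3[OF X K eta_nat'[OF Li]]) (auto simp: nz)
      then show ?thesis unfolding e ext_star_op .
    qed
    ultimately show "x \<in> (\<Union>k\<in>ext N k. ?I k)" by blast
  qed
  ultimately show thesis by (rule that)
qed

end

section \<open>S-integrability\<close>

text \<open>The geometric mean of the two bounds: half of the decay is kept for summability, the
  other half is traded for the factor \<open>sqrt \<delta>\<close>.\<close>

lemma decay_sqrt_bound:
  fixes a x :: real
  assumes "0 \<le> a" "a \<le> \<delta>" "a \<le> C / (1 + x\<^sup>2)\<^sup>2"
  shows "a \<le> sqrt \<delta> * sqrt C * (1 / (1 + x\<^sup>2))"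
proof -
  have "a = sqrt a * sqrt a" using assms by simp
  also have "\<dots> \<le> sqrt \<delta> * sqrt (C / (1 + x\<^sup>2)\<^sup>2)"
    using assms by (intro mult_mono real_sqrt_le_mono) auto
  also have "sqrt (C / (1 + x\<^sup>2)\<^sup>2) = sqrt C / (1 + x\<^sup>2)"
    by (simp add: real_sqrt_divide)
  finally show ?thesis by simp
qed

context ns_infinite
begin

text \<open>Stated for real functions so that it applies to both Re g and Im g. Finiteness uses the
  summable majorant C / (1 + x^2), sets of infinitesimal measure use the bound C, and sets where the
  function is infinitesimal use the geometric mean of smallness and decay.\<close>

lemma S_integrable_real_decay:
  fixes h :: "real \<Rightarrow> real"
  assumes C: "0 < C" and decay: "\<And>x. \<bar>h x\<bar> \<le> C / (1 + x\<^sup>2)\<^sup>2"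
  shows "S_integrable_real N \<eta> (star2 N (\<lambda>n z. of_real (h (Re (cell n z)))) \<eta>)"
proof -
  let ?H = "\<lambda>n z. complex_of_real (h (Re (cell n z)))"
  let ?H' = "\<lambda>n z. complex_of_real \<bar>h (Re (cell n z))\<bar>"
  have norm_eq: "(\<lambda>x. star_norm N (star2 N ?H \<eta> x)) = star2 N ?H' \<eta>"
    by (simp add: star1_star2)
  obtain M where M: "0 \<le> M" "\<And>n. n \<ge> 1 \<Longrightarrow> riemann_sum n (\<lambda>x. 1 / (1 + x\<^sup>2)) \<le> M"
    using riemann_sum_inverse_quadratic_bounded by blast
  have h_le: "\<bar>h x\<bar> \<le> C * (1 / (1 + x\<^sup>2))" "\<bar>h x\<bar> \<le> C" for x
    using decay[of x] inverse_quadratic_square_le[of C x] C by auto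
  have norm_sum: "norm (grid_sum (?H' (of_nat n)) A (of_nat n)) =
      riemann_sum n (\<lambda>x. if complex_of_real x \<in> A then \<bar>h x\<bar> else 0)" if "n \<ge> 1" for n A
    using grid_sum_cell_real[OF that, of "\<lambda>x. \<bar>h x\<bar>" A] by (simp add: riemann_sum_nonneg)
  show ?thesis
    unfolding S_integrable_real_def norm_eq
  proof (intro conjI ballI impI)
    fix x
    define L where "L = [\<eta>, x]"
    have e: "\<eta> = star_op N (\<lambda>zs. zs ! 0) L" "x = star_op N (\<lambda>zs. zs ! 1) L"
      using star_op_nth[of _ L] by (simp_all add: L_def)
    show "star2 N ?H \<eta> x \<in> star_set N \<real>"
      unfolding e by (simp add: star_set_star_op rel_const)
  next
    show "internal_fun_on N (R_bar N \<eta>) (star2 N ?H \<eta>)"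
      unfolding internal_fun_on_def by (rule exI, rule codes_fun_on_star2)
  next
    show "C_measurable N \<eta> (star2 N ?H \<eta>)"
      unfolding C_measurable_def
    proof (intro allI impI)
      fix b assume b: "rel N (\<lambda>zs. \<exists>B\<in>sets borel. zs = [Set B]) [b]"
      \<comment> \<open>The function depends on \<open>z\<close> through its cell only, so this
        preimage is a union of cells.\<close>
      let ?A = "\<lambda>zs. {z \<in> line (num_of (zs ! 0)). ?H (num_of (zs ! 0)) z \<in> set_of (zs ! 1)}"
      have "{x \<in> R_bar N \<eta>. star2 N ?H \<eta> x \<in> ext N b} = ext N (star_op N (\<lambda>zs. Set (?A zs)) [\<eta>, b])"
      proof (rule set_eqI)
        fix x
        define L where "L = [\<eta>, b, x]"
        have e: "\<eta> = star_op N (\<lambda>zs. zs ! 0) L" "b = star_op N (\<lambda>zs. zs ! 1) L" "x = star_op N (\<lambda>zs. zs ! 2) L"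
          using star_op_nth[of _ L] by (simp_all add: L_def numeral_2_eq_2)
        have Li: "0 < length L" "L ! 0 = \<eta>" by (simp_all add: L_def)
        have B: "rel N (\<lambda>zs. \<exists>B. zs ! 1 = Set B) L"
          using b unfolding e rel_star_op1 by (rule rel_mono) auto
        have l: "x \<in> R_bar N \<eta> \<longleftrightarrow> rel N (\<lambda>zs. \<exists>z \<in> line (num_of (zs ! 0)). zs ! 2 = Num z) L"
          unfolding e(3) by (rule R_bar_star_op[OF Li])
        have m: "star2 N ?H \<eta> x \<in> ext N b \<longleftrightarrow> rel N (\<lambda>zs. \<exists>z B.
            Num (?H (num_of (zs ! 0)) (num_of (zs ! 2))) = Num z \<and> zs ! 1 = Set B \<and> z \<in> B) L"
          unfolding e star2_star_op ext_star_op ..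
        have r: "x \<in> ext N (star_op N (\<lambda>zs. Set (?A zs)) [\<eta>, b]) \<longleftrightarrow>
            rel N (\<lambda>zs. \<exists>z A. zs ! 2 = Num z \<and> Set (?A zs) = Set A \<and> z \<in> A) L"
          unfolding e star_op_comp2 ext_star_op by simp
        have "x \<in> R_bar N \<eta> \<and> star2 N ?H \<eta> x \<in> ext N b \<longleftrightarrow> x \<in> ext N (star_op N (\<lambda>zs. Set (?A zs)) [\<eta>, b])"
          unfolding r
        proof
          assume "x \<in> R_bar N \<eta> \<and> star2 N ?H \<eta> x \<in> ext N b"
          then have "rel N (\<lambda>zs. \<exists>z \<in> line (num_of (zs ! 0)). zs ! 2 = Num z) L"
            "rel N (\<lambda>zs. \<exists>z B. Num (?H (num_of (zs ! 0)) (num_of (zs ! 2))) = Num z \<and> zs ! 1 = Set B \<and> z \<in> B) L"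
            unfolding l m by simp_all
          then show "rel N (\<lambda>zs. \<exists>z A. zs ! 2 = Num z \<and> Set (?A zs) = Set A \<and> z \<in> A) L"
            by (rule rel_mp2) auto
        next
          assume R: "rel N (\<lambda>zs. \<exists>z A. zs ! 2 = Num z \<and> Set (?A zs) = Set A \<and> z \<in> A) L"
          show "x \<in> R_bar N \<eta> \<and> star2 N ?H \<eta> x \<in> ext N b"
            unfolding l m
          proof
            show "rel N (\<lambda>zs. \<exists>z \<in> line (num_of (zs ! 0)). zs ! 2 = Num z) L"
              by (rule rel_mono[OF R]) auto
            show "rel N (\<lambda>zs. \<exists>z B. Num (?H (num_of (zs ! 0)) (num_of (zs ! 2))) = Num z \<and> zs ! 1 = Set B \<and> z \<in> B) L"
              by (rule rel_mp2[OF R B]) auto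
          qed
        qed
        then show "x \<in> {x \<in> R_bar N \<eta>. star2 N ?H \<eta> x \<in> ext N b} \<longleftrightarrow>
            x \<in> ext N (star_op N (\<lambda>zs. Set (?A zs)) [\<eta>, b])"
          by simp
      qed
      moreover have "rel N (\<lambda>zs. cell_set (num_of (zs ! 0)) (?A zs)) [\<eta>, b]"
      proof (rule rel_mono[OF eta_nat'[of 0]])
        fix zs :: "obj list" assume "\<exists>n\<ge>1. zs ! 0 = Num (of_nat n)"
        then obtain n where n: "n \<ge> 1" "zs ! 0 = Num (of_nat n)" by blast
        show "cell_set (num_of (zs ! 0)) (?A zs)"
          unfolding n num_of.simps by (rule cell_set_Collect[OF n(1)])
      qed simp_all
      ultimately show "{x \<in> R_bar N \<eta>. star2 N ?H \<eta> x \<in> ext N b} \<in> C_alg N \<eta>"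
        using ext_in_C_alg[OF cell_code_germ] by simp
    qed
  next
    show "ns_finite N (int_lambda N \<eta> (R_bar N \<eta>) (star2 N ?H' \<eta>))"
      unfolding int_lambda_R_bar ns_finite_germ
    proof (rule exI, rule rel_mono[OF eta_nat'[of 0]])
      fix zs :: "obj list" assume "\<exists>n\<ge>1. zs ! 0 = Num (of_nat n)"
      then obtain n where n: "n \<ge> 1" "zs ! 0 = Num (of_nat n)" by blast
      have "riemann_sum n (\<lambda>x. \<bar>h x\<bar>) \<le> riemann_sum n (\<lambda>x. C * (1 / (1 + x\<^sup>2)))"
        by (rule riemann_sum_mono) (rule h_le)
      also have "\<dots> \<le> C * M"
        unfolding riemann_sum_cmult using M(2)[OF n(1)] C by (intro mult_left_mono) auto
      finally show "norm (grid_sum (?H' (num_of (zs ! 0))) (line (num_of (zs ! 0))) (num_of (zs ! 0))) \<le> C * M"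
        unfolding n(2) num_of.simps norm_sum[OF n(1)] riemann_sum_line[OF n(1)] .
    qed simp_all
  next
    fix A assume "A \<in> C_alg N \<eta>" and small: "infinitesimal N (lambda N \<eta> A)"
    then obtain a where a: "cell_code a" "A = ext N a" by (elim C_algE)
    define L where "L = [\<eta>, a]"
    have Li: "0 < length L" "L ! 0 = \<eta>" by (simp_all add: L_def)
    have a_eq: "a = star_op N (\<lambda>zs. Set (set_of (zs ! 1))) [\<eta>, a]"
      using is_set_germ[of L 1] a by (simp add: L_def)
    have lam: "lambda N \<eta> A = star_op N (\<lambda>zs. Num (grid_sum (\<lambda>_. 1) (set_of (zs ! 1)) (num_of (zs ! 0)))) L"
      unfolding a(2) L_def by (subst a_eq, rule lambda_germ)
    have int: "int_lambda N \<eta> A (star2 N ?H' \<eta>) =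
        star_op N (\<lambda>zs. Num (grid_sum (?H' (num_of (zs ! 0))) (set_of (zs ! 1)) (num_of (zs ! 0)))) L"
      unfolding a(2) L_def using a(1) by (intro int_lambda_star2) simp
    show "infinitesimal N (int_lambda N \<eta> A (star2 N ?H' \<eta>))"
      unfolding int infinitesimal_germ
    proof (intro allI impI)
      fix r :: real assume "r > 0"
      \<comment> \<open>As the function is bounded by C, its integral over \<open>A\<close> is at
        most C times the measure of \<open>A\<close>.\<close>
      then have "r / C > 0" using C by simp
      then have "rel N (\<lambda>zs. norm (grid_sum (\<lambda>_. 1) (set_of (zs ! 1)) (num_of (zs ! 0))) < r / C) L"
        by (rule small[unfolded lam infinitesimal_germ, rule_format])
      then show "rel N (\<lambda>zs. norm (grid_sum (?H' (num_of (zs ! 0))) (set_of (zs ! 1)) (num_of (zs ! 0))) < r) L"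
      proof (rule rel_mp2[OF _ eta_nat'[OF Li]])
        fix zs :: "obj list" assume "\<exists>n\<ge>1. zs ! 0 = Num (of_nat n)"
          and lt: "norm (grid_sum (\<lambda>_. 1) (set_of (zs ! 1)) (num_of (zs ! 0))) < r / C"
        then obtain n where n: "n \<ge> 1" "zs ! 0 = Num (of_nat n)" by blast
        let ?A = "set_of (zs ! 1)"
        let ?one = "\<lambda>x. if complex_of_real x \<in> ?A then 1 else 0 :: real"
        have "norm (grid_sum (\<lambda>_. 1) ?A (of_nat n)) = riemann_sum n ?one"
          using grid_sum_cell_real[OF n(1), of "\<lambda>_. 1" ?A] by (simp add: riemann_sum_nonneg)
        then have *: "riemann_sum n ?one < r / C" using lt n by simp
        have "riemann_sum n (\<lambda>x. if complex_of_real x \<in> ?A then \<bar>h x\<bar> else 0) \<le> riemann_sum n (\<lambda>x. C * ?one x)"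
          by (rule riemann_sum_mono) (use h_le(2) in auto)
        also have "\<dots> < r"
          unfolding riemann_sum_cmult using * C by (simp add: field_simps)
        finally show "norm (grid_sum (?H' (num_of (zs ! 0))) ?A (num_of (zs ! 0))) < r"
          unfolding n(2) num_of.simps norm_sum[OF n(1)] .
      qed
    qed
  next
    fix A assume "A \<in> C_alg N \<eta>" and small: "\<forall>x\<in>A. infinitesimal N (star_norm N (star2 N ?H \<eta> x))"
    then obtain a where a: "cell_code a" "A = ext N a" by (elim C_algE)
    define L where "L = [\<eta>, a]"
    have Li: "0 < length L" "L ! 0 = \<eta>" by (simp_all add: L_def)
    have int: "int_lambda N \<eta> A (star2 N ?H' \<eta>) =
        star_op N (\<lambda>zs. Num (grid_sum (?H' (num_of (zs ! 0))) (set_of (zs ! 1)) (num_of (zs ! 0)))) L"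
      unfolding a(2) L_def using a(1) by (intro int_lambda_star2) simp
    \<comment> \<open>Infinitesimality at each point of an internal set gives every standard bound
      \<delta> uniformly on the set; otherwise some internal point of the set would violate the
      bound.\<close>
    have pt: "rel N (\<lambda>zs. \<forall>z\<in>set_of (zs ! 1). \<bar>h (Re (cell (num_of (zs ! 0)) z))\<bar> \<le> \<delta>) L" if \<delta>: "\<delta> > 0" for \<delta>
    proof (rule ccontr)
      let ?P = "\<lambda>zs. \<exists>z\<in>set_of (zs ! 2). zs ! 0 = Num z \<and> \<delta> < \<bar>h (Re (cell (num_of (zs ! 1)) z))\<bar>"
      assume "\<not> rel N (\<lambda>zs. \<forall>z\<in>set_of (zs ! 1). \<bar>h (Re (cell (num_of (zs ! 0)) z))\<bar> \<le> \<delta>) L"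
      then have "rel N (\<lambda>zs. \<not> (\<forall>z\<in>set_of (zs ! 1). \<bar>h (Re (cell (num_of (zs ! 0)) z))\<bar> \<le> \<delta>)) L"
        by (simp only: rel_not) simp
      then have "rel N (\<lambda>zs. \<exists>z. ?P (z # zs)) L"
        by (rule rel_mono) (auto simp: numeral_2_eq_2 not_le)
      then have "\<exists>x. rel N ?P (x # L)"
        by (rule rel_ex[of ?P, THEN iffD1])
      then obtain x where P: "rel N ?P (x # L)" ..
      define L' where "L' = x # L"
      have e: "x = star_op N (\<lambda>zs. zs ! 0) L'" "\<eta> = star_op N (\<lambda>zs. zs ! 1) L'" "a = star_op N (\<lambda>zs. zs ! 2) L'"
        using star_op_nth[of _ L'] by (simp_all add: L'_def L_def numeral_2_eq_2)
      have "x \<in> ext N a"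
      proof -
        have "is_set N a" using a by simp
        then have "rel N (\<lambda>zs. \<exists>A. zs ! 2 = Set A) L'" unfolding e is_set_star_op .
        with P[folded L'_def] show ?thesis
          unfolding e ext_star_op by (rule rel_mp2) auto
      qed
      then have "infinitesimal N (star2 N ?H' \<eta> x)"
        using small a(2) by (simp add: star1_star2)
      then have "rel N (\<lambda>zs. norm (?H' (num_of (zs ! 1)) (num_of (zs ! 0))) < \<delta>) L'"
        using \<delta> unfolding e star2_star_op infinitesimal_germ by simp
      with P[folded L'_def] have "rel N (\<lambda>_. False) L'"
        by (rule rel_mp2) auto
      then show False by (simp add: rel_const)
    qed
    show "infinitesimal N (int_lambda N \<eta> A (star2 N ?H' \<eta>))"
      unfolding int infinitesimal_germ
    proof (intro allI impI)
      fix r :: real assume r: "r > 0"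
      define D where "D = sqrt C * M"
      have D: "D \<ge> 0" using C M by (simp add: D_def)
      \<comment> \<open>Chosen so that sqrt \<delta> times D is r D / (D + 1), which is below r; the
        added 1 also covers D = 0.\<close>
      define \<delta> where "\<delta> = (r / (D + 1))\<^sup>2"
      have \<delta>: "\<delta> > 0" "sqrt \<delta> = r / (D + 1)"
        using r D by (auto simp: \<delta>_def)
      show "rel N (\<lambda>zs. norm (grid_sum (?H' (num_of (zs ! 0))) (set_of (zs ! 1)) (num_of (zs ! 0))) < r) L"
      proof (rule rel_mp2[OF pt[OF \<delta>(1)] eta_nat'[OF Li]])
        fix zs :: "obj list" assume "\<exists>n\<ge>1. zs ! 0 = Num (of_nat n)"
          and le: "\<forall>z\<in>set_of (zs ! 1). \<bar>h (Re (cell (num_of (zs ! 0)) z))\<bar> \<le> \<delta>"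
        then obtain n where n: "n \<ge> 1" "zs ! 0 = Num (of_nat n)" by blast
        let ?A = "set_of (zs ! 1)"
        have "riemann_sum n (\<lambda>x. if complex_of_real x \<in> ?A then \<bar>h x\<bar> else 0) \<le>
            riemann_sum n (\<lambda>x. sqrt \<delta> * sqrt C * (1 / (1 + x\<^sup>2)))"
        proof (rule riemann_sum_mono)
          fix k
          let ?x = "of_int k / real n"
          have "\<bar>h ?x\<bar> \<le> \<delta>" if "complex_of_real ?x \<in> ?A"
          proof -
            have "cell (of_nat n) (of_real ?x) = of_real ?x"
              using cell_grid_point[OF n(1), of k] by simp
            then show ?thesis using le that n by fastforce
          qed
          then show "(if complex_of_real ?x \<in> ?A then \<bar>h ?x\<bar> else 0) \<le> sqrt \<delta> * sqrt C * (1 / (1 + ?x\<^sup>2))"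
            using decay_sqrt_bound[OF _ _ decay[of ?x], of \<delta>] \<delta>(1) C by (auto intro!: mult_nonneg_nonneg)
        qed
        also have "\<dots> \<le> sqrt \<delta> * sqrt C * M"
          unfolding riemann_sum_cmult using M(2)[OF n(1)] \<delta>(1) C by (intro mult_left_mono) auto
        also have "\<dots> = r * (D / (D + 1))"
          by (simp add: \<delta>(2) D_def)
        also have "\<dots> < r * 1"
          using r D by (intro mult_strict_left_mono) auto
        finally show "norm (grid_sum (?H' (num_of (zs ! 0))) ?A (num_of (zs ! 0))) < r"
          unfolding n(2) num_of.simps norm_sum[OF n(1)] by simp
      qed
    qed
  qed
qed

lemma S_integrable_g_eta:
  assumes "g \<in> Schwartz"
  shows "S_integrable N \<eta> (g_eta N \<eta> g)"
proof -
  obtain C where C: "0 < C" "\<And>x. norm (g x) \<le> C / (1 + x\<^sup>2)\<^sup>2"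
    using Schwartz_bound[OF assms] by blast
  show ?thesis
    unfolding S_integrable_def g_eta_eq
  proof (intro conjI ballI)
    fix x
    define L where "L = [\<eta>, x]"
    have e: "\<eta> = star_op N (\<lambda>zs. zs ! 0) L" "x = star_op N (\<lambda>zs. zs ! 1) L"
      using star_op_nth[of _ L] by (simp_all add: L_def)
    show "star2 N (\<lambda>n z. g (Re (cell n z))) \<eta> x \<in> star_set N UNIV"
      unfolding e by (simp add: star_set_star_op rel_const)
  next
    have "\<bar>Re (g x)\<bar> \<le> C / (1 + x\<^sup>2)\<^sup>2" for x
      using abs_Re_le_cmod C(2) by (rule order_trans)
    from S_integrable_real_decay[OF C(1) this]
    show "S_integrable_real N \<eta> (\<lambda>x. star_Re N (star2 N (\<lambda>n z. g (Re (cell n z))) \<eta> x))"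
      by (simp add: star1_star2)
  next
    have "\<bar>Im (g x)\<bar> \<le> C / (1 + x\<^sup>2)\<^sup>2" for x
      using abs_Im_le_cmod C(2) by (rule order_trans)
    from S_integrable_real_decay[OF C(1) this]
    show "S_integrable_real N \<eta> (\<lambda>x. star_Im N (star2 N (\<lambda>n z. g (Re (cell n z))) \<eta> x))"
      by (simp add: star1_star2)
  qed
qed

text \<open>Closeness to the Lebesgue integral within every standard tolerance yields the standard
  part; tolerance 1 alone yields finiteness, without which the standard part would say
  nothing.\<close>

lemma int_lambda_g_eta:
  assumes "g \<in> Schwartz"
  shows "ns_finite N (int_lambda N \<eta> (R_bar N \<eta>) (g_eta N \<eta> g))"
    and "complex_st N (int_lambda N \<eta> (R_bar N \<eta>) (g_eta N \<eta> g)) = integral\<^sup>L lborel g"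
proof -
  obtain C where C: "0 < C" "\<And>x. norm (g x) \<le> C / (1 + x\<^sup>2)\<^sup>2"
    using Schwartz_bound[OF assms] by blast
  have cont: "isCont g x" for x by (rule Schwartz_isCont[OF assms])
  have "(\<lambda>n. riemann_sum n g) \<longlonglongrightarrow> integral\<^sup>L lborel g"
  proof (rule riemann_sum_LIMSEQ)
    show "g \<in> borel_measurable borel"
      by (rule Schwartz_measurable[OF assms])
    show "norm (g x) \<le> C / (1 + x\<^sup>2)" for x
      using C(2)[of x] inverse_quadratic_square_le(1)[of C x] C(1) by linarith
  qed (use cont in simp)
  then have lim: "\<forall>\<^sub>F n in sequentially. norm (riemann_sum n g - integral\<^sup>L lborel g) < r" if "r > 0" for r
    using that by (auto simp: tendsto_iff dist_norm)
  let ?S = "\<lambda>zs. grid_sum (\<lambda>z. g (Re (cell (num_of (zs ! 0)) z))) (line (num_of (zs ! 0))) (num_of (zs ! 0))"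
  have near: "rel N (\<lambda>zs. norm (?S zs - integral\<^sup>L lborel g) < r) [\<eta>]" if "r > 0" for r
  proof (rule rel_mono[OF eta_eventually[OF lim[OF that], of 0]])
    fix zs :: "obj list"
    assume "\<exists>n\<ge>1. zs ! 0 = Num (of_nat n) \<and> norm (riemann_sum n g - integral\<^sup>L lborel g) < r"
    then obtain n where n: "n \<ge> 1" "zs ! 0 = Num (of_nat n)" "norm (riemann_sum n g - integral\<^sup>L lborel g) < r"
      by blast
    have "?S zs = riemann_sum n g"
      unfolding n(2) num_of.simps grid_sum_cell[OF n(1), of g] by (rule riemann_sum_line[OF n(1)])
    with n(3) show "norm (?S zs - integral\<^sup>L lborel g) < r" by simp
  qed simp_all
  show "complex_st N (int_lambda N \<eta> (R_bar N \<eta>) (g_eta N \<eta> g)) = integral\<^sup>L lborel g"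
    unfolding g_eta_eq int_lambda_R_bar by (rule complex_st_germ) (rule near)
  show "ns_finite N (int_lambda N \<eta> (R_bar N \<eta>) (g_eta N \<eta> g))"
    unfolding g_eta_eq int_lambda_R_bar ns_finite_germ
  proof (rule exI, rule rel_mono[OF near[of 1]])
    fix zs assume "norm (?S zs - integral\<^sup>L lborel g) < 1"
    then show "norm (?S zs) \<le> norm (integral\<^sup>L lborel g) + 1"
      using norm_triangle_ineq2[of "?S zs" "integral\<^sup>L lborel g"] by linarith
  qed simp
qed

end

section \<open>Standard parts\<close>

lemma Re_cell_bounds:
  assumes "n \<ge> 1"
  shows "\<bar>Re (cell (of_nat n) (of_real t)) - t\<bar> \<le> 1 / real n"
  unfolding cell_of_nat Re_complex_of_real
  using floor_mult_div_bounds[OF assms, of t] by linarith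

context ns_infinite
begin

lemma R_bar_germ:
  assumes "x \<in> R_bar N \<eta>"
  shows "x = star_op N (\<lambda>zs. Num (num_of (zs ! 1))) [\<eta>, x]"
    and "rel N (\<lambda>zs. \<exists>n\<ge>1. zs ! 0 = Num (of_nat n) \<and>
      (\<exists>t. zs ! 1 = Num (of_real t) \<and> complex_of_real t \<in> line (of_nat n))) [\<eta>, x]"
proof -
  define L where "L = [\<eta>, x]"
  have e: "x = star_op N (\<lambda>zs. zs ! 1) L"
    using star_op_nth[of 1 L] by (simp_all add: L_def)
  have Li: "0 < length L" "L ! 0 = \<eta>" by (simp_all add: L_def)
  have R: "rel N (\<lambda>zs. \<exists>z \<in> line (num_of (zs ! 0)). zs ! 1 = Num z) L"
    using assms by (subst (asm) e) (simp add: R_bar_star_op[OF Li])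
  show "rel N (\<lambda>zs. \<exists>n\<ge>1. zs ! 0 = Num (of_nat n) \<and>
      (\<exists>t. zs ! 1 = Num (of_real t) \<and> complex_of_real t \<in> line (of_nat n))) [\<eta>, x]"
    unfolding L_def[symmetric]
  proof (rule rel_mp2[OF R eta_nat'[OF Li]])
    fix zs :: "obj list"
    assume 1: "\<exists>z \<in> line (num_of (zs ! 0)). zs ! 1 = Num z" and 2: "\<exists>n\<ge>1. zs ! 0 = Num (of_nat n)"
    obtain n where n: "n \<ge> 1" "zs ! 0 = Num (of_nat n)" using 2 by blast
    obtain z where z: "z \<in> line (of_nat n)" "zs ! 1 = Num z" using 1 n by auto
    obtain t where "z = of_real t" using z(1) by (rule lineE)
    then show "\<exists>n\<ge>1. zs ! 0 = Num (of_nat n) \<and> (\<exists>t. zs ! 1 = Num (of_real t) \<and> complex_of_real t \<in> line (of_nat n))"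
      using n z by auto
  qed
  have "star_op N (\<lambda>zs. zs ! 1) L = star_op N (\<lambda>zs. Num (num_of (zs ! 1))) L"
    unfolding star_op_eq_iff by (rule rel_mono[OF R]) auto
  with e have "x = star_op N (\<lambda>zs. Num (num_of (zs ! 1))) L" by (rule trans)
  then show "x = star_op N (\<lambda>zs. Num (num_of (zs ! 1))) [\<eta>, x]" unfolding L_def .
qed

lemma ns_finite_iff:
  assumes "x \<in> R_bar N \<eta>"
  shows "ns_finite N x \<longleftrightarrow> (\<exists>r. rel N (\<lambda>zs. norm (num_of (zs ! 1)) \<le> r) [\<eta>, x])"
  by (subst R_bar_germ(1)[OF assms]) (rule ns_finite_germ)

text \<open>The point and the left endpoint of its cell are both recorded, since g is evaluated at
  the endpoint while the standard part belongs to the point.\<close>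

lemma real_st_near:
  assumes x: "x \<in> R_bar N \<eta>" and fin: "ns_finite N x" and "r > 0"
  shows "rel N (\<lambda>zs. \<exists>n\<ge>1. zs ! 0 = Num (of_nat n) \<and>
      (\<exists>t. zs ! 1 = Num (of_real t) \<and> complex_of_real t \<in> line (of_nat n) \<and> \<bar>t - real_st N x\<bar> < r \<and>
        \<bar>Re (cell (of_nat n) (of_real t)) - real_st N x\<bar> < r)) [\<eta>, x]"
proof -
  define L where "L = [\<eta>, x]"
  have Li: "0 < length L" "L ! 0 = \<eta>" by (simp_all add: L_def)
  note R = R_bar_germ(2)[OF x, folded L_def]
  obtain b where b: "rel N (\<lambda>zs. norm (num_of (zs ! 1)) \<le> b) L"
    using fin ns_finite_iff[OF x] by (auto simp: L_def)
  moreover have "rel N (\<lambda>zs. num_of (zs ! 1) \<in> \<real>) L"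
    by (rule rel_mono[OF R]) auto
  ultimately obtain c :: real where c: "\<And>r. r > 0 \<Longrightarrow> rel N (\<lambda>zs. norm (num_of (zs ! 1) - of_real c) < r) L"
    by (rule ex_real_st_germ) blast
  have "real_st N (star_op N (\<lambda>zs. Num (num_of (zs ! 1))) L) = c"
    by (rule real_st_germ) (rule c)
  then have st: "real_st N x = c"
    by (subst R_bar_germ(1)[OF x]) (simp add: L_def)
  \<comment> \<open>Half of the tolerance pays for rounding, the other half for the distance from
    the point to its standard part.\<close>
  have "\<forall>\<^sub>F n in sequentially. 1 / real n < r / 2"
    using \<open>r > 0\<close> order_tendstoD(2)[OF lim_1_over_n[where 'a=real], of "r / 2"] by simp
  from eta_eventually[OF this Li]
  have n: "rel N (\<lambda>zs. \<exists>n\<ge>1. zs ! 0 = Num (of_nat n) \<and> 1 / real n < r / 2) L" .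
  from \<open>r > 0\<close> have "r / 2 > 0" by simp
  show ?thesis
    unfolding st L_def[symmetric]
  proof (rule rel_mp3[OF R n c[OF \<open>r / 2 > 0\<close>]])
    fix zs :: "obj list"
    assume 1: "\<exists>n\<ge>1. zs ! 0 = Num (of_nat n) \<and> (\<exists>t. zs ! 1 = Num (of_real t) \<and> complex_of_real t \<in> line (of_nat n))"
      and 2: "\<exists>n\<ge>1. zs ! 0 = Num (of_nat n) \<and> 1 / real n < r / 2"
      and 3: "norm (num_of (zs ! 1) - complex_of_real c) < r / 2"
    obtain n t where n: "n \<ge> 1" "zs ! 0 = Num (of_nat n)"
      and t: "zs ! 1 = Num (of_real t)" "complex_of_real t \<in> line (of_nat n)"
      using 1 by blast
    have "1 / real n < r / 2" using 2 n by auto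
    moreover have "\<bar>t - c\<bar> < r / 2"
      using 3 t(1) by (simp only: num_of.simps of_real_diff[symmetric] norm_of_real)
    ultimately have "\<bar>t - c\<bar> < r" "\<bar>Re (cell (of_nat n) (of_real t)) - c\<bar> < r"
      using Re_cell_bounds[OF n(1), of t] by linarith+
    then show "\<exists>n\<ge>1. zs ! 0 = Num (of_nat n) \<and>
      (\<exists>t. zs ! 1 = Num (of_real t) \<and> complex_of_real t \<in> line (of_nat n) \<and> \<bar>t - c\<bar> < r \<and>
        \<bar>Re (cell (of_nat n) (of_real t)) - c\<bar> < r)"
      using n t by blast
  qed
qed

text \<open>Infinite points exceed \<open>b + 1\<close> in absolute value; the extra 1 absorbs the
  rounding error 1/n.\<close>

lemma not_ns_finite_large:
  assumes x: "x \<in> R_bar N \<eta>" and inf: "\<not> ns_finite N x"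
  shows "rel N (\<lambda>zs. \<exists>n\<ge>1. zs ! 0 = Num (of_nat n) \<and>
      (\<exists>t. zs ! 1 = Num (of_real t) \<and> \<bar>Re (cell (of_nat n) (of_real t))\<bar> > b)) [\<eta>, x]"
proof -
  have "\<not> rel N (\<lambda>zs. norm (num_of (zs ! 1)) \<le> b + 1) [\<eta>, x]"
    using inf ns_finite_iff[OF x] by blast
  then have "rel N (\<lambda>zs. \<not> norm (num_of (zs ! 1)) \<le> b + 1) [\<eta>, x]"
    by (simp only: rel_not) simp
  with R_bar_germ(2)[OF x] show ?thesis
  proof (rule rel_mp2)
    fix zs :: "obj list"
    assume 1: "\<exists>n\<ge>1. zs ! 0 = Num (of_nat n) \<and> (\<exists>t. zs ! 1 = Num (of_real t) \<and> complex_of_real t \<in> line (of_nat n))"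
      and 2: "\<not> norm (num_of (zs ! 1)) \<le> b + 1"
    obtain n t where n: "n \<ge> 1" "zs ! 0 = Num (of_nat n)" and t: "zs ! 1 = Num (of_real t)"
      using 1 by blast
    have "1 / real n \<le> 1" using n by simp
    moreover have "\<bar>t\<bar> > b + 1" using 2 t by simp
    ultimately have "\<bar>Re (cell (of_nat n) (of_real t))\<bar> > b"
      using Re_cell_bounds[OF n(1), of t] by linarith
    then show "\<exists>n\<ge>1. zs ! 0 = Num (of_nat n) \<and> (\<exists>t. zs ! 1 = Num (of_real t) \<and> \<bar>Re (cell (of_nat n) (of_real t))\<bar> > b)"
      using n t by blast
  qed
qed

lemma g_eta_germ:
  assumes "x \<in> R_bar N \<eta>"
  shows "g_eta N \<eta> g x = star_op N (\<lambda>zs. Num (g (Re (cell (num_of (zs ! 0)) (num_of (zs ! 1)))))) [\<eta>, x]"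
proof -
  define L where "L = [\<eta>, x]"
  have e: "\<eta> = star_op N (\<lambda>zs. zs ! 0) L" "x = star_op N (\<lambda>zs. zs ! 1) L"
    using star_op_nth[of _ L] by (simp_all add: L_def)
  show ?thesis
    unfolding L_def[symmetric] unfolding g_eta_eq e by simp
qed

lemma st_pullback_g_infty:
  "st_pullback N (g_infty g) x = (if ns_finite N x then g (real_st N x) else 0)"
  by (simp add: st_pullback_def st_bar_def g_infty_def)

text \<open>At finite points this is continuity of g at the standard part. At infinite points it is
  decay of g, and 0 is the value that \<open>g_infty\<close> prescribes there.\<close>

lemma g_eta_standard_part:
  assumes g: "g \<in> Schwartz" and x: "x \<in> R_bar N \<eta>"
  shows "ns_finite N (g_eta N \<eta> g x)"
    and "complex_st N (g_eta N \<eta> g x) = st_pullback N (g_infty g) x"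
proof -
  obtain C where C: "0 < C" "\<And>x. norm (g x) \<le> C / (1 + x\<^sup>2)\<^sup>2"
    using Schwartz_bound[OF g] by blast
  have C1: "norm (g y) \<le> C / (1 + y\<^sup>2)" for y
    using C(2)[of y] inverse_quadratic_square_le(1)[of C y] C(1) by linarith
  have C2: "norm (g y) \<le> C" for y
    using C1[of y] inverse_quadratic_square_le(2)[of C y] C(1) by linarith
  show "ns_finite N (g_eta N \<eta> g x)"
    unfolding g_eta_germ[OF x] ns_finite_germ using C2 by (intro exI[of _ C] rel_valid)
  show "complex_st N (g_eta N \<eta> g x) = st_pullback N (g_infty g) x"
    unfolding g_eta_germ[OF x] st_pullback_g_infty
  proof (rule complex_st_germ)
    fix r :: real assume r: "r > 0"
    let ?g = "\<lambda>zs. g (Re (cell (num_of (zs ! 0)) (num_of (zs ! 1))))"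
    show "rel N (\<lambda>zs. norm (?g zs - (if ns_finite N x then g (real_st N x) else 0)) < r) [\<eta>, x]"
    proof (cases "ns_finite N x")
      case True
      obtain d where d: "d > 0" "\<And>y. \<bar>y - real_st N x\<bar> < d \<Longrightarrow> norm (g y - g (real_st N x)) < r"
        using Schwartz_isCont[OF g, of "real_st N x"] r
        unfolding continuous_at_eps_delta dist_norm real_norm_def by blast
      have "rel N (\<lambda>zs. norm (?g zs - g (real_st N x)) < r) [\<eta>, x]"
        by (rule rel_mono[OF real_st_near[OF x True d(1)]]) (auto intro!: d(2))
      then show ?thesis using True by simp
    next
      case False
      \<comment> \<open>Beyond the threshold \<open>sqrt (C / r)\<close> the majorant C / (1 + y^2)
        drops below \<open>r\<close>.\<close>
      have "rel N (\<lambda>zs. norm (?g zs) < r) [\<eta>, x]"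
      proof (rule rel_mono[OF not_ns_finite_large[OF x False, of "sqrt (C / r)"]])
        fix zs :: "obj list"
        assume "\<exists>n\<ge>1. zs ! 0 = Num (of_nat n) \<and>
          (\<exists>t. zs ! 1 = Num (of_real t) \<and> \<bar>Re (cell (of_nat n) (of_real t))\<bar> > sqrt (C / r))"
        then obtain n t where n: "zs ! 0 = Num (of_nat n)" "zs ! 1 = Num (of_real t)"
          and gt: "\<bar>Re (cell (of_nat n) (of_real t))\<bar> > sqrt (C / r)" by blast
        define y where "y = Re (cell (of_nat n) (of_real t))"
        have "C / r < y\<^sup>2"
          using gt C(1) r by (metis y_def real_less_rsqrt not_less real_sqrt_abs real_sqrt_less_iff)
        then have "C < r * (1 + y\<^sup>2)" using r by (simp add: field_simps)
        then have "C / (1 + y\<^sup>2) < r"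
          by (simp add: divide_less_eq add_pos_nonneg)
        then have "norm (g y) < r" using C1[of y] by linarith
        then show "norm (?g zs) < r" unfolding n num_of.simps y_def .
      qed
      then show ?thesis using False by simp
    qed
  qed
qed

section \<open>The Loeb measure\<close>

lemma rel_disj: "rel N (\<lambda>zs. P zs \<or> Q zs) xs \<longleftrightarrow> rel N P xs \<or> rel N Q xs"
proof -
  have "rel N (\<lambda>zs. P zs \<or> Q zs) xs \<longleftrightarrow> rel N (\<lambda>zs. \<not> (\<not> P zs \<and> \<not> Q zs)) xs"
    by (rule rel_cong) blast
  then show ?thesis by (simp only: rel_not rel_conj) blast
qed

text \<open>The explicit code is part of the conclusion because additivity compares the three
  measures as germs at one common tuple.\<close>

lemma ext_Un:
  assumes a: "cell_code a" and b: "cell_code b"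
  obtains c where "cell_code c" "ext N c = ext N a \<union> ext N b"
    "c = star_op N (\<lambda>zs. Set (set_of (zs ! 1) \<union> set_of (zs ! 2))) [\<eta>, a, b]"
proof -
  let ?c = "star_op N (\<lambda>zs. Set (set_of (zs ! 1) \<union> set_of (zs ! 2))) [\<eta>, a, b]"
  have "rel N (\<lambda>zs. cell_set (num_of (zs ! 0)) (set_of (zs ! 1) \<union> set_of (zs ! 2))) [\<eta>, a, b]"
  proof -
    define L where "L = [\<eta>, a, b]"
    have e: "\<eta> = star_op N (\<lambda>zs. zs ! 0) L" "a = star_op N (\<lambda>zs. zs ! 1) L" "b = star_op N (\<lambda>zs. zs ! 2) L"
      using star_op_nth[of _ L] by (simp_all add: L_def numeral_2_eq_2)
    have "rel N (\<lambda>zs. cell_set (num_of (zs ! 0)) (set_of (zs ! 1))) L"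
      "rel N (\<lambda>zs. cell_set (num_of (zs ! 0)) (set_of (zs ! 2))) L"
      using a b unfolding e by (simp_all add: rel_star_op2)
    then show ?thesis
      unfolding L_def[symmetric] by (rule rel_mp2) (simp add: cell_set_def, blast)
  qed
  then have "cell_code ?c" by (rule cell_code_germ)
  moreover have "ext N ?c = ext N a \<union> ext N b"
  proof (rule set_eqI)
    fix x
    define L where "L = [\<eta>, a, b, x]"
    have e: "\<eta> = star_op N (\<lambda>zs. zs ! 0) L" "a = star_op N (\<lambda>zs. zs ! 1) L"
      "b = star_op N (\<lambda>zs. zs ! 2) L" "x = star_op N (\<lambda>zs. zs ! 3) L"
      using star_op_nth[of _ L] by (simp_all add: L_def numeral_2_eq_2 numeral_3_eq_3)
    have A: "rel N (\<lambda>zs. (\<exists>A. zs ! 1 = Set A) \<and> (\<exists>A. zs ! 2 = Set A)) L"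
      using a b unfolding e by (simp add: is_set_star_op rel_conj)
    have "x \<in> ext N ?c \<longleftrightarrow> rel N (\<lambda>zs. \<exists>z A. zs ! 3 = Num z \<and> Set (set_of (zs ! 1) \<union> set_of (zs ! 2)) = Set A \<and> z \<in> A) L"
      unfolding e star_op_comp3 ext_star_op by (simp add: numeral_2_eq_2)
    also have "\<dots> \<longleftrightarrow> rel N (\<lambda>zs. (\<exists>z A. zs ! 3 = Num z \<and> zs ! 1 = Set A \<and> z \<in> A) \<or>
        (\<exists>z A. zs ! 3 = Num z \<and> zs ! 2 = Set A \<and> z \<in> A)) L" (is "rel N ?P L \<longleftrightarrow> rel N ?Q L")
    proof
      assume "rel N ?P L"
      with A show "rel N ?Q L" by (rule rel_mp2) auto
    next
      assume "rel N ?Q L"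
      with A show "rel N ?P L" by (rule rel_mp2) auto
    qed
    also have "\<dots> \<longleftrightarrow> x \<in> ext N a \<union> ext N b"
      unfolding e rel_disj Un_iff ext_star_op ..
    finally show "x \<in> ext N ?c \<longleftrightarrow> x \<in> ext N a \<union> ext N b" .
  qed
  ultimately show thesis by (rule that) simp
qed

lemma ext_Compl:
  assumes a: "cell_code a"
  obtains c where "cell_code c" "ext N c = R_bar N \<eta> - ext N a"
proof -
  let ?c = "star_op N (\<lambda>zs. Set (line (num_of (zs ! 0)) - set_of (zs ! 1))) [\<eta>, a]"
  have "rel N (\<lambda>zs. cell_set (num_of (zs ! 0)) (line (num_of (zs ! 0)) - set_of (zs ! 1))) [\<eta>, a]"
  proof (rule rel_mp2[OF conjunct2[OF a] eta_nat'[of 0]])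
    fix zs :: "obj list"
    assume 1: "cell_set (num_of (zs ! 0)) (set_of (zs ! 1))" and "\<exists>n\<ge>1. zs ! 0 = Num (of_nat n)"
    then obtain n where n: "n \<ge> 1" "zs ! 0 = Num (of_nat n)" by blast
    show "cell_set (num_of (zs ! 0)) (line (num_of (zs ! 0)) - set_of (zs ! 1))"
      using 1 cell_in_line[OF n(1)] unfolding cell_set_def n(2) num_of.simps by blast
  qed simp_all
  then have "cell_code ?c" by (rule cell_code_germ)
  moreover have "ext N ?c = R_bar N \<eta> - ext N a"
  proof (rule set_eqI)
    fix x
    define L where "L = [\<eta>, a, x]"
    have e: "\<eta> = star_op N (\<lambda>zs. zs ! 0) L" "a = star_op N (\<lambda>zs. zs ! 1) L" "x = star_op N (\<lambda>zs. zs ! 2) L"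
      using star_op_nth[of _ L] by (simp_all add: L_def numeral_2_eq_2)
    have Li: "0 < length L" "L ! 0 = \<eta>" by (simp_all add: L_def)
    have A: "rel N (\<lambda>zs. \<exists>A. zs ! 1 = Set A) L"
      using a unfolding e by (simp add: is_set_star_op)
    have "x \<in> ext N ?c \<longleftrightarrow> rel N (\<lambda>zs. \<exists>z A. zs ! 2 = Num z \<and> Set (line (num_of (zs ! 0)) - set_of (zs ! 1)) = Set A \<and> z \<in> A) L"
      unfolding e star_op_comp2 ext_star_op by simp
    also have "\<dots> \<longleftrightarrow> rel N (\<lambda>zs. (\<exists>z \<in> line (num_of (zs ! 0)). zs ! 2 = Num z) \<and>
        \<not> (\<exists>z A. zs ! 2 = Num z \<and> zs ! 1 = Set A \<and> z \<in> A)) L" (is "rel N ?P L \<longleftrightarrow> rel N ?Q L")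
    proof
      assume "rel N ?P L"
      with A show "rel N ?Q L" by (rule rel_mp2) auto
    next
      assume "rel N ?Q L"
      with A show "rel N ?P L" by (rule rel_mp2) auto
    qed
    also have "\<dots> \<longleftrightarrow> x \<in> R_bar N \<eta> - ext N a"
    proof -
      have 1: "x \<in> R_bar N \<eta> \<longleftrightarrow> rel N (\<lambda>zs. \<exists>z \<in> line (num_of (zs ! 0)). zs ! 2 = Num z) L"
        by (subst e(3)) (rule R_bar_star_op[OF Li])
      have 2: "x \<in> ext N a \<longleftrightarrow> rel N (\<lambda>zs. \<exists>z A. zs ! 2 = Num z \<and> zs ! 1 = Set A \<and> z \<in> A) L"
        unfolding e ext_star_op ..
      show ?thesis unfolding rel_conj rel_not Diff_iff 1 2 ..
    qed
    finally show "x \<in> ext N ?c \<longleftrightarrow> x \<in> R_bar N \<eta> - ext N a" .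
  qed
  ultimately show thesis by (rule that)
qed

lemma ext_subset_R_bar:
  assumes a: "cell_code a"
  shows "ext N a \<subseteq> R_bar N \<eta>"
proof
  fix x assume x: "x \<in> ext N a"
  define L where "L = [\<eta>, a, x]"
  have e: "\<eta> = star_op N (\<lambda>zs. zs ! 0) L" "a = star_op N (\<lambda>zs. zs ! 1) L" "x = star_op N (\<lambda>zs. zs ! 2) L"
    using star_op_nth[of _ L] by (simp_all add: L_def numeral_2_eq_2)
  have Li: "0 < length L" "L ! 0 = \<eta>" by (simp_all add: L_def)
  have 1: "rel N (\<lambda>zs. cell_set (num_of (zs ! 0)) (set_of (zs ! 1))) L"
    using a unfolding e by (simp add: rel_star_op2)
  have 2: "rel N (\<lambda>zs. \<exists>z A. zs ! 2 = Num z \<and> zs ! 1 = Set A \<and> z \<in> A) L"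
    using x unfolding e ext_star_op .
  show "x \<in> R_bar N \<eta>"
    unfolding e(3) R_bar_star_op[OF Li] by (rule rel_mp2[OF 1 2]) (auto simp: cell_set_def)
qed

lemma R_bar_in_C_alg: "R_bar N \<eta> \<in> C_alg N \<eta>"
proof -
  have "rel N (\<lambda>zs. cell_set (num_of (zs ! 0)) (line (num_of (zs ! 0)))) [\<eta>]"
    by (rule rel_mono[OF eta_nat'[of 0]]) (auto intro!: cell_set_line)
  from ext_in_C_alg[OF cell_code_germ[OF this]] show ?thesis
    by (subst R_bar_eq_ext[of 0 "[\<eta>]"]) simp_all
qed

sublocale C_alg: algebra "R_bar N \<eta>" "C_alg N \<eta>"
  unfolding algebra_iff_Un
proof (intro conjI ballI)
  show "C_alg N \<eta> \<subseteq> Pow (R_bar N \<eta>)"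
  proof
    fix A assume "A \<in> C_alg N \<eta>"
    then obtain a where a: "cell_code a" and A: "A = ext N a" by (rule C_algE)
    show "A \<in> Pow (R_bar N \<eta>)" using ext_subset_R_bar[OF a] by (simp add: A)
  qed
  show compl: "R_bar N \<eta> - A \<in> C_alg N \<eta>" if AC: "A \<in> C_alg N \<eta>" for A
  proof -
    obtain a where a: "cell_code a" and A: "A = ext N a" using AC by (rule C_algE)
    obtain c where c: "cell_code c" "ext N c = R_bar N \<eta> - A"
      unfolding A by (rule ext_Compl[OF a])
    show ?thesis using ext_in_C_alg[OF c(1)] unfolding c(2) .
  qed
  show "{} \<in> C_alg N \<eta>"
    using compl[OF R_bar_in_C_alg] by simp
  show "A \<union> B \<in> C_alg N \<eta>" if AC: "A \<in> C_alg N \<eta>" and BC: "B \<in> C_alg N \<eta>" for A B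
  proof -
    obtain a where a: "cell_code a" and A: "A = ext N a" using AC by (rule C_algE)
    obtain b where b: "cell_code b" and B: "B = ext N b" using BC by (rule C_algE)
    obtain c where c: "cell_code c" "ext N c = A \<union> B"
      unfolding A B by (rule ext_Un[OF a b])
    show ?thesis using ext_in_C_alg[OF c(1)] unfolding c(2) .
  qed
qed

end

text \<open>\<open>measure_of\<close> falls back to the zero measure unless its set function is a
  measure on the generated sigma algebra. Caratheodory gives this on the larger system of
  outer-measurable sets, from which it is restricted.\<close>

lemma (in ring_of_sets) measure_space_outer_measure:
  assumes pos: "positive M f" and ca: "countably_additive M f"
  shows "measure_space \<Omega> (sigma_sets \<Omega> M) (outer_measure M f)"
proof -
  have add: "additive M f" by (rule countably_additive_additive[OF pos ca])
  have inc: "increasing M f" by (rule additive_increasing[OF pos add])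
  define ls where "ls = lambda_system \<Omega> (Pow \<Omega>) (outer_measure M f)"
  have mls: "measure_space \<Omega> ls (outer_measure M f)"
    unfolding ls_def
    by (rule sigma_algebra.caratheodory_lemma[OF sigma_algebra_Pow outer_measure_space_outer_measure[OF pos inc]])
  then have sls: "sigma_algebra \<Omega> ls" by (simp add: measure_space_def)
  have "M \<subseteq> ls"
    unfolding ls_def by (rule algebra_subset_lambda_system[OF pos inc add])
  then have "sigma_sets \<Omega> M \<subseteq> ls"
    by (rule sigma_algebra.sigma_sets_subset[OF sls])
  then show ?thesis
    by (intro measure_down[OF mls] sigma_algebra_sigma_sets space_closed)
qed

lemma grid_sum_one:
  assumes "n \<ge> 1"
  shows "grid_sum (\<lambda>_. 1) A (of_nat n) =
    complex_of_real (riemann_sum n (\<lambda>x. if complex_of_real x \<in> A then 1 else 0))"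
  using grid_sum_cell_real[OF assms, of "\<lambda>_. 1" A] by simp

lemma grid_sum_Un_disjoint:
  assumes "A \<inter> B = {}"
  shows "grid_sum h (A \<union> B) n = grid_sum h A n + grid_sum h B n"
proof -
  let ?I = "{- (\<lfloor>Re n\<rfloor>\<^sup>2) ..< \<lfloor>Re n\<rfloor>\<^sup>2}"
  have "{k \<in> ?I. of_int k / n \<in> A \<union> B} = {k \<in> ?I. of_int k / n \<in> A} \<union> {k \<in> ?I. of_int k / n \<in> B}"
    by auto
  moreover have "{k \<in> ?I. of_int k / n \<in> A} \<inter> {k \<in> ?I. of_int k / n \<in> B} = {}"
    using assms by auto
  moreover have "finite {k \<in> ?I. of_int k / n \<in> A}" "finite {k \<in> ?I. of_int k / n \<in> B}"
    by (rule finite_subset[of _ ?I]; auto)+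
  ultimately show ?thesis
    unfolding grid_sum_def by (simp only: sum.union_disjoint distrib_left)
qed

section \<open>Finite additivity of the Loeb premeasure\<close>

context ns_infinite
begin

text \<open>The case distinction of \<open>st_lambda\<close> moved from sets to germs, so that
  additivity can be proved for nonnegative numbers before sets come in.\<close>

definition st_ennreal :: "(obj list \<Rightarrow> complex) \<Rightarrow> 's list \<Rightarrow> ennreal" where
  "st_ennreal F xs = (if ns_finite N (star_op N (\<lambda>zs. Num (F zs)) xs)
     then ennreal (real_st N (star_op N (\<lambda>zs. Num (F zs)) xs)) else \<infinity>)"

text \<open>Nonnegativity is decisive twice: a finite sum forces both summands to be finite, so the
  infinite cases match, and nonnegative standard parts are not truncated by
  \<open>ennreal\<close>.\<close>

lemma st_ennreal_add:
  assumes F: "rel N (\<lambda>zs. \<exists>a\<ge>0. F zs = complex_of_real a) xs"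
    and G: "rel N (\<lambda>zs. \<exists>a\<ge>0. G zs = complex_of_real a) xs"
  shows "st_ennreal (\<lambda>zs. F zs + G zs) xs = st_ennreal F xs + st_ennreal G xs"
proof -
  have norms: "norm (F zs) \<le> norm (F zs + G zs)" "norm (G zs) \<le> norm (F zs + G zs)"
    if "\<exists>a\<ge>0. F zs = complex_of_real a" "\<exists>a\<ge>0. G zs = complex_of_real a" for zs
    using that by (auto simp flip: of_real_add)
  have finF: "rel N (\<lambda>zs. norm (F zs) \<le> r) xs" and finG: "rel N (\<lambda>zs. norm (G zs) \<le> r) xs"
    if fin: "rel N (\<lambda>zs. norm (F zs + G zs) \<le> r) xs" for r
    by (rule rel_mp3[OF fin F G], use norms order_trans in blast)+
  show ?thesis
  proof (cases "(\<exists>r. rel N (\<lambda>zs. norm (F zs) \<le> r) xs) \<and> (\<exists>r. rel N (\<lambda>zs. norm (G zs) \<le> r) xs)")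
    case True
    then obtain p q where p: "rel N (\<lambda>zs. norm (F zs) \<le> p) xs" and q: "rel N (\<lambda>zs. norm (G zs) \<le> q) xs"
      by blast
    have RF: "rel N (\<lambda>zs. F zs \<in> \<real>) xs" by (rule rel_mono[OF F]) auto
    have RG: "rel N (\<lambda>zs. G zs \<in> \<real>) xs" by (rule rel_mono[OF G]) auto
    obtain c :: real where c: "\<And>r. r > 0 \<Longrightarrow> rel N (\<lambda>zs. norm (F zs - of_real c) < r) xs"
      using p RF by (rule ex_real_st_germ) blast
    obtain d :: real where d: "\<And>r. r > 0 \<Longrightarrow> rel N (\<lambda>zs. norm (G zs - of_real d) < r) xs"
      using q RG by (rule ex_real_st_germ) blast
    \<comment> \<open>A negative standard part would exclude approximation within its own absolute
      value by nonnegative numbers.\<close>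
    have nonneg: "0 \<le> c'" if near: "\<And>r. r > 0 \<Longrightarrow> rel N (\<lambda>zs. norm (H zs - of_real c') < r) xs"
      and H: "rel N (\<lambda>zs. \<exists>a\<ge>0. H zs = complex_of_real a) xs" for H c'
    proof (rule ccontr)
      assume "\<not> 0 \<le> c'"
      then have "- c' > 0" by simp
      have "rel N (\<lambda>_. False) xs"
      proof (rule rel_mp2[OF near[OF \<open>- c' > 0\<close>] H])
        fix zs assume 1: "norm (H zs - of_real c') < - c'" and "\<exists>a\<ge>0. H zs = complex_of_real a"
        then obtain a where a: "a \<ge> 0" "H zs = of_real a" by blast
        have "\<bar>a - c'\<bar> < - c'"
          using 1 unfolding a(2) by (simp only: of_real_diff[symmetric] norm_of_real)
        with a(1) \<open>- c' > 0\<close> show False by linarith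
      qed
      then show False by (simp add: rel_const)
    qed
    have cd: "rel N (\<lambda>zs. norm (F zs + G zs - of_real (c + d)) < r) xs" if "r > 0" for r
    proof -
      have "r / 2 > 0" using that by simp
      show ?thesis
      proof (rule rel_mp2[OF c[OF \<open>r / 2 > 0\<close>] d[OF \<open>r / 2 > 0\<close>]])
        fix zs assume "norm (F zs - of_real c) < r / 2" "norm (G zs - of_real d) < r / 2"
        then have "norm ((F zs - of_real c) + (G zs - of_real d)) < r"
          using norm_triangle_ineq[of "F zs - of_real c" "G zs - of_real d"] by linarith
        then show "norm (F zs + G zs - of_real (c + d)) < r" by (simp add: algebra_simps)
      qed
    qed
    have "rel N (\<lambda>zs. norm (F zs + G zs) \<le> p + q) xs"
      by (rule rel_mp2[OF p q]) (rule norm_triangle_mono)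
    moreover have "real_st N (star_op N (\<lambda>zs. Num (F zs + G zs)) xs) = c + d"
      by (rule real_st_germ) (rule cd)
    ultimately have "st_ennreal (\<lambda>zs. F zs + G zs) xs = ennreal (c + d)"
      unfolding st_ennreal_def ns_finite_germ by auto
    moreover have "st_ennreal F xs = ennreal c"
      using p real_st_germ[of F c, OF c] unfolding st_ennreal_def ns_finite_germ by auto
    moreover have "st_ennreal G xs = ennreal d"
      using q real_st_germ[of G d, OF d] unfolding st_ennreal_def ns_finite_germ by auto
    ultimately show ?thesis
      using nonneg[OF c F] nonneg[OF d G] by (simp only: ennreal_plus)
  next
    case False
    then have "\<not> (\<exists>r. rel N (\<lambda>zs. norm (F zs + G zs) \<le> r) xs)"
      using finF finG by blast
    with False show ?thesis
      unfolding st_ennreal_def ns_finite_germ by (auto simp: top_add)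
  qed
qed

lemma st_lambda_germ:
  "st_lambda N \<eta> (ext N (star_op N (\<lambda>zs. Set (A zs)) (\<eta> # ys))) =
     st_ennreal (\<lambda>zs. grid_sum (\<lambda>_. 1) (A zs) (num_of (zs ! 0))) (\<eta> # ys)"
  unfolding st_lambda_def lambda_germ st_ennreal_def ..

lemma st_lambda_additive: "additive (C_alg N \<eta>) (st_lambda N \<eta>)"
  unfolding additive_def
proof (intro ballI impI)
  fix A B assume AC: "A \<in> C_alg N \<eta>" and BC: "B \<in> C_alg N \<eta>" and disj: "A \<inter> B = {}"
  obtain a where a: "cell_code a" and A: "A = ext N a" using AC by (rule C_algE)
  obtain b where b: "cell_code b" and B: "B = ext N b" using BC by (rule C_algE)
  define L where "L = [\<eta>, a, b]"
  have L: "0 < length L" "L ! 0 = \<eta>" "1 < length L" "L ! 1 = a" "2 < length L" "L ! 2 = b"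
    by (simp_all add: L_def)
  have ae: "a = star_op N (\<lambda>zs. Set (set_of (zs ! 1))) L"
    using is_set_germ[of L 1] a L by simp
  have be: "b = star_op N (\<lambda>zs. Set (set_of (zs ! 2))) L"
    using is_set_germ[of L 2] b L by simp
  obtain c where c: "ext N c = A \<union> B"
    and ce: "c = star_op N (\<lambda>zs. Set (set_of (zs ! 1) \<union> set_of (zs ! 2))) L"
    unfolding A B L_def by (rule ext_Un[OF a b])
  let ?S = "\<lambda>A zs. grid_sum (\<lambda>_. 1) (A zs) (num_of (zs ! 0))"
  have sA: "st_lambda N \<eta> A = st_ennreal (?S (\<lambda>zs. set_of (zs ! 1))) L"
    unfolding A by (subst ae, unfold L_def) (rule st_lambda_germ)
  have sB: "st_lambda N \<eta> B = st_ennreal (?S (\<lambda>zs. set_of (zs ! 2))) L"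
    unfolding B by (subst be, unfold L_def) (rule st_lambda_germ)
  have sAB: "st_lambda N \<eta> (A \<union> B) = st_ennreal (?S (\<lambda>zs. set_of (zs ! 1) \<union> set_of (zs ! 2))) L"
    unfolding c[symmetric] ce L_def by (rule st_lambda_germ)
  \<comment> \<open>Disjointness is assumed for the extensions. It passes to the germs because a
    failure would produce an internal point common to both sets.\<close>
  have disj': "rel N (\<lambda>zs. set_of (zs ! 1) \<inter> set_of (zs ! 2) = {}) L"
  proof (rule ccontr)
    let ?P = "\<lambda>zs. \<exists>z\<in>set_of (zs ! 2) \<inter> set_of (zs ! 3). zs ! 0 = Num z"
    assume "\<not> rel N (\<lambda>zs. set_of (zs ! 1) \<inter> set_of (zs ! 2) = {}) L"
    then have "rel N (\<lambda>zs. \<not> (set_of (zs ! 1) \<inter> set_of (zs ! 2) = {})) L"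
      by (simp only: rel_not) simp
    then have "rel N (\<lambda>zs. \<exists>z. ?P (z # zs)) L"
      by (rule rel_mono) (auto simp: numeral_2_eq_2 numeral_3_eq_3)
    then have "\<exists>x. rel N ?P (x # L)"
      by (rule rel_ex[of ?P, THEN iffD1])
    then obtain x where P: "rel N ?P (x # L)" ..
    define L' where "L' = x # L"
    have e: "x = star_op N (\<lambda>zs. zs ! 0) L'" "a = star_op N (\<lambda>zs. zs ! 2) L'" "b = star_op N (\<lambda>zs. zs ! 3) L'"
      using star_op_nth[of _ L'] by (simp_all add: L'_def L_def numeral_2_eq_2 numeral_3_eq_3)
    have sets: "rel N (\<lambda>zs. (\<exists>A. zs ! 2 = Set A) \<and> (\<exists>A. zs ! 3 = Set A)) L'"
      using conjunct1[OF a] conjunct1[OF b] unfolding e is_set_star_op rel_conj by simp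
    have "x \<in> A"
      unfolding A e ext_star_op by (rule rel_mp2[OF P[folded L'_def] sets]) auto
    moreover have "x \<in> B"
      unfolding B e ext_star_op by (rule rel_mp2[OF P[folded L'_def] sets]) auto
    ultimately show False using disj by blast
  qed
  have nonneg: "rel N (\<lambda>zs. \<exists>a\<ge>0. ?S X zs = complex_of_real a) L" for X
    by (rule rel_mono[OF eta_nat'[OF L(1,2)]]) (auto simp: grid_sum_one intro!: riemann_sum_nonneg)
  have eq: "star_op N (\<lambda>zs. Num (?S (\<lambda>zs. set_of (zs ! 1) \<union> set_of (zs ! 2)) zs)) L =
      star_op N (\<lambda>zs. Num (?S (\<lambda>zs. set_of (zs ! 1)) zs + ?S (\<lambda>zs. set_of (zs ! 2)) zs)) L"
    unfolding star_op_eq_iff by (rule rel_mono[OF disj']) (simp add: grid_sum_Un_disjoint)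
  have "st_lambda N \<eta> (A \<union> B) = st_ennreal (\<lambda>zs. ?S (\<lambda>zs. set_of (zs ! 1)) zs + ?S (\<lambda>zs. set_of (zs ! 2)) zs) L"
    unfolding sAB st_ennreal_def eq ..
  also have "\<dots> = st_lambda N \<eta> A + st_lambda N \<eta> B"
    unfolding sA sB by (rule st_ennreal_add[OF nonneg nonneg])
  finally show "st_lambda N \<eta> (A \<union> B) = st_lambda N \<eta> A + st_lambda N \<eta> B" .
qed

lemma st_lambda_near:
  assumes "\<And>r. r > 0 \<Longrightarrow> rel N (\<lambda>zs. norm (grid_sum (\<lambda>_. 1) (A zs) (num_of (zs ! 0)) - complex_of_real c) < r) (\<eta> # ys)"
  shows "st_lambda N \<eta> (ext N (star_op N (\<lambda>zs. Set (A zs)) (\<eta> # ys))) = ennreal c"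
proof -
  have "\<exists>r. rel N (\<lambda>zs. norm (grid_sum (\<lambda>_. 1) (A zs) (num_of (zs ! 0))) \<le> r) (\<eta> # ys)"
  proof (rule exI, rule rel_mono[OF assms[of 1]])
    fix zs assume "norm (grid_sum (\<lambda>_. 1) (A zs) (num_of (zs ! 0)) - complex_of_real c) < 1"
    then show "norm (grid_sum (\<lambda>_. 1) (A zs) (num_of (zs ! 0))) \<le> norm (complex_of_real c) + 1"
      using norm_triangle_ineq2[of "grid_sum (\<lambda>_. 1) (A zs) (num_of (zs ! 0))" "complex_of_real c"] by linarith
  qed simp
  then show ?thesis
    unfolding st_lambda_germ st_ennreal_def ns_finite_germ using real_st_germ[OF assms] by simp
qed

lemma st_lambda_positive: "positive (C_alg N \<eta>) (st_lambda N \<eta>)"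
proof -
  let ?e = "star_op N (\<lambda>_. Set {}) [\<eta>]"
  have "ext N ?e = {}"
  proof -
    have "x \<notin> ext N ?e" for x
    proof
      assume x: "x \<in> ext N ?e"
      define L where "L = [x]"
      have e: "x = star_op N (\<lambda>zs. zs ! 0) L"
        using star_op_nth[of 0 L] by (simp_all add: L_def)
      have "star_op N (\<lambda>_. Set {}) [\<eta>] = star_op N (\<lambda>_. Set {}) L"
        by (simp add: star_op_const)
      with x have "rel N (\<lambda>zs. \<exists>z A. zs ! 0 = Num z \<and> Set {} = Set A \<and> z \<in> A) L"
        unfolding e by (simp only: ext_star_op)
      then have "rel N (\<lambda>_. False) L" by (rule rel_mono) auto
      then show False by (simp add: rel_const)
    qed
    then show ?thesis by blast
  qed
  moreover have "st_lambda N \<eta> (ext N ?e) = ennreal 0"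
    by (rule st_lambda_near) (simp add: grid_sum_def rel_const)
  ultimately show ?thesis by (simp add: positive_def)
qed

end

section \<open>Countable additivity and the Loeb measure\<close>

locale ns_loeb = ns_infinite N \<eta> for N :: "'s extension" and \<eta> :: 's +
  assumes saturated: "countably_saturated N"
begin

text \<open>
  By saturation a set of the algebra that is a countable union of sets of the algebra is already a
  finite union of them, so countable additivity reduces to finite additivity.
\<close>

lemma C_alg_finite_subcover:
  fixes A :: "nat \<Rightarrow> 's set"
  assumes A: "range A \<subseteq> C_alg N \<eta>" and B: "B \<in> C_alg N \<eta>" "B \<subseteq> (\<Union>i. A i)"
  obtains n where "B \<subseteq> (\<Union>i\<le>n. A i)"
proof (rule ccontr)
  assume "\<not> thesis"
  then have no: "\<not> B \<subseteq> (\<Union>i\<le>n. A i)" for n using that by blast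
  obtain b where b: "cell_code b" and Be: "B = ext N b" using B(1) by (rule C_algE)
  have "\<exists>a. cell_code a \<and> A i = ext N a" for i
  proof -
    have "A i \<in> C_alg N \<eta>" using A by blast
    then obtain a where "cell_code a" "A i = ext N a" by (rule C_algE)
    then show ?thesis by blast
  qed
  then obtain a where a: "\<And>i. cell_code (a i)" and Ae: "\<And>i. A i = ext N (a i)" by metis
  \<comment> \<open>Membership in \<open>B\<close> but not in \<open>A i\<close>, with the codes as
    parameters. Failure of every finite subcover makes these internal conditions finitely
    satisfiable.\<close>
  let ?R = "\<lambda>zs. \<exists>z B A. zs ! 0 = Num z \<and> zs ! 1 = Set B \<and> zs ! 2 = Set A \<and> z \<in> B \<and> z \<notin> A"
  have iff: "rel N ?R (x # [b, a i]) \<longleftrightarrow> x \<in> B \<and> x \<notin> A i" for x i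
  proof -
    define L where "L = [x, b, a i]"
    have e: "x = star_op N (\<lambda>zs. zs ! 0) L" "b = star_op N (\<lambda>zs. zs ! 1) L" "a i = star_op N (\<lambda>zs. zs ! 2) L"
      using star_op_nth[of _ L] by (simp_all add: L_def numeral_2_eq_2)
    have sets: "rel N (\<lambda>zs. \<exists>A. zs ! 2 = Set A) L"
      using conjunct1[OF a[of i]] unfolding e is_set_star_op .
    let ?P = "\<lambda>zs. \<exists>z A. zs ! 0 = Num z \<and> zs ! 1 = Set A \<and> z \<in> A"
    let ?Q = "\<lambda>zs. \<exists>z A. zs ! 0 = Num z \<and> zs ! 2 = Set A \<and> z \<in> A"
    have "rel N ?R L \<longleftrightarrow> rel N (\<lambda>zs. ?P zs \<and> \<not> ?Q zs) L"
    proof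
      assume "rel N ?R L"
      then show "rel N (\<lambda>zs. ?P zs \<and> \<not> ?Q zs) L" by (rule rel_mono) auto
    next
      assume "rel N (\<lambda>zs. ?P zs \<and> \<not> ?Q zs) L"
      with sets show "rel N ?R L" by (rule rel_mp2) auto
    qed
    also have "\<dots> \<longleftrightarrow> x \<in> B \<and> x \<notin> A i"
      unfolding rel_conj rel_not Be Ae e ext_star_op ..
    finally show ?thesis unfolding L_def .
  qed
  have "\<exists>x. \<forall>i\<le>n. rel N ?R (x # [b, a i])" for n
  proof -
    obtain x where "x \<in> B" "x \<notin> (\<Union>i\<le>n. A i)" using no[of n] by blast
    then show ?thesis unfolding iff by blast
  qed
  then have "\<exists>x. \<forall>i. rel N ?R (x # [b, a i])"
    using saturated[unfolded countably_saturated_def, rule_format, of "\<lambda>_. ?R" "\<lambda>i. [b, a i]"] by simp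
  then obtain x where "\<And>i. x \<in> B \<and> x \<notin> A i" unfolding iff by blast
  then show False using B(2) by blast
qed

lemma st_lambda_countably_additive: "countably_additive (C_alg N \<eta>) (st_lambda N \<eta>)"
  unfolding countably_additive_def
proof (intro allI impI)
  fix A :: "nat \<Rightarrow> 's set"
  assume A: "range A \<subseteq> C_alg N \<eta>" and disj: "disjoint_family A" and U: "(\<Union>i. A i) \<in> C_alg N \<eta>"
  obtain n where n: "(\<Union>i. A i) \<subseteq> (\<Union>i\<le>n. A i)"
    using C_alg_finite_subcover[OF A U] by blast
  \<comment> \<open>The first n + 1 sets already cover the union, so disjointness leaves nothing for
    later ones and the series is a finite sum.\<close>
  have empty: "A i = {}" if "i \<notin> {..n}" for i
  proof -
    have "A i \<inter> A j = {}" if "j \<le> n" for j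
      using disj that \<open>i \<notin> {..n}\<close> by (auto simp: disjoint_family_on_def)
    then show ?thesis using n by blast
  qed
  have "(\<Sum>i. st_lambda N \<eta> (A i)) = (\<Sum>i\<le>n. st_lambda N \<eta> (A i))"
    using st_lambda_positive empty by (intro suminf_finite) (auto simp: positive_def)
  also have "\<dots> = st_lambda N \<eta> (\<Union>i\<le>n. A i)"
    using A disj by (intro C_alg.additive_sum[OF st_lambda_positive st_lambda_additive])
      (auto simp: disjoint_family_on_def)
  also have "(\<Union>i\<le>n. A i) = (\<Union>i. A i)" using n by blast
  finally show "(\<Sum>i. st_lambda N \<eta> (A i)) = st_lambda N \<eta> (\<Union>i. A i)" .
qed

text \<open>The Loeb measure before completion. Measurability and integrals are handled here and
  carried to the completion at the end.\<close>

definition loeb0 :: "'s measure" where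
  "loeb0 = measure_of (R_bar N \<eta>) (C_alg N \<eta>) (outer_measure (C_alg N \<eta>) (st_lambda N \<eta>))"

lemma Loeb_eq: "Loeb N \<eta> = completion loeb0"
  by (simp add: Loeb_def loeb0_def)

lemma space_loeb0: "space loeb0 = R_bar N \<eta>"
  by (simp add: loeb0_def C_alg.space_closed)

lemma sets_loeb0: "sets loeb0 = sigma_sets (R_bar N \<eta>) (C_alg N \<eta>)"
  by (simp add: loeb0_def C_alg.space_closed)

lemma C_alg_sets: "A \<in> C_alg N \<eta> \<Longrightarrow> A \<in> sets loeb0"
  by (simp add: sets_loeb0)

lemma emeasure_loeb0:
  assumes "A \<in> C_alg N \<eta>"
  shows "emeasure loeb0 A = st_lambda N \<eta> A"
proof -
  have "measure_space (R_bar N \<eta>) (sets loeb0) (outer_measure (C_alg N \<eta>) (st_lambda N \<eta>))"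
    unfolding sets_loeb0
    by (rule C_alg.measure_space_outer_measure[OF st_lambda_positive st_lambda_countably_additive])
  then have "emeasure loeb0 A = outer_measure (C_alg N \<eta>) (st_lambda N \<eta>) A"
    by (intro emeasure_measure_of[OF loeb0_def C_alg.space_closed _ _ C_alg_sets[OF assms]])
      (auto simp: measure_space_def)
  also have "\<dots> = st_lambda N \<eta> A"
    by (rule C_alg.outer_measure_agrees[OF st_lambda_positive st_lambda_countably_additive assms])
  finally show ?thesis .
qed

end

text \<open>The indicator is continuous off its two endpoints, a null set, so convergence of Riemann
  sums for almost everywhere continuous functions applies.\<close>

lemma riemann_sum_indicator_LIMSEQ:
  fixes c d :: real
  assumes "c \<le> d"
  shows "(\<lambda>n. riemann_sum n (\<lambda>x. if c \<le> x \<and> x < d then 1 else 0 :: real)) \<longlonglongrightarrow> d - c"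
proof -
  let ?\<phi> = "\<lambda>x. if c \<le> x \<and> x < d then 1 else 0 :: real"
  have ind: "?\<phi> = indicator {c..<d}"
    by (auto simp: indicator_def)
  \<comment> \<open>Points of the interval satisfy \<bar>x\<bar> \<le> \<bar>c\<bar> +
    \<bar>d\<bar>, so this constant over 1 + x^2 is at least 1 there.\<close>
  let ?C = "1 + (\<bar>c\<bar> + \<bar>d\<bar>)\<^sup>2"
  have "(\<lambda>n. riemann_sum n ?\<phi>) \<longlonglongrightarrow> integral\<^sup>L lborel ?\<phi>"
  proof (rule riemann_sum_LIMSEQ)
    show "?\<phi> \<in> borel_measurable borel"
      unfolding ind by measurable
    have "AE x in lborel. x \<notin> {c, d}"
      by (rule AE_not_in) (simp add: finite_imp_null_set_lborel)
    then show "AE x in lborel. isCont ?\<phi> x"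
    proof eventually_elim
      case (elim x)
      have "(x < c \<or> d < x) \<or> (c < x \<and> x < d)" using elim by auto
      then show ?case
      proof
        assume x: "x < c \<or> d < x"
        have "\<forall>\<^sub>F y in nhds x. ?\<phi> y = 0"
          by (rule eventually_mono[OF eventually_nhds_in_open[of "{..<c} \<union> {d<..}"]]) (use x in auto)
        then show ?thesis using isCont_cong[of ?\<phi> "\<lambda>_. 0" x] by simp
      next
        assume x: "c < x \<and> x < d"
        have "\<forall>\<^sub>F y in nhds x. ?\<phi> y = 1"
          by (rule eventually_mono[OF eventually_nhds_in_open[of "{c<..<d}"]]) (use x in auto)
        then show ?thesis using isCont_cong[of ?\<phi> "\<lambda>_. 1" x] by simp
      qed
    qed
    show "norm (?\<phi> x) \<le> ?C / (1 + x\<^sup>2)" for x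
    proof (cases "c \<le> x \<and> x < d")
      case True
      then have "\<bar>x\<bar> \<le> \<bar>c\<bar> + \<bar>d\<bar>" by linarith
      then have "x\<^sup>2 \<le> (\<bar>c\<bar> + \<bar>d\<bar>)\<^sup>2" by (metis abs_ge_zero power2_abs power_mono)
      then have "1 + x\<^sup>2 \<le> ?C" by simp
      then have "1 \<le> ?C / (1 + x\<^sup>2)" by (subst pos_le_divide_eq) (simp_all add: add_pos_nonneg)
      then show ?thesis using True by simp
    qed auto
  qed
  moreover have "integral\<^sup>L lborel ?\<phi> = d - c"
    unfolding ind using assms by simp
  ultimately show ?thesis by simp
qed

section \<open>Internal intervals and the standard part map\<close>

context ns_infinite
begin

text \<open>The interval [c, d) rounded to the grid: cells are selected by their left endpoint, so
  the result is internal and belongs to the algebra.\<close>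

definition st_interval :: "real \<Rightarrow> real \<Rightarrow> 's set" where
  "st_interval c d = ext N (star_op N (\<lambda>zs. Set {z \<in> line (num_of (zs ! 0)).
     c \<le> Re (cell (num_of (zs ! 0)) z) \<and> Re (cell (num_of (zs ! 0)) z) < d}) [\<eta>])"

lemma st_interval_in_C_alg: "st_interval c d \<in> C_alg N \<eta>"
  unfolding st_interval_def
proof (rule ext_in_C_alg, rule cell_code_germ, rule rel_mono[OF eta_nat'[of 0]])
  fix zs :: "obj list" assume "\<exists>n\<ge>1. zs ! 0 = Num (of_nat n)"
  then obtain n where n: "n \<ge> 1" "zs ! 0 = Num (of_nat n)" by blast
  show "cell_set (num_of (zs ! 0)) {z \<in> line (num_of (zs ! 0)).
     c \<le> Re (cell (num_of (zs ! 0)) z) \<and> Re (cell (num_of (zs ! 0)) z) < d}"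
    unfolding n(2) num_of.simps by (rule cell_set_Collect[OF n(1)])
qed simp_all

lemma st_lambda_st_interval:
  assumes "c \<le> d"
  shows "st_lambda N \<eta> (st_interval c d) = ennreal (d - c)"
  unfolding st_interval_def
proof (rule st_lambda_near)
  fix r :: real assume "r > 0"
  then have "\<forall>\<^sub>F n in sequentially. \<bar>riemann_sum n (\<lambda>x. if c \<le> x \<and> x < d then 1 else 0) - (d - c)\<bar> < r"
    using riemann_sum_indicator_LIMSEQ[OF assms] by (auto simp: tendsto_iff dist_real_def)
  from eta_eventually[OF this, of 0 "[\<eta>]"]
  have ev: "rel N (\<lambda>zs. \<exists>n\<ge>1. zs ! 0 = Num (of_nat n) \<and>
      \<bar>riemann_sum n (\<lambda>x. if c \<le> x \<and> x < d then 1 else 0) - (d - c)\<bar> < r) [\<eta>]" by simp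
  show "rel N (\<lambda>zs. norm (grid_sum (\<lambda>_. 1) {z \<in> line (num_of (zs ! 0)).
     c \<le> Re (cell (num_of (zs ! 0)) z) \<and> Re (cell (num_of (zs ! 0)) z) < d} (num_of (zs ! 0))
     - complex_of_real (d - c)) < r) [\<eta>]"
  proof (rule rel_mono[OF ev])
    fix zs :: "obj list"
    assume "\<exists>n\<ge>1. zs ! 0 = Num (of_nat n) \<and>
      \<bar>riemann_sum n (\<lambda>x. if c \<le> x \<and> x < d then 1 else 0) - (d - c)\<bar> < r"
    then obtain n where n: "n \<ge> 1" "zs ! 0 = Num (of_nat n)"
      "\<bar>riemann_sum n (\<lambda>x. if c \<le> x \<and> x < d then 1 else 0) - (d - c)\<bar> < r" by blast
    let ?A = "{z \<in> line (of_nat n). c \<le> Re (cell (of_nat n) z) \<and> Re (cell (of_nat n) z) < d}"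
    have "riemann_sum n (\<lambda>x. if complex_of_real x \<in> ?A then 1 else 0) =
        riemann_sum n (\<lambda>x. if c \<le> x \<and> x < d then 1 else 0 :: real)"
      unfolding riemann_sum_def
    proof (intro sum.cong refl arg_cong2[where f="(*\<^sub>R)"])
      fix k assume k: "k \<in> grid n"
      let ?x = "of_int k / real n"
      have cell: "cell (of_nat n) (complex_of_real ?x) = complex_of_real ?x"
        using cell_grid_point[OF n(1), of k] by simp
      have "complex_of_real ?x \<in> line (of_nat n)"
        using grid_point_in_line[OF n(1), of k] k by (simp add: grid_def)
      then show "(if complex_of_real ?x \<in> ?A then 1 else 0) = (if c \<le> ?x \<and> ?x < d then 1 else 0 :: real)"
        unfolding mem_Collect_eq cell Re_complex_of_real by simp
    qed
    then show "norm (grid_sum (\<lambda>_. 1) {z \<in> line (num_of (zs ! 0)).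
     c \<le> Re (cell (num_of (zs ! 0)) z) \<and> Re (cell (num_of (zs ! 0)) z) < d} (num_of (zs ! 0))
     - complex_of_real (d - c)) < r"
      unfolding n(2) num_of.simps grid_sum_one[OF n(1)]
      using n(3) by (simp only: of_real_diff[symmetric] norm_of_real)
  qed
qed

lemma st_interval_iff:
  assumes x: "x \<in> R_bar N \<eta>"
  shows "x \<in> st_interval c d \<longleftrightarrow> rel N (\<lambda>zs. \<exists>n\<ge>1. zs ! 0 = Num (of_nat n) \<and>
      (\<exists>t. zs ! 1 = Num (of_real t) \<and> c \<le> Re (cell (of_nat n) (of_real t)) \<and>
        Re (cell (of_nat n) (of_real t)) < d)) [\<eta>, x]"
proof -
  define L where "L = [\<eta>, x]"
  have e: "\<eta> = star_op N (\<lambda>zs. zs ! 0) L" "x = star_op N (\<lambda>zs. zs ! 1) L"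
    using star_op_nth[of _ L] by (simp_all add: L_def)
  note R = R_bar_germ(2)[OF x, folded L_def]
  let ?A = "\<lambda>zs. {z \<in> line (num_of (zs ! 0)). c \<le> Re (cell (num_of (zs ! 0)) z) \<and> Re (cell (num_of (zs ! 0)) z) < d}"
  let ?P = "\<lambda>zs. \<exists>z A. zs ! 1 = Num z \<and> Set (?A zs) = Set A \<and> z \<in> A"
  let ?Q = "\<lambda>zs. \<exists>n\<ge>1. zs ! 0 = Num (of_nat n) \<and>
      (\<exists>t. zs ! 1 = Num (of_real t) \<and> c \<le> Re (cell (of_nat n) (of_real t)) \<and>
        Re (cell (of_nat n) (of_real t)) < d)"
  have "x \<in> st_interval c d \<longleftrightarrow> rel N ?P L"
    unfolding st_interval_def unfolding e star_op_comp1 ext_star_op by simp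
  also have "\<dots> \<longleftrightarrow> rel N ?Q L"
  proof
    assume "rel N ?P L"
    with R show "rel N ?Q L" by (rule rel_mp2) auto
  next
    assume "rel N ?Q L"
    with R show "rel N ?P L"
    proof (rule rel_mp2)
      fix zs :: "obj list"
      assume 1: "\<exists>n\<ge>1. zs ! 0 = Num (of_nat n) \<and> (\<exists>t. zs ! 1 = Num (of_real t) \<and> complex_of_real t \<in> line (of_nat n))"
        and 2: "?Q zs"
      obtain n t where n: "zs ! 0 = Num (of_nat n)" "zs ! 1 = Num (of_real t)" "complex_of_real t \<in> line (of_nat n)"
        using 1 by blast
      have "c \<le> Re (cell (of_nat n) (of_real t)) \<and> Re (cell (of_nat n) (of_real t)) < d"
        using 2 n by auto
      then have "complex_of_real t \<in> ?A zs" using n by simp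
      then show "?P zs" using n(2) by (intro exI[of _ "of_real t"] exI[of _ "?A zs"]) simp
    qed
  qed
  finally show ?thesis unfolding L_def .
qed

definition finite_part :: "'s set" where
  "finite_part = {x \<in> R_bar N \<eta>. ns_finite N x}"

text \<open>Internal intervals see a point only up to an infinitesimal. A standard margin at both
  ends absorbs this error, and every standard part strictly between the bounds leaves room for some
  margin 1/(m+1).\<close>

lemma st_vimage_greaterThanLessThan:
  "{x \<in> finite_part. l < real_st N x \<and> real_st N x < u} =
     (\<Union>m. st_interval (l + 1 / real (Suc m)) (u - 1 / real (Suc m)))"
proof (intro equalityI subsetI)
  fix x assume "x \<in> {x \<in> finite_part. l < real_st N x \<and> real_st N x < u}"
  then have x: "x \<in> R_bar N \<eta>" and fin: "ns_finite N x" and lu: "l < real_st N x" "real_st N x < u"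
    by (auto simp: finite_part_def)
  \<comment> \<open>Half the distance to the nearer bound: one \<open>e\<close> covers the distance
    from the cell to the standard part, the other covers the margin.\<close>
  define e where "e = min (real_st N x - l) (u - real_st N x) / 2"
  have e: "e > 0" "l + 2 * e \<le> real_st N x" "real_st N x + 2 * e \<le> u" using lu by (auto simp: e_def)
  obtain m where m: "1 / real (Suc m) < e"
    using nat_approx_posE[OF e(1)] by blast
  have "x \<in> st_interval (l + 1 / real (Suc m)) (u - 1 / real (Suc m))"
    unfolding st_interval_iff[OF x]
  proof (rule rel_mono[OF real_st_near[OF x fin e(1)]])
    fix zs :: "obj list"
    assume "\<exists>n\<ge>1. zs ! 0 = Num (of_nat n) \<and>
      (\<exists>t. zs ! 1 = Num (of_real t) \<and> complex_of_real t \<in> line (of_nat n) \<and> \<bar>t - real_st N x\<bar> < e \<and>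
        \<bar>Re (cell (of_nat n) (of_real t)) - real_st N x\<bar> < e)"
    then obtain n t where n: "n \<ge> 1" "zs ! 0 = Num (of_nat n)" "zs ! 1 = Num (of_real t)"
      and "\<bar>Re (cell (of_nat n) (of_real t)) - real_st N x\<bar> < e" by blast
    then have "l + 1 / real (Suc m) \<le> Re (cell (of_nat n) (of_real t))"
      "Re (cell (of_nat n) (of_real t)) < u - 1 / real (Suc m)"
      using m e by linarith+
    then show "\<exists>n\<ge>1. zs ! 0 = Num (of_nat n) \<and>
      (\<exists>t. zs ! 1 = Num (of_real t) \<and> l + 1 / real (Suc m) \<le> Re (cell (of_nat n) (of_real t)) \<and>
        Re (cell (of_nat n) (of_real t)) < u - 1 / real (Suc m))"
      using n by blast
  qed
  then show "x \<in> (\<Union>m. st_interval (l + 1 / real (Suc m)) (u - 1 / real (Suc m)))" by blast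
next
  fix x assume "x \<in> (\<Union>m. st_interval (l + 1 / real (Suc m)) (u - 1 / real (Suc m)))"
  then obtain m where xm: "x \<in> st_interval (l + 1 / real (Suc m)) (u - 1 / real (Suc m))" by blast
  define e where "e = 1 / real (Suc m)"
  have e: "e > 0" by (simp add: e_def)
  have x: "x \<in> R_bar N \<eta>"
    using xm st_interval_in_C_alg C_alg.sets_into_space by blast
  let ?Q = "\<lambda>zs. \<exists>n\<ge>1. zs ! 0 = Num (of_nat n) \<and>
      (\<exists>t. zs ! 1 = Num (of_real t) \<and> l + e \<le> Re (cell (of_nat n) (of_real t)) \<and>
        Re (cell (of_nat n) (of_real t)) < u - e)"
  have Q: "rel N ?Q [\<eta>, x]"
    using xm unfolding st_interval_iff[OF x] e_def .
  have fin: "ns_finite N x"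
  proof -
    \<comment> \<open>The cell endpoint lies between two standard numbers; the summand 1 accounts
      for rounding.\<close>
    have "rel N (\<lambda>zs. norm (num_of (zs ! 1)) \<le> \<bar>l + e\<bar> + \<bar>u - e\<bar> + 1) [\<eta>, x]"
    proof (rule rel_mono[OF Q])
      fix zs :: "obj list" assume "?Q zs"
      then obtain n t where n: "n \<ge> 1" "zs ! 0 = Num (of_nat n)" "zs ! 1 = Num (of_real t)"
        and b: "l + e \<le> Re (cell (of_nat n) (of_real t))" "Re (cell (of_nat n) (of_real t)) < u - e" by blast
      have "1 / real n \<le> 1" using n by simp
      then have "\<bar>t\<bar> \<le> \<bar>l + e\<bar> + \<bar>u - e\<bar> + 1"
        using Re_cell_bounds[OF n(1), of t] b by linarith
      then show "norm (num_of (zs ! 1)) \<le> \<bar>l + e\<bar> + \<bar>u - e\<bar> + 1"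
        unfolding n num_of.simps norm_of_real .
    qed
    then show ?thesis unfolding ns_finite_iff[OF x] ..
  qed
  \<comment> \<open>The relation does not mention the tuple, so \<open>rel_const\<close> turns it
    into a plain fact about the real number \<open>real_st N x\<close>.\<close>
  have "rel N (\<lambda>_. l < real_st N x \<and> real_st N x < u) [\<eta>, x]"
  proof (rule rel_mp2[OF Q real_st_near[OF x fin e]])
    fix zs :: "obj list" assume 1: "?Q zs" and 2: "\<exists>n\<ge>1. zs ! 0 = Num (of_nat n) \<and>
      (\<exists>t. zs ! 1 = Num (of_real t) \<and> complex_of_real t \<in> line (of_nat n) \<and> \<bar>t - real_st N x\<bar> < e \<and>
        \<bar>Re (cell (of_nat n) (of_real t)) - real_st N x\<bar> < e)"
    obtain n t where n: "zs ! 0 = Num (of_nat n)" "zs ! 1 = Num (of_real t)"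
      and b: "l + e \<le> Re (cell (of_nat n) (of_real t))" "Re (cell (of_nat n) (of_real t)) < u - e"
      using 1 by blast
    have "\<bar>Re (cell (of_nat n) (of_real t)) - real_st N x\<bar> < e" using 2 n by auto
    with b show "l < real_st N x \<and> real_st N x < u" by linarith
  qed
  then show "x \<in> {x \<in> finite_part. l < real_st N x \<and> real_st N x < u}"
    using x fin by (simp add: rel_const finite_part_def)
qed

lemma st_interval_mono:
  assumes "c' \<le> c" "d \<le> d'"
  shows "st_interval c d \<subseteq> st_interval c' d'"
proof
  fix x assume *: "x \<in> st_interval c d"
  then have x: "x \<in> R_bar N \<eta>"
    using st_interval_in_C_alg C_alg.sets_into_space by blast
  show "x \<in> st_interval c' d'"
    using * unfolding st_interval_iff[OF x]
  proof (rule rel_mono)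
    fix zs :: "obj list"
    assume "\<exists>n\<ge>1. zs ! 0 = Num (of_nat n) \<and> (\<exists>t. zs ! 1 = Num (of_real t) \<and>
        c \<le> Re (cell (of_nat n) (of_real t)) \<and> Re (cell (of_nat n) (of_real t)) < d)"
    then obtain n t where n: "n \<ge> 1" "zs ! 0 = Num (of_nat n)" "zs ! 1 = Num (of_real t)"
      and "c \<le> Re (cell (of_nat n) (of_real t))" "Re (cell (of_nat n) (of_real t)) < d" by blast
    then have "c' \<le> Re (cell (of_nat n) (of_real t)) \<and> Re (cell (of_nat n) (of_real t)) < d'"
      using assms by linarith
    with n show "\<exists>n\<ge>1. zs ! 0 = Num (of_nat n) \<and> (\<exists>t. zs ! 1 = Num (of_real t) \<and>
        c' \<le> Re (cell (of_nat n) (of_real t)) \<and> Re (cell (of_nat n) (of_real t)) < d')"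
      by blast
  qed
qed

end

section \<open>The image of the Loeb measure under the standard part map\<close>

context ns_loeb
begin

lemma st_vimage_sets: "{x \<in> finite_part. l < real_st N x \<and> real_st N x < u} \<in> sets loeb0"
  unfolding st_vimage_greaterThanLessThan
  by (intro sets.countable_UN) (auto intro: C_alg_sets st_interval_in_C_alg)

text \<open>Continuity from below along the internal intervals. Their length u - l - 2/(m+1) is
  positive only for large m, hence the comparison of the two sequences is eventual and the case l =
  u is separate.\<close>

lemma emeasure_st_vimage:
  assumes "l \<le> u"
  shows "emeasure loeb0 {x \<in> finite_part. l < real_st N x \<and> real_st N x < u} = ennreal (u - l)"
proof (cases "l = u")
  case True
  then have "{x \<in> finite_part. l < real_st N x \<and> real_st N x < u} = {}" by auto
  then show ?thesis using True by (simp only: emeasure_empty diff_self ennreal_0)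
next
  case False
  let ?I = "\<lambda>m. st_interval (l + 1 / real (Suc m)) (u - 1 / real (Suc m))"
  have "incseq ?I"
    by (intro monoI st_interval_mono add_left_mono diff_left_mono frac_le) simp_all
  moreover have "range ?I \<subseteq> sets loeb0"
    by (auto intro: C_alg_sets st_interval_in_C_alg)
  ultimately have 1: "(\<lambda>m. emeasure loeb0 (?I m)) \<longlonglongrightarrow> emeasure loeb0 (\<Union>m. ?I m)"
    by (intro Lim_emeasure_incseq)
  have inv: "(\<lambda>m. 1 / real (Suc m)) \<longlonglongrightarrow> 0"
    using LIMSEQ_inverse_real_of_nat by (simp add: divide_inverse)
  have lim: "(\<lambda>m. u - l - 2 * (1 / real (Suc m))) \<longlonglongrightarrow> u - l"
    using tendsto_diff[OF tendsto_const[of "u - l"] tendsto_mult[OF tendsto_const[of 2] inv]] by simp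
  then have "(\<lambda>m. ennreal (u - l - 2 * (1 / real (Suc m)))) \<longlonglongrightarrow> ennreal (u - l)"
    by (rule tendsto_ennrealI)
  moreover have "0 < u - l" using False assms by simp
  then have "\<forall>\<^sub>F m in sequentially. ennreal (u - l - 2 * (1 / real (Suc m))) = emeasure loeb0 (?I m)"
  proof (rule eventually_mono[OF order_tendstoD(1)[OF lim]])
    fix m assume pos: "0 < u - l - 2 * (1 / real (Suc m))"
    have "emeasure loeb0 (?I m) = st_lambda N \<eta> (?I m)"
      by (rule emeasure_loeb0[OF st_interval_in_C_alg])
    also have "\<dots> = ennreal (u - 1 / real (Suc m) - (l + 1 / real (Suc m)))"
      using pos by (intro st_lambda_st_interval) linarith
    also have "u - 1 / real (Suc m) - (l + 1 / real (Suc m)) = u - l - 2 * (1 / real (Suc m))"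
      by linarith
    finally show "ennreal (u - l - 2 * (1 / real (Suc m))) = emeasure loeb0 (?I m)" by (rule sym)
  qed
  ultimately have 2: "(\<lambda>m. emeasure loeb0 (?I m)) \<longlonglongrightarrow> ennreal (u - l)"
    by (rule Lim_transform_eventually)
  show ?thesis
    unfolding st_vimage_greaterThanLessThan by (rule LIMSEQ_unique[OF 1 2])
qed

lemma finite_part_sets: "finite_part \<in> sets loeb0"
proof -
  have eq: "finite_part = (\<Union>m::nat. {x \<in> finite_part. - real m < real_st N x \<and> real_st N x < real m})"
  proof (intro equalityI subsetI)
    fix x assume x: "x \<in> finite_part"
    obtain m where "\<bar>real_st N x\<bar> < real m" using reals_Archimedean2 by blast
    then show "x \<in> (\<Union>m::nat. {x \<in> finite_part. - real m < real_st N x \<and> real_st N x < real m})"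
      using x by (auto intro!: exI[of _ m])
  qed auto
  show ?thesis
    by (subst eq, intro sets.countable_UN image_subsetI st_vimage_sets)
qed

lemma finite_part_subset: "finite_part \<subseteq> space loeb0"
  by (rule sets.sets_into_space[OF finite_part_sets])

text \<open>Confined to the finite part because at infinite points \<open>real_st\<close> is an
  unspecified value. The added upper bound \<open>real m\<close> reduces half-lines to a countable
  union of open intervals.\<close>

lemma real_st_measurable: "real_st N \<in> borel_measurable (restrict_space loeb0 finite_part)"
  unfolding borel_measurable_iff_greater
proof
  fix a
  have "{w \<in> space (restrict_space loeb0 finite_part). a < real_st N w} =
      (\<Union>m::nat. {x \<in> finite_part. a < real_st N x \<and> real_st N x < real m})"
    using finite_part_subset reals_Archimedean2 by (auto simp: space_restrict_space)
  also have "\<dots> \<in> sets loeb0"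
    using st_vimage_sets by (intro sets.countable_UN) auto
  finally show "{w \<in> space (restrict_space loeb0 finite_part). a < real_st N w} \<in> sets (restrict_space loeb0 finite_part)"
    using finite_part_sets finite_part_subset
    by (subst sets_restrict_space_iff) (auto simp: space_restrict_space Int_absorb2)
qed

lemma distr_real_st: "distr (restrict_space loeb0 finite_part) borel (real_st N) = lborel"
proof (rule sym, rule lborel_eqI)
  fix l u :: real
  assume le: "\<And>b. b \<in> Basis \<Longrightarrow> l \<bullet> b \<le> u \<bullet> b"
  have vimage: "real_st N -` box l u \<inter> space (restrict_space loeb0 finite_part) =
      {x \<in> finite_part. l < real_st N x \<and> real_st N x < u}"
    using finite_part_subset by (auto simp: space_restrict_space)
  have "emeasure (distr (restrict_space loeb0 finite_part) borel (real_st N)) (box l u) =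
      emeasure (restrict_space loeb0 finite_part) {x \<in> finite_part. l < real_st N x \<and> real_st N x < u}"
    by (subst emeasure_distr[OF real_st_measurable]) (simp_all only: vimage borel_open open_box)
  also have "\<dots> = emeasure loeb0 {x \<in> finite_part. l < real_st N x \<and> real_st N x < u}"
    using finite_part_sets finite_part_subset by (intro emeasure_restrict_space) (auto simp: Int_absorb2)
  also have "\<dots> = ennreal (u - l)"
    using le[of 1] by (intro emeasure_st_vimage) simp
  finally show "emeasure (distr (restrict_space loeb0 finite_part) borel (real_st N)) (box l u) =
      ennreal (\<Prod>b\<in>Basis. (u - l) \<bullet> b)"
    by simp
qed simp

text \<open>The pullback vanishes at infinite points, so it is g composed with
  \<open>real_st\<close>, cut off to the finite part. The integral passes from the completion to
  \<open>loeb0\<close>, then to the restriction, then to the image measure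
  \<open>lborel\<close>.\<close>

lemma integral_Loeb_st_pullback:
  assumes meas: "g \<in> borel_measurable borel" and int: "integrable lborel g"
  shows "integrable (Loeb N \<eta>) (st_pullback N (g_infty g))"
    and "integral\<^sup>L (Loeb N \<eta>) (st_pullback N (g_infty g)) = integral\<^sup>L lborel g"
proof -
  let ?M = "restrict_space loeb0 finite_part"
  let ?h = "\<lambda>x. indicator finite_part x *\<^sub>R g (real_st N x)"
  have F: "finite_part \<inter> space loeb0 \<in> sets loeb0"
    using finite_part_sets by simp
  have eq: "st_pullback N (g_infty g) x = ?h x" if "x \<in> space loeb0" for x
    using that by (simp add: st_pullback_g_infty finite_part_def space_loeb0 indicator_def)
  have "(\<lambda>x. g (real_st N x)) \<in> borel_measurable ?M"
    using measurable_compose[OF real_st_measurable meas] .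
  then have "?h \<in> borel_measurable loeb0"
    by (simp add: borel_measurable_restrict_space_iff[OF F])
  then have m: "st_pullback N (g_infty g) \<in> borel_measurable loeb0"
    by (rule measurable_cong[THEN iffD2, rotated]) (rule eq)
  have "integrable ?M (\<lambda>x. g (real_st N x))"
    using int unfolding distr_real_st[symmetric] integrable_distr_eq[OF real_st_measurable meas] .
  then have "integrable loeb0 ?h"
    by (simp add: integrable_restrict_space[OF F])
  then have "integrable loeb0 (st_pullback N (g_infty g))"
    by (rule Bochner_Integration.integrable_cong[OF refl eq, THEN iffD2, rotated])
  then show "integrable (Loeb N \<eta>) (st_pullback N (g_infty g))"
    unfolding Loeb_eq integrable_completion[OF m] .
  have "integral\<^sup>L (Loeb N \<eta>) (st_pullback N (g_infty g)) = integral\<^sup>L loeb0 (st_pullback N (g_infty g))"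
    unfolding Loeb_eq by (rule integral_completion[OF m])
  also have "\<dots> = integral\<^sup>L loeb0 ?h"
    by (rule Bochner_Integration.integral_cong[OF refl eq])
  also have "\<dots> = integral\<^sup>L ?M (\<lambda>x. g (real_st N x))"
    by (rule integral_restrict_space[OF F, symmetric])
  also have "\<dots> = integral\<^sup>L lborel g"
    unfolding distr_real_st[symmetric] by (rule integral_distr[OF real_st_measurable meas, symmetric])
  finally show "integral\<^sup>L (Loeb N \<eta>) (st_pullback N (g_infty g)) = integral\<^sup>L lborel g" .
qed

end

theorem theorem17:
  fixes N :: "'s extension" and \<eta> :: 's and g :: "real \<Rightarrow> complex"
  assumes "nonstandard_extension N" and "countably_saturated N"
    and "\<eta> \<in> star_set N \<nat>" and "\<eta> \<notin> std N ` \<nat>"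
    and "g \<in> Schwartz"
  shows "S_integrable N \<eta> (g_eta N \<eta> g) \<and>
    (\<forall>x \<in> R_bar N \<eta>. ns_finite N (g_eta N \<eta> g x) \<and>
       complex_st N (g_eta N \<eta> g x) = st_pullback N (g_infty g) x) \<and>
    ns_finite N (int_lambda N \<eta> (R_bar N \<eta>) (g_eta N \<eta> g)) \<and>
    integrable (Loeb N \<eta>) (st_pullback N (g_infty g)) \<and>
    integrable lebesgue g \<and>
    complex_st N (int_lambda N \<eta> (R_bar N \<eta>) (g_eta N \<eta> g)) =
      (\<integral>x. st_pullback N (g_infty g) x \<partial>(Loeb N \<eta>)) \<and>
    (\<integral>x. st_pullback N (g_infty g) x \<partial>(Loeb N \<eta>)) = (\<integral>x. g x \<partial>lebesgue)"
proof -
  interpret ns_loeb N \<eta>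
    using assms by unfold_locales
  have meas: "g \<in> borel_measurable lborel"
    using Schwartz_measurable[OF assms(5)] by simp
  note loeb = integral_Loeb_st_pullback[OF Schwartz_measurable Schwartz_integrable, OF assms(5,5)]
  show ?thesis
  proof (intro conjI ballI)
    \<comment> \<open>\<open>lebesgue\<close> is the completion of \<open>lborel\<close>, and
      completion leaves integrals of measurable functions unchanged.\<close>
    show "integrable lebesgue g"
      using Schwartz_integrable[OF assms(5)] by (simp add: integrable_completion[OF meas])
    \<comment> \<open>The two sides meet at the Lebesgue integral of g, one through Riemann sums and
      the other through the image measure.\<close>
    show "complex_st N (int_lambda N \<eta> (R_bar N \<eta>) (g_eta N \<eta> g)) =
        (\<integral>x. st_pullback N (g_infty g) x \<partial>(Loeb N \<eta>))"
      unfolding int_lambda_g_eta(2)[OF assms(5)] loeb(2) ..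
    show "(\<integral>x. st_pullback N (g_infty g) x \<partial>(Loeb N \<eta>)) = (\<integral>x. g x \<partial>lebesgue)"
      unfolding loeb(2) integral_completion[OF meas] ..
  qed (fact S_integrable_g_eta[OF assms(5)] g_eta_standard_part[OF assms(5)]
      int_lambda_g_eta(1)[OF assms(5)] loeb(1))+
qed

end
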